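(* Let $\eta\in\mathbb R$, $\eta\ne0$. Consider the parametrized SCFIE $$-\tfrac{1+\nu}2\psi-K_2^\top(\nu I-2K_2^\top)\psi-\nu K_1^\top(I+2K_2^\top)\psi+2(R_1-R_2)S_2\psi+i\eta\nu S_1(I+2K_2^\top)\psi+i\eta(I-2K_1)S_2\psi=-g+i\eta f$$ with solution $\psi$, and its Nyström approximation: find $\psi_n\in\mathbb T_n$ with $$-\tfrac{1+\nu}2\psi_n-P_nK_{2,n}^\top(\nu I-2K_{2,n}^\top)\psi_n-\nu P_nK_{1,n}^\top(I+2K_{2,n}^\top)\psi_n+2P_n(R_{1,n}-R_{2,n})S_{2,n}\psi_n+i\eta\nu P_nS_{1,n}(I+2K_{2,n}^\top)\psi_n+i\eta P_n(I-2K_{1,n})S_{2,n}\psi_n=-P_ng+i\eta P_nf.$$ For all $n$ sufficiently large the discrete equation has a unique solution $\psi_n$. Moreover, for all $p\ge1$ and $q\ge0$ there is a constant $C_{p,q}$, depending only on $p$ and $q$, such that, for all sufficiently large $n$ and whenever $\psi\in H^{p+q}[0,2\pi]$, $$\|\psi_n-\psi\|_p\le C_{p,q}\,n^{-q}\|\psi\|_{p+q}.$$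
   Context: **Geometry and data.** $\Gamma\subset\mathbb R^2$ is a smooth simple closed curve bounding the bounded domain $D_2$, $D_1=\mathbb R^2\setminus\overline{D_2}$, $\mathbf n$ is the unit normal on $\Gamma$ exterior to $D_2$, and $\mathbf x:\mathbb R\to\mathbb R^2$ is a smooth $2\pi$-periodic regular parametrization of $\Gamma$ ($|\mathbf x'(t)|>0$). Let $\omega,\epsilon_1,\epsilon_2>0$, $k_j=\omega\sqrt{\epsilon_j}$ ($j=1,2$), $\nu\in\{1,\epsilon_1/\epsilon_2\}$. These data and $\eta$ are fixed. The incident field $u^{inc}$ satisfies $\Delta u^{inc}+k_1^2u^{inc}=0$ in $D_1$; $\gamma_D^1,\gamma_N^1$ denote exterior Dirichlet and Neumann (w.r.t. $\mathbf n$) traces on $\Gamma$. Set $f(t)=-(\gamma_D^1u^{inc})(\mathbf x(t))$, $g(t)=-|\mathbf x'(t)|(\gamma_N^1u^{inc})(\mathbf x(t))$. **Sobolev spaces.** $H^p[0,2\pi]$ is the $2\pi$-periodic Sobolev space with norm $\|\varphi\|_p^2=\sum_{m\in\mathbb Z}(1+m^2)^p|\widehat\varphi(m)|^2$, $\widehat\varphi(m)=\frac1{2\pi}\int_0^{2\pi}\varphi(t)e^{-imt}dt$. **Parametrized operators.** For $k>0$ let $G_k(\mathbf z)=\frac i4H_0^{(1)}(k|\mathbf z|)$ and $M_k(t,\tau)=G_k(\mathbf x(t)-\mathbf x(\tau))$; $H_k(t,\tau)=\frac{\partial G_k(\mathbf x(t)-\mathbf x(\tau))}{\partial\mathbf n(\mathbf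 x(\tau))}|\mathbf x'(\tau)|$; $H_k^\top(t,\tau)=H_k(\tau,t)$; $D_k(t,\tau)=k^2M_k(t,\tau)\,\mathbf x'(t)\cdot\mathbf x'(\tau)-\frac{\partial^2}{\partial t\,\partial\tau}\{M_k(t,\tau)+\frac1{4\pi}\ln(\sin^2\frac{t-\tau}2)\}$. $S_k,K_k,K_k^\top,R_k$ are the integral operators $\varphi\mapsto\int_0^{2\pi}(\cdot)(t,\tau)\varphi(\tau)d\tau$ with kernels $M_k,H_k,H_k^\top,D_k$. The parametrized hypersingular operator is $N_k=T_0+R_k$ with $(T_0\psi)(t)=\frac1{4\pi}\mathrm{PV}\int_0^{2\pi}\cot\frac{\tau-t}2\,\psi'(\tau)d\tau$, so $N_1-N_2=R_1-R_2$. A subscript $j\in\{1,2\}$ stands for $k_j$. The SCFIE is uniquely solvable. **Kernel splittings.** Write $\ell(t,\tau)=\ln(4\sin^2\frac{t-\tau}2)$. For $j=1,2$ fix decompositions $M_j=M_{j,1}\ell+M_{j,2}$, $H_j=H_{j,1}\ell+H_{j,2}$, $D_j=D_{j,1}\ell+D_{j,2}$, $H_j^\top=H_{j,1}^\top\sin^2(\frac{t-\tau}2)\ell+H_{j,2}^\top$ with smooth $2\pi$-biperiodic functions $M_{j,i},H_{j,i},D_{j,i},H_{j,i}^\top$ (analytic if $\mathbf x$ is), coming from the splitting of the Hankel functions into $J$ and $Y$ Bessel functions. **Discretization.** $\mathbb T_n$ is the space of $v(t)=\sum_{m=0}^na_m\cos mt+\sum_{m=1}^{n-1}b_m\sin mt$,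 and $P_n$ is interpolation in $\mathbb T_n$ at $t_j^{(n)}=j\pi/n$, $j=0,\dots,2n-1$. An operator $(L\varphi)(t)=\int_0^{2\pi}\rho(t-\tau)K(t,\tau)\varphi(\tau)d\tau$, with $K$ smooth biperiodic and $\rho(s)$ one of $\ln(4\sin^2\frac s2)$, $\sin^2(\frac s2)\ln(4\sin^2\frac s2)$, $1$, is discretized by $(L_n\varphi)(t)=\int_0^{2\pi}\rho(t-\tau)\,(P_n[K(t,\cdot)\varphi])(\tau)d\tau$. Applying this to each of the two terms of the decompositions $M_j=M_{j,1}\ell+M_{j,2}$, $H_j=H_{j,1}\ell+H_{j,2}$, $H_j^\top=H_{j,1}^\top\sin^2(\frac{t-\tau}2)\ell+H_{j,2}^\top$, $D_j=D_{j,1}\ell+D_{j,2}$ ($j=1,2$), and adding, gives $S_{j,n},K_{j,n},K_{j,n}^\top,R_{j,n}$. *)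

theory Defs
  imports "HOL-Analysis.Analysis"
begin

section \<open>Smoothness and periodicity\<close>

text \<open>\<open>C_k_on k f S\<close> is meant for open \<open>S\<close>: all iterated directional derivatives of \<open>f\<close>
  up to order \<open>k\<close> exist and are continuous on \<open>S\<close>.\<close>

primrec C_k_on ::
  "nat \<Rightarrow> ('a::euclidean_space \<Rightarrow> 'b::real_normed_vector) \<Rightarrow> 'a set \<Rightarrow> bool" where
  "C_k_on 0 f S = continuous_on S f"
| "C_k_on (Suc k) f S =
     ((\<forall>y\<in>S. f differentiable (at y)) \<and>
      (\<forall>v. C_k_on k (\<lambda>y. frechet_derivative f (at y) v) S))"

definition smooth :: "('a::euclidean_space \<Rightarrow> 'b::real_normed_vector) \<Rightarrow> bool" where
  "smooth f \<longleftrightarrow> (\<forall>k. C_k_on k f UNIV)"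

definition periodic_2pi :: "(real \<Rightarrow> 'a) \<Rightarrow> bool" where
  "periodic_2pi f \<longleftrightarrow> (\<forall>t. f (t + 2 * pi) = f t)"

definition smooth_biperiodic :: "(real \<Rightarrow> real \<Rightarrow> complex) \<Rightarrow> bool" where
  "smooth_biperiodic K \<longleftrightarrow>
     smooth (\<lambda>(t, \<tau>). K t \<tau>) \<and>
     (\<forall>\<tau>. periodic_2pi (\<lambda>t. K t \<tau>)) \<and> (\<forall>t. periodic_2pi (K t))"

section \<open>Periodic Sobolev spaces\<close>

text \<open>Elements of the Sobolev spaces are represented by functions on the real line; two functions
  that agree almost everywhere represent the same element. Only exponents \<open>p \<ge> 0\<close> are
  intended, so that every element is a square-integrable function.\<close>

definition fourier_coeff :: "(real \<Rightarrow> complex) \<Rightarrow> int \<Rightarrow> complex" where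
  "fourier_coeff \<phi> m =
     1 / (2 * of_real pi) * (LBINT t:{0..2*pi}. \<phi> t * exp (- \<i> * of_int m * of_real t))"

definition sobolev :: "real \<Rightarrow> (real \<Rightarrow> complex) set" where
  "sobolev p = {\<phi>. periodic_2pi \<phi> \<and> \<phi> \<in> borel_measurable borel \<and>
     set_integrable lborel {0..2*pi} (\<lambda>t. (cmod (\<phi> t))\<^sup>2) \<and>
     (\<lambda>m::int. (1 + (of_int m)\<^sup>2) powr p * (cmod (fourier_coeff \<phi> m))\<^sup>2) summable_on UNIV}"

definition sobolev_norm :: "real \<Rightarrow> (real \<Rightarrow> complex) \<Rightarrow> real" where
  "sobolev_norm p \<phi> =
     sqrt (\<Sum>\<^sub>\<infinity>m::int. (1 + (of_int m)\<^sup>2) powr p * (cmod (fourier_coeff \<phi> m))\<^sup>2)"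

section \<open>Geometry\<close>

abbreviation speed :: "(real \<Rightarrow> real^2) \<Rightarrow> real \<Rightarrow> real" where
  "speed x t \<equiv> norm (vector_derivative x (at t))"

definition regular_closed_param :: "(real \<Rightarrow> real^2) \<Rightarrow> bool" where
  "regular_closed_param x \<longleftrightarrow>
     smooth x \<and> periodic_2pi x \<and> inj_on x {0..<2*pi} \<and> (\<forall>t. speed x t > 0)"

definition interior_domain :: "(real \<Rightarrow> real^2) \<Rightarrow> (real^2) set" where
  "interior_domain x = inside (range x)"

definition exterior_domain :: "(real \<Rightarrow> real^2) \<Rightarrow> (real^2) set" where
  "exterior_domain x = - closure (interior_domain x)"

text \<open>The normal field is parametrized as well: \<open>nv t\<close> is the normal at the point \<open>x t\<close>.
  The three conditions determine \<open>nv\<close>.\<close>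

definition exterior_unit_normal :: "(real \<Rightarrow> real^2) \<Rightarrow> (real \<Rightarrow> real^2) \<Rightarrow> bool" where
  "exterior_unit_normal x nv \<longleftrightarrow>
     (\<forall>t. norm (nv t) = 1 \<and> nv t \<bullet> vector_derivative x (at t) = 0 \<and>
       (\<forall>\<^sub>F h in at_right 0. x t + h *\<^sub>R nv t \<in> exterior_domain x \<and>
                                x t - h *\<^sub>R nv t \<in> interior_domain x))"

section \<open>Incident fields\<close>

definition laplacian :: "(real^2 \<Rightarrow> complex) \<Rightarrow> real^2 \<Rightarrow> complex" where
  "laplacian u y =
     (\<Sum>b\<in>Basis. frechet_derivative (\<lambda>z. frechet_derivative u (at z) b) (at y) b)"

definition dirichlet_trace :: "(real \<Rightarrow> real^2) \<Rightarrow> (real^2 \<Rightarrow> complex) \<Rightarrow> real \<Rightarrow> complex" where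
  "dirichlet_trace x u t = Lim (at (x t) within exterior_domain x) u"

definition neumann_trace ::
  "(real \<Rightarrow> real^2) \<Rightarrow> (real \<Rightarrow> real^2) \<Rightarrow> (real^2 \<Rightarrow> complex) \<Rightarrow> real \<Rightarrow> complex" where
  "neumann_trace x nv u t =
     Lim (at_right 0) (\<lambda>h. frechet_derivative u (at (x t + h *\<^sub>R nv t)) (nv t))"

text \<open>The Dirichlet trace is the limit from within the exterior domain, the Neumann trace the
  limit of the normal derivative along the normal. They are required to exist at
  every point and to be continuous, since the discretization samples them at the nodes.\<close>

definition incident_field ::
  "(real \<Rightarrow> real^2) \<Rightarrow> (real \<Rightarrow> real^2) \<Rightarrow> real \<Rightarrow> (real^2 \<Rightarrow> complex) \<Rightarrow> bool" where
  "incident_field x nv k u \<longleftrightarrow>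
     C_k_on 2 u (exterior_domain x) \<and>
     (\<forall>y\<in>exterior_domain x. laplacian u y + of_real (k\<^sup>2) * u y = 0) \<and>
     (\<forall>t. (u \<longlongrightarrow> dirichlet_trace x u t) (at (x t) within exterior_domain x)) \<and>
     (\<forall>t. ((\<lambda>h. frechet_derivative u (at (x t + h *\<^sub>R nv t)) (nv t))
             \<longlongrightarrow> neumann_trace x nv u t) (at_right 0)) \<and>
     continuous_on UNIV (dirichlet_trace x u) \<and>
     continuous_on UNIV (neumann_trace x nv u)"

definition data_f :: "(real \<Rightarrow> real^2) \<Rightarrow> (real^2 \<Rightarrow> complex) \<Rightarrow> real \<Rightarrow> complex" where
  "data_f x u t = - dirichlet_trace x u t"

definition data_g ::
  "(real \<Rightarrow> real^2) \<Rightarrow> (real \<Rightarrow> real^2) \<Rightarrow> (real^2 \<Rightarrow> complex) \<Rightarrow> real \<Rightarrow> complex" where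
  "data_g x nv u t = - of_real (speed x t) * neumann_trace x nv u t"

section \<open>Kernels and integral operators\<close>

text \<open>\<open>bessel_Y0\<close> is meaningful only for positive arguments; the term \<open>m = 0\<close> of its series
  vanishes because \<open>harm 0 = 0\<close>.\<close>

definition bessel_J0 :: "real \<Rightarrow> real" where
  "bessel_J0 z = (\<Sum>m. (-1) ^ m / (fact m)\<^sup>2 * (z / 2) ^ (2 * m))"

definition bessel_Y0 :: "real \<Rightarrow> real" where
  "bessel_Y0 z = 2 / pi * (ln (z / 2) + euler_mascheroni) * bessel_J0 z
     + 2 / pi * (\<Sum>m. (-1) ^ Suc m * harm m / (fact m)\<^sup>2 * (z / 2) ^ (2 * m))"

definition hankel1_0 :: "real \<Rightarrow> complex" where
  "hankel1_0 z = of_real (bessel_J0 z) + \<i> * of_real (bessel_Y0 z)"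

definition helmholtz_G :: "real \<Rightarrow> real^2 \<Rightarrow> complex" where
  "helmholtz_G k z = \<i> / 4 * hankel1_0 (k * norm z)"

text \<open>The kernels below are meaningful only off the diagonal, that is for
  \<open>x t \<noteq> x \<tau>\<close>. In \<open>kernel_H\<close> the normal derivative acts on the second point \<open>x \<tau>\<close>.\<close>

definition kernel_M :: "(real \<Rightarrow> real^2) \<Rightarrow> real \<Rightarrow> real \<Rightarrow> real \<Rightarrow> complex" where
  "kernel_M x k t \<tau> = helmholtz_G k (x t - x \<tau>)"

definition kernel_H ::
  "(real \<Rightarrow> real^2) \<Rightarrow> (real \<Rightarrow> real^2) \<Rightarrow> real \<Rightarrow> real \<Rightarrow> real \<Rightarrow> complex" where
  "kernel_H x nv k t \<tau> =
     frechet_derivative (\<lambda>y. helmholtz_G k (x t - y)) (at (x \<tau>)) (nv \<tau>) * of_real (speed x \<tau>)"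

definition kernel_HT ::
  "(real \<Rightarrow> real^2) \<Rightarrow> (real \<Rightarrow> real^2) \<Rightarrow> real \<Rightarrow> real \<Rightarrow> real \<Rightarrow> complex" where
  "kernel_HT x nv k t \<tau> = kernel_H x nv k \<tau> t"

definition kernel_D :: "(real \<Rightarrow> real^2) \<Rightarrow> real \<Rightarrow> real \<Rightarrow> real \<Rightarrow> complex" where
  "kernel_D x k t \<tau> =
     of_real (k\<^sup>2) * kernel_M x k t \<tau>
       * of_real (vector_derivative x (at t) \<bullet> vector_derivative x (at \<tau>))
     - vector_derivative
         (\<lambda>s. vector_derivative
            (\<lambda>\<sigma>. kernel_M x k s \<sigma> + of_real (1 / (4 * pi) * ln ((sin ((s - \<sigma>) / 2))\<^sup>2))) (at \<tau>))
         (at t)"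

definition integral_op ::
  "(real \<Rightarrow> real \<Rightarrow> complex) \<Rightarrow> (real \<Rightarrow> complex) \<Rightarrow> real \<Rightarrow> complex" where
  "integral_op K \<phi> t = (LBINT \<tau>:{0..2*pi}. K t \<tau> * \<phi> \<tau>)"

section \<open>Kernel splittings and their discretization\<close>

definition w_log :: "real \<Rightarrow> real" where
  "w_log s = ln (4 * (sin (s / 2))\<^sup>2)"

definition w_sin2log :: "real \<Rightarrow> real" where
  "w_sin2log s = (sin (s / 2))\<^sup>2 * ln (4 * (sin (s / 2))\<^sup>2)"

definition w_one :: "real \<Rightarrow> real" where
  "w_one s = 1"

text \<open>The identity is imposed only off the (periodically continued) diagonal: on it the kernels
  are undefined, and the logarithm takes the conventional value \<open>ln 0 = 0\<close>.\<close>

definition is_splitting ::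
  "(real \<Rightarrow> real) \<Rightarrow> (real \<Rightarrow> real \<Rightarrow> complex) \<Rightarrow>
   (real \<Rightarrow> real \<Rightarrow> complex) \<Rightarrow> (real \<Rightarrow> real \<Rightarrow> complex) \<Rightarrow> bool" where
  "is_splitting \<rho> L L1 L2 \<longleftrightarrow>
     smooth_biperiodic L1 \<and> smooth_biperiodic L2 \<and>
     (\<forall>t \<tau>. sin ((t - \<tau>) / 2) \<noteq> 0 \<longrightarrow>
        L t \<tau> = L1 t \<tau> * of_real (\<rho> (t - \<tau>)) + L2 t \<tau>)"

definition trig_space :: "nat \<Rightarrow> (real \<Rightarrow> complex) set" where
  "trig_space n = {v. \<exists>a b. \<forall>t. v t =
     (\<Sum>m=0..n. a m * of_real (cos (real m * t))) +
     (\<Sum>m=1..<n. b m * of_real (sin (real m * t)))}"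

definition node :: "nat \<Rightarrow> nat \<Rightarrow> real" where
  "node n j = real j * pi / real n"

definition trig_interp :: "nat \<Rightarrow> (real \<Rightarrow> complex) \<Rightarrow> real \<Rightarrow> complex" where
  "trig_interp n \<phi> = (THE v. v \<in> trig_space n \<and> (\<forall>j<2*n. v (node n j) = \<phi> (node n j)))"

definition disc_op ::
  "nat \<Rightarrow> (real \<Rightarrow> real) \<Rightarrow> (real \<Rightarrow> real \<Rightarrow> complex) \<Rightarrow> (real \<Rightarrow> complex) \<Rightarrow> real \<Rightarrow> complex" where
  "disc_op n \<rho> K \<phi> t =
     (LBINT \<tau>:{0..2*pi}. of_real (\<rho> (t - \<tau>)) * trig_interp n (\<lambda>\<sigma>. K t \<sigma> * \<phi> \<sigma>) \<tau>)"

definition disc_split_op ::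
  "nat \<Rightarrow> (real \<Rightarrow> real) \<Rightarrow> (real \<Rightarrow> real \<Rightarrow> complex) \<Rightarrow> (real \<Rightarrow> real \<Rightarrow> complex) \<Rightarrow>
   (real \<Rightarrow> complex) \<Rightarrow> real \<Rightarrow> complex" where
  "disc_split_op n \<rho> L1 L2 \<phi> t = disc_op n \<rho> L1 \<phi> t + disc_op n w_one L2 \<phi> t"

section \<open>The single combined field integral equation\<close>

text \<open>The continuous and the discrete equation have the same left-hand side, up to the choice
  of the operators and of the outer projection \<open>Q\<close>: the identity in the first case,
  trigonometric interpolation in the second.\<close>

definition scfie_lhs ::
  "real \<Rightarrow> real \<Rightarrow> ((real \<Rightarrow> complex) \<Rightarrow> (real \<Rightarrow> complex)) \<Rightarrow>
   (nat \<Rightarrow> (real \<Rightarrow> complex) \<Rightarrow> (real \<Rightarrow> complex)) \<Rightarrow>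
   (nat \<Rightarrow> (real \<Rightarrow> complex) \<Rightarrow> (real \<Rightarrow> complex)) \<Rightarrow>
   (nat \<Rightarrow> (real \<Rightarrow> complex) \<Rightarrow> (real \<Rightarrow> complex)) \<Rightarrow>
   (nat \<Rightarrow> (real \<Rightarrow> complex) \<Rightarrow> (real \<Rightarrow> complex)) \<Rightarrow>
   (real \<Rightarrow> complex) \<Rightarrow> real \<Rightarrow> complex" where
  "scfie_lhs \<nu> \<eta> Q S K KT R \<psi> t =
     - of_real ((1 + \<nu>) / 2) * \<psi> t
     - Q (KT 2 (\<lambda>s. of_real \<nu> * \<psi> s - 2 * KT 2 \<psi> s)) t
     - of_real \<nu> * Q (KT 1 (\<lambda>s. \<psi> s + 2 * KT 2 \<psi> s)) t
     + 2 * Q (\<lambda>s. R 1 (S 2 \<psi>) s - R 2 (S 2 \<psi>) s) t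
     + \<i> * of_real \<eta> * of_real \<nu> * Q (S 1 (\<lambda>s. \<psi> s + 2 * KT 2 \<psi> s)) t
     + \<i> * of_real \<eta> * Q (\<lambda>s. S 2 \<psi> s - 2 * K 1 (S 2 \<psi>) s) t"

definition scfie_op ::
  "(real \<Rightarrow> real^2) \<Rightarrow> (real \<Rightarrow> real^2) \<Rightarrow> (nat \<Rightarrow> real) \<Rightarrow> real \<Rightarrow> real \<Rightarrow>
   (real \<Rightarrow> complex) \<Rightarrow> real \<Rightarrow> complex" where
  "scfie_op x nv k \<nu> \<eta> =
     scfie_lhs \<nu> \<eta> id
       (\<lambda>j. integral_op (kernel_M x (k j)))
       (\<lambda>j. integral_op (kernel_H x nv (k j)))
       (\<lambda>j. integral_op (kernel_HT x nv (k j)))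
       (\<lambda>j. integral_op (kernel_D x (k j)))"

text \<open>Here \<open>M j i\<close>, \<open>H j i\<close>, \<open>HT j i\<close>, \<open>D j i\<close> are the \<open>i\<close>-th terms (\<open>i = 1, 2\<close>) of the splittings of
  the respective kernels for the wave number \<open>k j\<close>.\<close>

definition scfie_disc_op ::
  "nat \<Rightarrow> real \<Rightarrow> real \<Rightarrow>
   (nat \<Rightarrow> nat \<Rightarrow> real \<Rightarrow> real \<Rightarrow> complex) \<Rightarrow> (nat \<Rightarrow> nat \<Rightarrow> real \<Rightarrow> real \<Rightarrow> complex) \<Rightarrow>
   (nat \<Rightarrow> nat \<Rightarrow> real \<Rightarrow> real \<Rightarrow> complex) \<Rightarrow> (nat \<Rightarrow> nat \<Rightarrow> real \<Rightarrow> real \<Rightarrow> complex) \<Rightarrow>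
   (real \<Rightarrow> complex) \<Rightarrow> real \<Rightarrow> complex" where
  "scfie_disc_op n \<nu> \<eta> M H HT D =
     scfie_lhs \<nu> \<eta> (trig_interp n)
       (\<lambda>j. disc_split_op n w_log (M j 1) (M j 2))
       (\<lambda>j. disc_split_op n w_log (H j 1) (H j 2))
       (\<lambda>j. disc_split_op n w_sin2log (HT j 1) (HT j 2))
       (\<lambda>j. disc_split_op n w_log (D j 1) (D j 2))"

text \<open>The continuous equation is an identity between elements of \<open>L\<^sup>2\<close>, hence almost
  everywhere; the discrete one is an identity in the trigonometric space, hence everywhere.\<close>

definition solves_scfie ::
  "(real \<Rightarrow> real^2) \<Rightarrow> (real \<Rightarrow> real^2) \<Rightarrow> (nat \<Rightarrow> real) \<Rightarrow> real \<Rightarrow> real \<Rightarrow>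
   (real \<Rightarrow> complex) \<Rightarrow> (real \<Rightarrow> complex) \<Rightarrow> bool" where
  "solves_scfie x nv k \<nu> \<eta> h \<psi> \<longleftrightarrow>
     \<psi> \<in> sobolev 0 \<and> (AE t in lborel. scfie_op x nv k \<nu> \<eta> \<psi> t = h t)"

definition scfie_uniquely_solvable ::
  "(real \<Rightarrow> real^2) \<Rightarrow> (real \<Rightarrow> real^2) \<Rightarrow> (nat \<Rightarrow> real) \<Rightarrow> real \<Rightarrow> real \<Rightarrow> bool" where
  "scfie_uniquely_solvable x nv k \<nu> \<eta> \<longleftrightarrow>
     (\<forall>h\<in>sobolev 0. \<exists>\<psi>. solves_scfie x nv k \<nu> \<eta> h \<psi> \<and>
        (\<forall>\<psi>'. solves_scfie x nv k \<nu> \<eta> h \<psi>' \<longrightarrow> (AE t in lborel. \<psi>' t = \<psi> t)))"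

definition solves_nystrom ::
  "nat \<Rightarrow> real \<Rightarrow> real \<Rightarrow>
   (nat \<Rightarrow> nat \<Rightarrow> real \<Rightarrow> real \<Rightarrow> complex) \<Rightarrow> (nat \<Rightarrow> nat \<Rightarrow> real \<Rightarrow> real \<Rightarrow> complex) \<Rightarrow>
   (nat \<Rightarrow> nat \<Rightarrow> real \<Rightarrow> real \<Rightarrow> complex) \<Rightarrow> (nat \<Rightarrow> nat \<Rightarrow> real \<Rightarrow> real \<Rightarrow> complex) \<Rightarrow>
   (real \<Rightarrow> complex) \<Rightarrow> (real \<Rightarrow> complex) \<Rightarrow> (real \<Rightarrow> complex) \<Rightarrow> bool" where
  "solves_nystrom n \<nu> \<eta> M H HT D f g \<psi>\<^sub>n \<longleftrightarrow>
     \<psi>\<^sub>n \<in> trig_space n \<and>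
     (\<forall>t. scfie_disc_op n \<nu> \<eta> M H HT D \<psi>\<^sub>n t =
        - trig_interp n g t + \<i> * of_real \<eta> * trig_interp n f t)"

end

theory Submission
  imports Defs "HOL-Library.Function_Algebras"
begin

text \<open>The whole problem is moved to Fourier coefficients. A smooth biperiodic kernel is a rapidly
  convergent double Fourier series
  \<open>\<Sum>(j, l). \<kappa> (j, l) * exp (\<i> j t) * exp (\<i> l \<tau>)\<close> (lemma
  \<open>smooth_biperiodic_double_series\<close>), and convolution with each of the three weights multiplies the
  coefficient of order \<open>m\<close> by a factor of size \<open>O(1 / m)\<close> (\<open>order_one_w_log\<close> and its companions).
  An integral operator therefore acts on coefficient sequences as \<open>ker_op\<close>: shift by \<open>l\<close>, multiply,
  shift by \<open>j\<close>, and sum against rapidly decaying numbers. Shifts cost powers of \<open>j\<close> and \<open>l\<close> that the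
  decay absorbs, and the multiplier gains one order of smoothness (\<open>sob_le_ker_op\<close>).

  The discretized operator is the same expression with trigonometric interpolation inserted
  after the shift by \<open>l\<close> (\<open>disc_op_fser\<close>). Hence the discretization error is \<open>ker_op\<close> applied to an
  interpolation error. For an argument of order \<open>p + q\<close> that error has size \<open>n\<close> to the power
  \<open>- (q + 1)\<close> in order \<open>p - 1\<close> (\<open>sob_le_interp_error\<close>), and the multiplier restores the lost
  order (\<open>approx_ker_op\<close>). Approximations of this kind are closed under sums and compositions.
  The integral equation thus reads \<open>c0 a + B a = r\<close> with \<open>c0 = - (1 + \<nu>) / 2 \<noteq> 0\<close> and \<open>B\<close> smoothing
  by one order, and its discretization reads \<open>c0 b + P B\<^sub>n b = P r\<close>, where \<open>P\<close> is interpolation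
  and \<open>B\<^sub>n\<close> approximates \<open>B\<close>.

  Unique solvability makes \<open>c0 + B\<close> injective. As \<open>B\<close> is compact, \<open>c0 + B\<close> is even bounded below
  in every Sobolev norm of order at least one (\<open>second_kind_coercive\<close>). The distance of \<open>P B\<^sub>n\<close>
  to \<open>B\<close> is \<open>O(1 / n)\<close> (\<open>nystrom_consistency\<close>), so \<open>c0 + P B\<^sub>n\<close> is bounded below uniformly for
  large \<open>n\<close> (\<open>nystrom_stability\<close>). On the finite-dimensional trigonometric space this gives unique
  solvability, and applied to the error \<open>b - a\<close>, for which
  \<open>(c0 + P B\<^sub>n) (b - a) = c0 (P a - a) + P (B - B\<^sub>n) a\<close>, it gives the rate (\<open>nystrom_residual\<close>).

  One analytic fact links functions with sequences: an integrable function orthogonal to all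
  modes vanishes almost everywhere (\<open>orth_modes_imp_AE_zero\<close>). So every element of a Sobolev
  space of order at least one is almost everywhere the sum of its Fourier series.\<close>

section \<open>Fourier modes and periodic integrals\<close>

definition mode :: "int \<Rightarrow> real \<Rightarrow> complex" where
  "mode m t = cis (of_int m * t)"

lemma mode_0 [simp]: "mode 0 t = 1"
  by (simp add: mode_def)

lemma mode_at_0 [simp]: "mode m 0 = 1"
  by (simp add: mode_def)

lemma norm_mode [simp]: "norm (mode m t) = 1"
  by (simp add: mode_def)

lemma mode_nonzero [simp]: "mode m t \<noteq> 0"
  using norm_mode[of m t] by (metis norm_zero zero_neq_one)

lemma mode_add: "mode (j + l) t = mode j t * mode l t"
  by (simp add: mode_def cis_mult algebra_simps)

lemma mode_diff_arg: "mode m (t - s) = mode m t * mode (- m) s"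
  by (simp add: mode_def cis_mult algebra_simps)

lemma exp_mode: "exp (- \<i> * of_int m * of_real t) = mode (- m) t"
  by (simp add: mode_def cis_conv_exp mult_ac)

lemma continuous_mode [continuous_intros]:
  "continuous_on A f \<Longrightarrow> continuous_on A (\<lambda>x. mode m (f x))"
  unfolding mode_def by (intro continuous_intros)

lemma mode_2pi: "mode m (2 * pi) = 1"
  by (metis cis_multiple_2pi Ints_of_int mode_def mult.commute)

lemma periodic_mode: "periodic_2pi (mode m)"
  unfolding periodic_2pi_def
proof
  fix t
  have "mode m (t + 2 * pi) = mode m t * mode m (2 * pi)"
    by (simp add: mode_def cis_mult algebra_simps)
  then show "mode m (t + 2 * pi) = mode m t" by (simp add: mode_2pi)
qed

lemma has_vector_derivative_mode:
  "(mode m has_vector_derivative (\<i> * of_int m * mode m t)) (at t within A)"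
proof -
  have "((\<lambda>z. exp (\<i> * of_int m * z)) has_field_derivative (exp (\<i> * of_int m * of_real t) * (\<i> * of_int m))) (at (of_real t))"
    by (auto intro!: derivative_eq_intros)
  from has_vector_derivative_real_field[OF this, of A]
  moreover have "mode m = (\<lambda>x. exp (\<i> * of_int m * of_real x))"
    by (auto simp: mode_def cis_conv_exp mult_ac)
  ultimately show ?thesis by (simp add: mult_ac)
qed

lemma integrable_continuous_period:
  fixes f :: "real \<Rightarrow> complex"
  assumes "continuous_on {0..2*pi} f"
  shows "set_integrable lborel {0..2*pi} f"
  using assms by (rule borel_integrable_atLeastAtMost')

lemma LBINT_period_eq_integral:
  fixes f :: "real \<Rightarrow> complex"
  assumes "set_integrable lborel {0..2*pi} f"
  shows "(LBINT t:{0..2*pi}. f t) = integral {0..2*pi} f"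
  by (rule set_borel_integral_eq_integral(2)[OF assms])

lemma LBINT_mode: "(LBINT t:{0..2*pi}. mode m t) = (if m = 0 then 2 * of_real pi else 0)"
proof (cases "m = 0")
  case True
  have "(LBINT t:{0..2*pi}. (1::complex)) = of_real (2*pi)"
    by (subst LBINT_period_eq_integral) (auto intro!: integrable_continuous_period simp: scaleR_conv_of_real)
  then show ?thesis using True by simp
next
  case False
  have "((\<lambda>t. \<i> * of_int m * mode m t) has_integral (mode m (2*pi) - mode m 0)) {0..2*pi}"
    by (intro fundamental_theorem_of_calculus has_vector_derivative_mode) auto
  then have "integral {0..2*pi} (\<lambda>t. \<i> * of_int m * mode m t) = 0"
    by (simp only: mode_2pi mode_at_0 diff_self integral_unique)
  then have "(LBINT t:{0..2*pi}. \<i> * of_int m * mode m t) = 0"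
    by (subst LBINT_period_eq_integral) (auto intro!: integrable_continuous_period continuous_intros)
  then show ?thesis using False by (simp only: set_integral_mult_right) simp
qed

lemma fourier_coeff_alt:
  "fourier_coeff f m = 1 / (2 * of_real pi) * (LBINT t:{0..2*pi}. f t * mode (- m) t)"
  by (simp only: fourier_coeff_def exp_mode)

lemma periodic_2pi_of_int: "periodic_2pi f \<Longrightarrow> f (t + of_int k * (2 * pi)) = f t"
proof (induction k rule: int_induct[where k = 0])
  case (step1 i)
  have "f (t + of_int (i + 1) * (2 * pi)) = f ((t + of_int i * (2*pi)) + 2 * pi)"
    by (simp add: algebra_simps)
  then show ?case using step1 unfolding periodic_2pi_def by metis
next
  case (step2 i)
  have "f (t + of_int (i - 1) * (2 * pi)) = f ((t + of_int (i - 1) * (2*pi)) + 2 * pi)"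
    using step2(3) unfolding periodic_2pi_def by metis
  also have "\<dots> = f (t + of_int i * (2 * pi))"
    by (simp add: algebra_simps)
  finally show ?case using step2 by simp
qed simp

lemma integrable_translate_interval:
  fixes f :: "real \<Rightarrow> complex"
  shows "set_integrable lborel {a..b} (\<lambda>s. f (s + c)) \<longleftrightarrow> set_integrable lborel {a+c..b+c} f"
    and "(LBINT s:{a..b}. f (s + c)) = (LBINT s:{a+c..b+c}. f s)"
proof -
  have i: "indicator {a..b} s = (indicator {a+c..b+c} (c + 1 * s) :: real)" for s
    by (auto simp: indicator_def)
  have e: "(\<lambda>s. indicat_real {a..b} s *\<^sub>R f (s + c))
      = (\<lambda>s. (\<lambda>u. indicat_real {a+c..b+c} u *\<^sub>R f u) (c + 1 * s))"
    by (auto simp: i add.commute)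
  show "set_integrable lborel {a..b} (\<lambda>s. f (s + c)) \<longleftrightarrow> set_integrable lborel {a+c..b+c} f"
    unfolding set_integrable_def e by (subst lborel_integrable_real_affine_iff) auto
  show "(LBINT s:{a..b}. f (s + c)) = (LBINT s:{a+c..b+c}. f s)"
    unfolding set_lebesgue_integral_def e
    by (subst lborel_integral_real_affine[of 1 "\<lambda>u. indicat_real {a+c..b+c} u *\<^sub>R f u" c]) auto
qed

lemma set_integral_split_point:
  fixes f :: "real \<Rightarrow> complex"
  assumes "set_integrable lborel {a..c} f" "a \<le> b" "b \<le> c"
  shows "(LBINT s:{a..c}. f s) = (LBINT s:{a..b}. f s) + (LBINT s:{b..c}. f s)"
proof -
  have 1: "set_integrable lborel {a..b} f" and 2: "set_integrable lborel {b<..c} f"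
    using assms by (auto intro: set_integrable_subset)
  have "{a..c} = {a..b} \<union> {b<..c}" using assms by auto
  moreover have "{a..b} \<inter> {b<..c} = {}" by auto
  ultimately have "(LBINT s:{a..c}. f s) = (LBINT s:{a..b}. f s) + (LBINT s:{b<..c}. f s)"
    using set_integral_Un[OF _ 1 2] by metis
  also have "(LBINT s:{b<..c}. f s) = (LBINT s:{b..c}. f s)"
    by (rule set_integral_discrete_difference[of "{b}"]) auto
  finally show ?thesis .
qed

lemma periodic_integral_translate:
  fixes f :: "real \<Rightarrow> complex"
  assumes per: "periodic_2pi f" and int: "set_integrable lborel {0..2*pi} f"
  shows "set_integrable lborel {c..c+2*pi} f" and "(LBINT s:{c..c+2*pi}. f s) = (LBINT s:{0..2*pi}. f s)"
proof -
  \<comment> \<open>shifts within one period; the others differ from these by full periods\<close>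
  have main: "set_integrable lborel {c..c+2*pi} f \<and> (LBINT s:{c..c+2*pi}. f s) = (LBINT s:{0..2*pi}. f s)"
    if c: "0 \<le> c" "c \<le> 2 * pi" for c
  proof -
    have per': "(\<lambda>s. f (s + 2 * pi)) = f" using per by (auto simp: periodic_2pi_def)
    have i1: "set_integrable lborel {c..2*pi} f" "set_integrable lborel {0..c} f"
      by (rule set_integrable_subset[OF int]; use c in auto)+
    have i2: "set_integrable lborel {2*pi..c+2*pi} f"
      using i1(2) integrable_translate_interval(1)[of 0 c f "2*pi"] by (simp add: per')
    have v2: "(LBINT s:{2*pi..c+2*pi}. f s) = (LBINT s:{0..c}. f s)"
      using integrable_translate_interval(2)[of 0 c f "2*pi"] by (simp add: per')
    have "{c..c+2*pi} = {c..2*pi} \<union> {2*pi..c+2*pi}" using c by auto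
    with i1 i2 have i3: "set_integrable lborel {c..c+2*pi} f"
      by (simp add: set_integrable_Un)
    have "(LBINT s:{c..c+2*pi}. f s) = (LBINT s:{c..2*pi}. f s) + (LBINT s:{0..c}. f s)"
      using set_integral_split_point[OF i3, of "2*pi"] c v2 by simp
    also have "\<dots> = (LBINT s:{0..2*pi}. f s)"
      using set_integral_split_point[OF int, of c] c by simp
    finally show ?thesis using i3 by simp
  qed
  define k where "k = \<lfloor>c / (2*pi)\<rfloor>"
  define d where "d = c - of_int k * (2 * pi)"
  have kf: "of_int k \<le> c / (2*pi)" "c / (2*pi) < of_int k + 1"
    unfolding k_def by linarith+
  have d: "0 \<le> d" "d \<le> 2 * pi"
    using kf by (auto simp: d_def field_simps)
  have per': "(\<lambda>s. f (s + of_int k * (2 * pi))) = f"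
    using periodic_2pi_of_int[OF per] by auto
  show "set_integrable lborel {c..c+2*pi} f"
    using main[OF d] integrable_translate_interval(1)[of d "d+2*pi" f "of_int k * (2*pi)"]
    by (simp add: per' d_def)
  show "(LBINT s:{c..c+2*pi}. f s) = (LBINT s:{0..2*pi}. f s)"
    using main[OF d] integrable_translate_interval(2)[of d "d+2*pi" f "of_int k * (2*pi)"]
    by (simp add: per' d_def)
qed

text \<open>The reflected period is the translated interval from \<open>t - 2 * pi\<close> to \<open>t\<close>, and all periods
  carry the same integral.\<close>

lemma periodic_integral_reflect:
  fixes f :: "real \<Rightarrow> complex"
  assumes per: "periodic_2pi f" and int: "set_integrable lborel {0..2*pi} f"
  shows "set_integrable lborel {0..2*pi} (\<lambda>s. f (t - s))"
    and "(LBINT s:{0..2*pi}. f (t - s)) = (LBINT s:{0..2*pi}. f s)"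
proof -
  let ?g = "\<lambda>u. indicat_real {t - 2*pi..t - 2*pi + 2*pi} u *\<^sub>R f u"
  have e: "(\<lambda>s. indicat_real {0..2*pi} s *\<^sub>R f (t - s)) = (\<lambda>s. ?g (t + (-1) * s))"
    by (auto simp: indicator_def)
  note I = periodic_integral_translate[OF per int, of "t - 2*pi"]
  show "set_integrable lborel {0..2*pi} (\<lambda>s. f (t - s))"
    unfolding set_integrable_def e
    using I(1) unfolding set_integrable_def by (subst lborel_integrable_real_affine_iff) auto
  have "(LBINT s:{0..2*pi}. f (t - s)) = (\<integral>s. ?g (t + (-1) * s) \<partial>lborel)"
    unfolding set_lebesgue_integral_def e ..
  also have "\<dots> = (\<integral>u. ?g u \<partial>lborel)"
    using lborel_integral_real_affine[of "-1" ?g t] by simp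
  also have "\<dots> = (LBINT s:{0..2*pi}. f s)"
    using I(2) unfolding set_lebesgue_integral_def .
  finally show "(LBINT s:{0..2*pi}. f (t - s)) = (LBINT s:{0..2*pi}. f s)" .
qed

section \<open>Functions orthogonal to all modes\<close>

lemma set_integrable_mult_bounded:
  fixes \<phi> g :: "real \<Rightarrow> complex"
  assumes \<phi>: "set_integrable lborel A \<phi>" and g[measurable]: "g \<in> borel_measurable borel"
    and B: "\<And>x. norm (g x) \<le> B"
  shows "set_integrable lborel A (\<lambda>x. \<phi> x * g x)"
proof -
  let ?h = "\<lambda>x. indicat_real A x *\<^sub>R \<phi> x"
  have h: "integrable lborel ?h" using \<phi> by (simp add: set_integrable_def)
  have h': "integrable lborel (\<lambda>x. of_real B * ?h x)"
    by (subst mult.commute, rule integrable_mult_left) (rule h)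
  from h have [measurable]: "?h \<in> borel_measurable borel" by auto
  have "integrable lborel (\<lambda>x. ?h x * g x)"
  proof (rule Bochner_Integration.integrable_bound)
    show "integrable lborel (\<lambda>x. of_real B * ?h x)" by (rule h')
    show "AE x in lborel. norm (?h x * g x) \<le> norm (of_real B * ?h x)"
    proof (rule AE_I2)
      fix x :: real
      have "norm (g x) \<le> \<bar>B\<bar>" using B[of x] by linarith
      then show "norm (?h x * g x) \<le> norm (of_real B * ?h x)"
        using mult_right_mono[of "norm (g x)" "\<bar>B\<bar>" "indicat_real A x * norm (\<phi> x)"]
        by (simp add: norm_mult mult_ac)
    qed
  qed measurable
  then show ?thesis by (simp add: set_integrable_def mult_ac)
qed

lemma set_integral_mult_norm_le:
  fixes \<phi> g :: "real \<Rightarrow> complex"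
  assumes \<phi>: "set_integrable lborel A \<phi>" and g[measurable]: "g \<in> borel_measurable borel"
    and B: "\<And>x. norm (g x) \<le> B"
  shows "norm (LBINT x:A. \<phi> x * g x) \<le> B * (LBINT x:A. norm (\<phi> x))"
proof -
  have i: "integrable lborel (\<lambda>x. indicat_real A x *\<^sub>R \<phi> x)" using \<phi> by (simp add: set_integrable_def)
  have "norm (LBINT x:A. \<phi> x * g x) \<le> (LINT x|lborel. B * (indicat_real A x * norm (\<phi> x)))"
    unfolding set_lebesgue_integral_def
  proof (rule Bochner_Integration.integral_norm_bound_integral)
    show "integrable lborel (\<lambda>x. indicat_real A x *\<^sub>R (\<phi> x * g x))"
      using set_integrable_mult_bounded[OF \<phi> g B] by (simp add: set_integrable_def)
    show "integrable lborel (\<lambda>x. B * (indicat_real A x * norm (\<phi> x)))"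
      using integrable_norm[OF i] by (simp add: )
    show "norm (indicat_real A x *\<^sub>R (\<phi> x * g x)) \<le> B * (indicat_real A x * norm (\<phi> x))" for x
      using mult_left_mono[OF B[of x], of "indicat_real A x * norm (\<phi> x)"]
      by (simp add: norm_mult mult_ac)
  qed
  then show ?thesis by (simp add: set_lebesgue_integral_def)
qed

definition orth_modes :: "(real \<Rightarrow> complex) \<Rightarrow> bool" where
  "orth_modes \<phi> \<longleftrightarrow> set_integrable lborel {0..2*pi} \<phi> \<and>
     (\<forall>m. (LBINT t:{0..2*pi}. \<phi> t * mode m t) = 0)"

lemma borel_measurable_mode [measurable]: "mode m \<in> borel_measurable borel"
  by (intro borel_measurable_continuous_onI continuous_intros)

lemma orth_modes_mult_mode: "orth_modes \<phi> \<Longrightarrow> orth_modes (\<lambda>t. \<phi> t * mode l t)"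
  unfolding orth_modes_def
  by (auto intro!: set_integrable_mult_bounded[where B = 1] simp: mult.assoc simp flip: mode_add)

lemma orth_modes_scale: "orth_modes \<phi> \<Longrightarrow> orth_modes (\<lambda>t. c * \<phi> t)"
  unfolding orth_modes_def by (auto simp: mult.assoc)

lemma orth_modes_add:
  assumes "orth_modes \<phi>" "orth_modes \<psi>" shows "orth_modes (\<lambda>t. \<phi> t + \<psi> t)"
proof -
  have "(LBINT t:{0..2*pi}. (\<phi> t + \<psi> t) * mode m t) = 0" for m
    unfolding distrib_right using assms
    by (subst set_integral_add)
       (auto simp: orth_modes_def intro!: set_integrable_mult_bounded[where B = 1])
  then show ?thesis using assms by (simp add: orth_modes_def set_integral_add)
qed

text \<open>A linear function of \<open>cis t\<close> is a combination of the modes \<open>1\<close> and \<open>- 1\<close>. Products are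
  handled by generalizing over \<open>\<phi>\<close>: one factor is absorbed into it before the other is
  treated.\<close>

lemma orth_modes_mult_polynomial:
  fixes p :: "complex \<Rightarrow> real"
  assumes "real_polynomial_function p" "orth_modes \<phi>"
  shows "orth_modes (\<lambda>t. \<phi> t * of_real (p (cis t)))"
  using assms
proof (induction arbitrary: \<phi>)
  case (linear f)
  interpret bounded_linear f by fact
  have f: "f (cis t) = cos t * f 1 + sin t * f \<i>" for t
  proof -
    have "f (cis t) = f (cos t *\<^sub>R 1 + sin t *\<^sub>R \<i>)"
      by (rule arg_cong[of _ _ f]) (simp add: complex_eq_iff)
    then show ?thesis by (simp only: add scaleR) simp
  qed
  have "of_real (f (cis t)) = ((of_real (f 1) - \<i> * of_real (f \<i>)) / 2) * mode 1 t
          + ((of_real (f 1) + \<i> * of_real (f \<i>)) / 2) * mode (- 1) t" for t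
    by (auto simp: f mode_def complex_eq_iff field_simps)
  then have e: "(\<lambda>t. \<phi> t * of_real (f (cis t))) =
     (\<lambda>t. ((of_real (f 1) - \<i> * of_real (f \<i>)) / 2) * (\<phi> t * mode 1 t)
        + ((of_real (f 1) + \<i> * of_real (f \<i>)) / 2) * (\<phi> t * mode (- 1) t))"
    by (auto simp: algebra_simps)
  show ?case unfolding e
    by (intro orth_modes_add orth_modes_scale orth_modes_mult_mode linear.prems)
next
  case (const c)
  show ?case using orth_modes_scale[OF const, of "of_real c"] by (simp add: mult_ac)
next
  case (add f g)
  show ?case using orth_modes_add[OF add.IH(1)[OF add.prems] add.IH(2)[OF add.prems]]
    by (simp add: algebra_simps)
next
  case (mult f g)
  show ?case using mult.IH(2)[OF mult.IH(1)[OF mult.prems]] by (simp add: mult_ac)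
qed

text \<open>By the theorem of Stone and Weierstrass a continuous function is uniformly close to a
  polynomial on the unit circle, and an integrable \<open>\<phi>\<close> turns a uniformly small error into a
  small integral.\<close>

lemma orth_modes_continuous:
  fixes f :: "complex \<Rightarrow> real"
  assumes \<phi>: "orth_modes \<phi>" and f: "continuous_on UNIV f"
  shows "(LBINT t:{0..2*pi}. \<phi> t * of_real (f (cis t))) = 0"
proof -
  let ?I = "LBINT t:{0..2*pi}. norm (\<phi> t)"
  have int: "set_integrable lborel {0..2*pi} \<phi>" using \<phi> by (simp add: orth_modes_def)
  have I0: "?I \<ge> 0" by (simp add: set_lebesgue_integral_def)
  have le: "norm (LBINT t:{0..2*pi}. \<phi> t * of_real (f (cis t))) \<le> e * ?I" if e: "e > 0" for e
  proof -
    obtain g where g: "polynomial_function g" "\<And>z. z \<in> sphere 0 1 \<Longrightarrow> norm (f z - g z) < e"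
      using Stone_Weierstrass_polynomial_function[of "sphere 0 1 :: complex set" f e] e
        continuous_on_subset[OF f] by auto
    have g': "real_polynomial_function g" using g(1) by (simp add: real_polynomial_function_eq)
    from orth_modes_mult_polynomial[OF g' \<phi>]
    have z: "(LBINT t:{0..2*pi}. \<phi> t * of_real (g (cis t)) * mode 0 t) = 0" 
      and ig: "set_integrable lborel {0..2*pi} (\<lambda>t. \<phi> t * of_real (g (cis t)))"
      unfolding orth_modes_def by blast+
    have cg: "continuous_on UNIV (\<lambda>t. g (cis t))"
      by (intro continuous_on_compose2[OF continuous_on_polymonial_function[OF g(1)]] continuous_intros) auto
    have cf: "continuous_on UNIV (\<lambda>t. f (cis t))"
      by (intro continuous_on_compose2[OF f] continuous_intros) auto
    have d: "norm (of_real (f (cis t)) - of_real (g (cis t)) :: complex) \<le> e" for t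
      using g(2)[of "cis t"] by (metis less_eq_real_def mem_sphere_0 norm_cis norm_of_real of_real_diff real_norm_def)
    have m: "(\<lambda>t. of_real (f (cis t)) - of_real (g (cis t)) :: complex) \<in> borel_measurable borel"
      by (intro borel_measurable_continuous_onI continuous_intros cf cg)
    note i = set_integrable_mult_bounded[OF int m d]
    have "(LBINT t:{0..2*pi}. \<phi> t * of_real (f (cis t)))
       = (LBINT t:{0..2*pi}. \<phi> t * (of_real (f (cis t)) - of_real (g (cis t))) + \<phi> t * of_real (g (cis t)))"
      by (simp add: algebra_simps)
    also have "\<dots> = (LBINT t:{0..2*pi}. \<phi> t * (of_real (f (cis t)) - of_real (g (cis t))))"
      using z by (subst set_integral_add[OF i ig]) simp
    finally show ?thesis using set_integral_mult_norm_le[OF int m d] by simp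
  qed
  have "norm (LBINT t:{0..2*pi}. \<phi> t * of_real (f (cis t))) \<le> 0"
  proof (rule field_le_epsilon)
    fix e :: real assume e: "e > 0"
    have "e / (?I + 1) * ?I \<le> e" using e I0 by (simp add: field_simps)
    moreover have "e / (?I + 1) > 0" using e I0 by simp
    ultimately show "norm (LBINT t:{0..2*pi}. \<phi> t * of_real (f (cis t))) \<le> 0 + e"
      using le[of "e / (?I + 1)"] by linarith
  qed
  then show ?thesis by simp
qed

lemma cis_inj_period: "\<lbrakk>cis s = cis t; s \<in> {0..<2*pi}; t \<in> {0..<2*pi}\<rbrakk> \<Longrightarrow> s = t"
proof -
  assume a: "cis s = cis t" "s \<in> {0..<2*pi}" "t \<in> {0..<2*pi}"
  then have "sin s = sin t \<and> cos s = cos t" by (simp add: complex_eq_iff)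
  then obtain n :: int where n: "s = t + 2 * pi * n" using sin_cos_eq_iff by auto
  have "0 \<le> s" "s < 2 * pi" "0 \<le> t" "t < 2 * pi" using a by auto
  then have "2 * pi * n < 2 * pi * 1" "2 * pi * (-1) < 2 * pi * n" using n by linarith+
  moreover have "0 < 2 * pi" by simp
  ultimately have "real_of_int n < 1" "-1 < real_of_int n"
    unfolding mult_less_cancel_left_pos[OF \<open>0 < 2 * pi\<close>] by blast+
  then show ?thesis using n by simp
qed

text \<open>The indicator function of the closed set is a pointwise limit of continuous functions of the
  distance to its image on the circle. The point \<open>2 * pi\<close> is left out because \<open>cis\<close> identifies
  it with \<open>0\<close>.\<close>

lemma orth_modes_closed:
  assumes \<phi>: "orth_modes \<phi>" and T: "closed T" "T \<subseteq> {0..<2*pi}"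
  shows "(LBINT t:T. \<phi> t) = 0"
proof (cases "T = {}")
  case False
  define S where "S = cis ` T"
  have "bounded T" using T(2) bounded_subset[of "{0..2*pi}" T] by force
  then have "compact T" using T(1) by (simp add: compact_eq_bounded_closed)
  then have "compact S" unfolding S_def
    by (intro compact_continuous_image continuous_intros)
  then have S: "closed S" "S \<noteq> {}" using False by (auto simp: compact_imp_closed S_def)
  define f where "f = (\<lambda>k::nat. \<lambda>z::complex. max 0 (1 - real k * infdist z S))"
  have cf: "continuous_on UNIV (f k)" for k
    unfolding f_def by (intro continuous_intros)
  have mf [measurable]: "(\<lambda>t. of_real (f k (cis t)) :: complex) \<in> borel_measurable borel" for k
    by (intro borel_measurable_continuous_onI continuous_intros continuous_on_compose2[OF cf[of k]]) auto
  have fb: "norm (f k z) \<le> 1" for k z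
    unfolding f_def by (simp add: infdist_nonneg)
  have int: "integrable lborel (\<lambda>t. indicat_real {0..2*pi} t *\<^sub>R \<phi> t)"
    using \<phi> by (simp add: orth_modes_def set_integrable_def)
  then have m [measurable]: "(\<lambda>t. indicat_real {0..2*pi} t *\<^sub>R \<phi> t) \<in> borel_measurable borel" by auto
  have Tm [measurable]: "T \<in> sets borel" using T(1) by auto
  have e: "(\<lambda>t. indicat_real T t *\<^sub>R \<phi> t) = (\<lambda>t. indicat_real T t *\<^sub>R (indicat_real {0..2*pi} t *\<^sub>R \<phi> t))"
    using T(2) by (auto simp: indicator_def fun_eq_iff)
  have conv: "(\<lambda>k. (indicat_real {0..2*pi} t *\<^sub>R \<phi> t) * of_real (f k (cis t)))
       \<longlonglongrightarrow> indicat_real T t *\<^sub>R \<phi> t" if elim: "t \<noteq> 2 * pi" for t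
  proof (cases "t \<in> {0..2*pi}")
    case False
    then have "t \<notin> T" using T(2) by auto
    then have "indicat_real T t = 0" by (rule indicator_simps(2))
    moreover have "indicat_real {0..2*pi} t = 0" using False by (rule indicator_simps(2))
    ultimately show ?thesis by (simp only: scaleR_zero_left mult_zero_left tendsto_const)
  next
    case True
    then have "0 \<le> t" "t \<le> 2 * pi" by auto
    moreover from this(2) elim have "t < 2 * pi" by (simp only: less_le not_False_eq_True)
    ultimately have t: "t \<in> {0..<2*pi}" by (simp only: atLeastLessThan_iff)
    have "(\<lambda>k. of_real (f k (cis t)) :: complex) \<longlonglongrightarrow> of_real (indicator T t)"
    proof (cases "t \<in> T")
      case True
      then have "f k (cis t) = 1" for k by (simp add: f_def S_def)
      with True show ?thesis by simp
    next
      case False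
      have "cis t \<notin> S"
      proof
        assume "cis t \<in> S"
        then obtain s where "s \<in> T" "cis t = cis s" by (auto simp: S_def)
        with cis_inj_period[of t s] t T(2) False show False by auto
      qed
      then have pos: "infdist (cis t) S > 0"
        using S by (metis in_closed_iff_infdist_zero infdist_nonneg less_eq_real_def)
      obtain K :: nat where K: "1 / infdist (cis t) S < K" using reals_Archimedean2 by blast
      have "f k (cis t) = 0" if "k \<ge> K" for k
      proof -
        have "1 / infdist (cis t) S < k" using K that by linarith
        then show ?thesis using pos by (simp add: f_def field_simps)
      qed
      then have "eventually (\<lambda>k. of_real (f k (cis t)) = (0::complex)) sequentially"
        by (auto simp: eventually_sequentially)
      with False show ?thesis by (simp add: tendsto_eventually)
    qed
    from tendsto_mult_left[OF this, of "\<phi> t"] True show ?thesis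
      by (simp add: scaleR_conv_of_real mult_ac)
  qed
  have "(\<lambda>k. LINT t|lborel. (indicat_real {0..2*pi} t *\<^sub>R \<phi> t) * of_real (f k (cis t)))
           \<longlonglongrightarrow> (LINT t|lborel. indicat_real T t *\<^sub>R \<phi> t)"
  proof (rule integral_dominated_convergence[where w = "\<lambda>t. norm (indicat_real {0..2*pi} t *\<^sub>R \<phi> t)"])
    show "(\<lambda>t. indicat_real T t *\<^sub>R \<phi> t) \<in> borel_measurable lborel"
      unfolding e by measurable
    show "AE t in lborel. (\<lambda>k. (indicat_real {0..2*pi} t *\<^sub>R \<phi> t) * of_real (f k (cis t)))
       \<longlonglongrightarrow> indicat_real T t *\<^sub>R \<phi> t"
      by (rule AE_mp[OF AE_lborel_singleton[of "2*pi"]], rule AE_I2, rule impI, rule conv)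
    show "AE t in lborel. norm ((indicat_real {0..2*pi} t *\<^sub>R \<phi> t) * of_real (f k (cis t)))
       \<le> norm (indicat_real {0..2*pi} t *\<^sub>R \<phi> t)" for k
    proof (rule AE_I2)
      fix t
      show "norm ((indicat_real {0..2*pi} t *\<^sub>R \<phi> t) * of_real (f k (cis t)))
         \<le> norm (indicat_real {0..2*pi} t *\<^sub>R \<phi> t)"
        using mult_left_mono[OF fb[of k "cis t"], of "norm (indicat_real {0..2*pi} t *\<^sub>R \<phi> t)"]
        by (simp add: norm_mult mult.assoc)
    qed
    show "integrable lborel (\<lambda>t. norm (indicat_real {0..2*pi} t *\<^sub>R \<phi> t))"
      by (rule integrable_norm[OF int])
    show "(\<lambda>t. (indicat_real {0..2*pi} t *\<^sub>R \<phi> t) * of_real (f k (cis t))) \<in> borel_measurable lborel" for k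
      using borel_measurable_times[OF m mf[of k]] by (simp only: measurable_lborel1 measurable_lborel2)
  qed
  moreover have "(LINT t|lborel. (indicat_real {0..2*pi} t *\<^sub>R \<phi> t) * of_real (f k (cis t))) = 0" for k
    using orth_modes_continuous[OF \<phi> cf[of k]] by (simp add: set_lebesgue_integral_def)
  ultimately have "(\<lambda>k. 0) \<longlonglongrightarrow> (LINT t|lborel. indicat_real T t *\<^sub>R \<phi> t)" by simp
  then show ?thesis unfolding set_lebesgue_integral_def
    using LIMSEQ_unique tendsto_const by blast
qed (simp add: set_lebesgue_integral_def)

text \<open>If \<open>Re \<phi>\<close> were positive on a set of positive measure, inner regularity would provide a
  closed subset of positive measure, over which the integral of \<open>\<phi>\<close> could not vanish.\<close>

lemma orth_modes_Re_nonpos: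
  assumes \<phi>: "orth_modes \<phi>"
  shows "AE t in lborel. t \<in> {0..<2*pi} \<longrightarrow> Re (\<phi> t) \<le> 0"
proof -
  define h where "h = (\<lambda>t. indicat_real {0..2*pi} t *\<^sub>R \<phi> t)"
  have hi: "integrable lborel h" using \<phi> by (simp add: h_def orth_modes_def set_integrable_def)
  then have [measurable]: "h \<in> borel_measurable borel" by auto
  define E where "E = {t \<in> {0..<2*pi}. Re (h t) > 0}"
  have Em [measurable]: "E \<in> sets borel" unfolding E_def by measurable
  have "E \<in> null_sets lborel"
  proof (rule ccontr)
    assume "E \<notin> null_sets lborel"
    then have "emeasure lborel E \<noteq> 0" by (auto simp: null_sets_def)
    then have "emeasure lborel E > 0" by (simp add: zero_less_iff_neq_zero)
    then obtain r where r: "0 < r" "r < emeasure lborel E" by (meson dense)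
    then have "r < top" by (meson order_less_le_trans top_greatest)
    then obtain e where e: "e \<ge> 0" "r = ennreal e" by (cases r) auto
    with r have e0: "e > 0" by auto
    have "E \<in> sets lebesgue" using Em by (simp add: sets_completionI_sets)
    then obtain T where T: "closed T" "T \<subseteq> E" "emeasure lebesgue (E - T) < ennreal e"
      by (rule sets_lebesgue_inner_closed[OF _ e0])
    have Tm [measurable]: "T \<in> sets borel" using T(1) by auto
    have TE: "T \<subseteq> {0..<2*pi}" using T(2) by (auto simp: E_def)
    have "(LBINT t:T. \<phi> t) = (LBINT t:T. h t)"
      by (rule set_lebesgue_integral_cong) (auto simp: h_def dest!: subsetD[OF TE])
    with orth_modes_closed[OF \<phi> T(1) TE] have z: "(LBINT t:T. h t) = 0" by simp
    have "(LBINT t:T. Re (h t)) = Re (LBINT t:T. h t)"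
      unfolding set_lebesgue_integral_def
      using integral_Re[OF integrable_mult_indicator[OF _ hi, of T]] by simp
    with z have "(LBINT t:T. Re (h t)) = 0" by simp
    moreover have "integrable lborel (\<lambda>t. Re (h t))" using hi by simp
    ultimately have Tn: "T \<in> null_sets lborel"
      using T(2) by (intro null_if_pos_func_has_zero_int[of lborel "\<lambda>t. Re (h t)"]) (auto simp: E_def)
    have "emeasure lborel E \<le> emeasure lborel T + emeasure lborel (E - T)"
      using emeasure_subadditive[of T lborel "E - T"] T(2) by (simp add: Un_absorb1)
    also have "\<dots> = emeasure lebesgue (E - T)" using Tn by (simp add: null_sets_def)
    also have "\<dots> < r" using T(3) e by simp
    finally show False using r by simp
  qed
  then have "AE t in lborel. t \<notin> E" by (rule AE_not_in)
  then show ?thesis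
    by eventually_elim (auto simp: E_def h_def not_less)
qed

text \<open>The sign condition applies to \<open>\<phi>\<close> multiplied by each fourth root of unity.\<close>

lemma orth_modes_imp_AE_zero:
  assumes \<phi>: "orth_modes \<phi>"
  shows "AE t in lborel. t \<in> {0..2*pi} \<longrightarrow> \<phi> t = 0"
proof -
  have "AE t in lborel. t \<noteq> (2 * pi)" by (rule AE_lborel_singleton)
  moreover note orth_modes_Re_nonpos[OF \<phi>] orth_modes_Re_nonpos[OF orth_modes_scale[OF \<phi>, of "-1"]]
     orth_modes_Re_nonpos[OF orth_modes_scale[OF \<phi>, of "\<i>"]] orth_modes_Re_nonpos[OF orth_modes_scale[OF \<phi>, of "-\<i>"]]
  ultimately show ?thesis
    by eventually_elim (auto simp: complex_eq_iff)
qed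

section \<open>Absolutely convergent Fourier series\<close>

abbreviation l1 :: "(int \<Rightarrow> complex) \<Rightarrow> bool" where
  "l1 a \<equiv> (\<lambda>m. norm (a m)) summable_on UNIV"

lemma continuous_on_infsum:
  fixes g :: "'i \<Rightarrow> 'a::topological_space \<Rightarrow> complex"
  assumes "\<And>i. i \<in> I \<Longrightarrow> continuous_on S (g i)" "\<And>i t. i \<in> I \<Longrightarrow> t \<in> S \<Longrightarrow> norm (g i t) \<le> B i" "B summable_on I"
  shows "continuous_on S (\<lambda>t. \<Sum>\<^sub>\<infinity>i\<in>I. g i t)"
proof (rule uniform_limit_theorem)
  show "uniform_limit S (\<lambda>X t. \<Sum>i\<in>X. g i t) (\<lambda>t. \<Sum>\<^sub>\<infinity>i\<in>I. g i t) (finite_subsets_at_top I)"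
    using assms(2,3) by (rule Weierstrass_m_test_general)
  show "\<forall>\<^sub>F X in finite_subsets_at_top I. continuous_on S (\<lambda>t. \<Sum>i\<in>X. g i t)"
    by (intro eventually_finite_subsets_at_top_weakI continuous_on_sum assms(1)) auto
qed simp

text \<open>The majorant makes the convergence uniform, and an integrable factor \<open>\<rho>\<close> turns a uniformly
  small error into a small integral. The factor stays outside the series because it will be
  singular.\<close>

lemma LBINT_has_sum:
  fixes g :: "'i \<Rightarrow> real \<Rightarrow> complex" and \<rho> :: "real \<Rightarrow> complex"
  assumes \<rho>: "set_integrable lborel {0..2*pi} \<rho>"
    and cont: "\<And>i. i \<in> I \<Longrightarrow> continuous_on UNIV (g i)"
    and bound: "\<And>i t. i \<in> I \<Longrightarrow> norm (g i t) \<le> B i" and B: "B summable_on I"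
  shows "((\<lambda>i. LBINT t:{0..2*pi}. \<rho> t * g i t) has_sum
           (LBINT t:{0..2*pi}. \<rho> t * (\<Sum>\<^sub>\<infinity>i\<in>I. g i t))) I"
proof -
  let ?G = "\<lambda>t. \<Sum>\<^sub>\<infinity>i\<in>I. g i t" and ?R = "LBINT t:{0..2*pi}. norm (\<rho> t)"
  have R: "?R \<ge> 0" by (simp add: set_lebesgue_integral_def)
  have lim: "uniform_limit UNIV (\<lambda>X t. \<Sum>i\<in>X. g i t) ?G (finite_subsets_at_top I)"
    using bound B by (intro Weierstrass_m_test_general) auto
  have cG: "continuous_on UNIV ?G"
    by (rule continuous_on_infsum[OF cont bound B])
  have mG: "?G \<in> borel_measurable borel" by (rule borel_measurable_continuous_onI[OF cG])
  have Gb: "norm (?G t) \<le> (\<Sum>\<^sub>\<infinity>i\<in>I. B i)" for t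
  proof (rule norm_infsum_le)
    have "(\<lambda>i. norm (g i t)) summable_on I"
      by (rule summable_on_comparison_test[OF B]) (use bound in auto)
    then show "((\<lambda>i. g i t) has_sum ?G t) I" by (simp add: abs_summable_summable)
    show "(B has_sum (\<Sum>\<^sub>\<infinity>i\<in>I. B i)) I" using B by simp
  qed (use bound in auto)
  have mg: "g i \<in> borel_measurable borel" if "i \<in> I" for i
    by (rule borel_measurable_continuous_onI[OF cont[OF that]])
  have ig: "set_integrable lborel {0..2*pi} (\<lambda>t. \<rho> t * g i t)" if "i \<in> I" for i
    by (rule set_integrable_mult_bounded[OF \<rho> mg[OF that] bound[OF that]])
  have iG: "set_integrable lborel {0..2*pi} (\<lambda>t. \<rho> t * ?G t)"
    by (rule set_integrable_mult_bounded[OF \<rho> mG Gb])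
  show ?thesis unfolding has_sum_def
  proof (rule tendstoI)
    fix e :: real assume e: "e > 0"
    define d where "d = e / (?R + 1)"
    have d: "d > 0" "d * ?R < e" using e R by (auto simp: d_def field_simps)
    have "\<forall>\<^sub>F X in finite_subsets_at_top I. \<forall>t\<in>UNIV. dist (\<Sum>i\<in>X. g i t) (?G t) < d"
      using uniform_limitD[OF lim d(1)] .
    moreover have "\<forall>\<^sub>F X in finite_subsets_at_top I. finite X \<and> X \<subseteq> I"
      by (rule eventually_finite_subsets_at_top_weakI) auto
    ultimately show "\<forall>\<^sub>F X in finite_subsets_at_top I. dist (\<Sum>i\<in>X. LBINT t:{0..2*pi}. \<rho> t * g i t)
       (LBINT t:{0..2*pi}. \<rho> t * ?G t) < e"
    proof eventually_elim
      case (elim X)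
      have ind: "(\<lambda>t. indicat_real {0..2*pi} t *\<^sub>R (\<rho> t * (\<Sum>i\<in>X. g i t)))
          = (\<lambda>t. \<Sum>i\<in>X. indicat_real {0..2*pi} t *\<^sub>R (\<rho> t * g i t))"
        by (simp only: sum_distrib_left scaleR_sum_right)
      have igX: "integrable lborel (\<lambda>t. indicat_real {0..2*pi} t *\<^sub>R (\<rho> t * g i t))" if "i \<in> X" for i
        using ig[of i] elim(2) that unfolding set_integrable_def by blast
      have iX: "set_integrable lborel {0..2*pi} (\<lambda>t. \<rho> t * (\<Sum>i\<in>X. g i t))"
        unfolding set_integrable_def ind by (intro Bochner_Integration.integrable_sum igX)
      have vX: "(\<Sum>i\<in>X. LBINT t:{0..2*pi}. \<rho> t * g i t) = (LBINT t:{0..2*pi}. \<rho> t * (\<Sum>i\<in>X. g i t))"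
        unfolding set_lebesgue_integral_def ind by (intro Bochner_Integration.integral_sum[symmetric] igX)
      have mX: "(\<lambda>t. (\<Sum>i\<in>X. g i t) - ?G t) \<in> borel_measurable borel"
        by (intro borel_measurable_diff borel_measurable_sum mG mg) (use elim in auto)
      have "(LBINT t:{0..2*pi}. \<rho> t * (\<Sum>i\<in>X. g i t)) - (LBINT t:{0..2*pi}. \<rho> t * ?G t)
         = (LBINT t:{0..2*pi}. \<rho> t * ((\<Sum>i\<in>X. g i t) - ?G t))"
        by (subst set_integral_diff(2)[OF iX iG, symmetric]) (simp add: algebra_simps)
      also have "norm \<dots> \<le> d * ?R"
        by (rule set_integral_mult_norm_le[OF \<rho> mX]) (use elim in \<open>auto simp: dist_norm less_imp_le\<close>)
      finally show ?case using vX d(2) by (simp add: dist_norm)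
    qed
  qed
qed

definition fser :: "(int \<Rightarrow> complex) \<Rightarrow> real \<Rightarrow> complex" where
  "fser a t = (\<Sum>\<^sub>\<infinity>m. a m * mode m t)"

lemma fser_has_sum:
  assumes "l1 a" shows "((\<lambda>m. a m * mode m t) has_sum fser a t) UNIV"
proof -
  have "(\<lambda>m. norm (a m * mode m t)) summable_on UNIV" using assms by (simp add: norm_mult)
  then show ?thesis unfolding fser_def
    by (rule has_sum_infsum[OF abs_summable_summable])
qed

lemma continuous_on_fser:
  assumes "l1 a" shows "continuous_on S (fser a)"
proof -
  have "continuous_on S (\<lambda>t. fser a t)" unfolding fser_def
    by (rule continuous_on_infsum[where B = "\<lambda>m. norm (a m)"])
       (use assms in \<open>auto simp: norm_mult intro!: continuous_intros\<close>)
  then show ?thesis by simp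
qed

lemma periodic_fser: "periodic_2pi (fser a)"
  using periodic_mode unfolding periodic_2pi_def fser_def by simp

lemma norm_fser_le:
  assumes "l1 a" shows "norm (fser a t) \<le> (\<Sum>\<^sub>\<infinity>m. norm (a m))"
  by (rule norm_infsum_le[OF fser_has_sum[OF assms] has_sum_infsum[OF assms]]) (simp add: norm_mult)

lemma fser_integral_mode:
  assumes a: "l1 a"
  shows "(LBINT t:{0..2*pi}. fser a t * mode (- m) t) = 2 * of_real pi * a m"
proof -
  have e: "(\<lambda>t. 1 * (\<Sum>\<^sub>\<infinity>l. a l * mode (l - m) t)) = (\<lambda>t. fser a t * mode (- m) t)"
  proof
    fix t
    have "a l * mode (l - m) t = a l * mode l t * mode (- m) t" for l
      using mode_add[of l "- m" t] by simp
    then have "(\<lambda>l. a l * mode (l - m) t) = (\<lambda>l. a l * mode l t * mode (- m) t)" by (rule ext)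
    then show "1 * (\<Sum>\<^sub>\<infinity>l. a l * mode (l - m) t) = fser a t * mode (- m) t"
      by (simp only: fser_def infsum_cmult_left' mult_1)
  qed
  have "((\<lambda>l. LBINT t:{0..2*pi}. 1 * (a l * mode (l - m) t)) has_sum
           (LBINT t:{0..2*pi}. 1 * (\<Sum>\<^sub>\<infinity>l. a l * mode (l - m) t))) UNIV"
    by (rule LBINT_has_sum[where B = "\<lambda>l. norm (a l)"])
       (use a in \<open>auto simp: norm_mult intro!: continuous_intros integrable_continuous_period\<close>)
  then have "((\<lambda>l. a l * (if l = m then 2 * of_real pi else 0)) has_sum
           (LBINT t:{0..2*pi}. fser a t * mode (- m) t)) UNIV"
    unfolding e by (simp add: LBINT_mode)
  moreover have "((\<lambda>l. a l * (if l = m then 2 * of_real pi else 0)) has_sum (2 * of_real pi * a m)) UNIV"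
    by (rule has_sum_finite_neutralI[of "{m}"]) auto
  ultimately show ?thesis using has_sum_unique by blast
qed

lemma fourier_coeff_fser:
  assumes "l1 a" shows "fourier_coeff (fser a) m = a m"
  by (simp add: fourier_coeff_alt fser_integral_mode[OF assms])

text \<open>Fourier inversion without continuity: the difference of the two sides is orthogonal to all
  modes.\<close>

lemma AE_eq_fser:
  assumes f: "set_integrable lborel {0..2*pi} f" and a: "l1 a"
    and fa: "\<And>m. fourier_coeff f m = a m"
  shows "AE t in lborel. t \<in> {0..2*pi} \<longrightarrow> f t = fser a t"
proof -
  have i: "set_integrable lborel {0..2*pi} (fser a)"
    by (intro integrable_continuous_period continuous_on_fser a)
  have "orth_modes (\<lambda>t. f t - fser a t)" unfolding orth_modes_def
  proof (intro conjI allI)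
    show "set_integrable lborel {0..2*pi} (\<lambda>t. f t - fser a t)" using f i by auto
    fix m
    have "(LBINT t:{0..2*pi}. (f t - fser a t) * mode m t)
       = (LBINT t:{0..2*pi}. f t * mode m t) - (LBINT t:{0..2*pi}. fser a t * mode m t)"
      unfolding left_diff_distrib
      by (intro set_integral_diff set_integrable_mult_bounded[where B = 1] f i) auto
    also have "(LBINT t:{0..2*pi}. f t * mode m t) = 2 * of_real pi * a (- m)"
      using fa[of "- m"] by (simp add: fourier_coeff_alt field_simps)
    also have "(LBINT t:{0..2*pi}. fser a t * mode m t) = 2 * of_real pi * a (- m)"
      using fser_integral_mode[OF a, of "- m"] by simp
    finally show "(LBINT t:{0..2*pi}. (f t - fser a t) * mode m t) = 0" by simp
  qed
  from orth_modes_imp_AE_zero[OF this] show ?thesis by simp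
qed

text \<open>The set where two continuous functions differ is open, and a nonempty open set has positive
  measure.\<close>

lemma AE_imp_all_continuous:
  fixes f g :: "real \<Rightarrow> complex"
  assumes ae: "AE t in lborel. t \<in> {0..2*pi} \<longrightarrow> f t = g t"
    and f: "continuous_on UNIV f" and g: "continuous_on UNIV g" and t: "t \<in> {0..2*pi}"
  shows "f t = g t"
proof -
  define U where "U = {0<..<2*pi} \<inter> {t. f t \<noteq> g t}"
  have "open U" unfolding U_def by (intro open_Int open_Collect_neq f g) auto
  moreover have "U \<in> null_sets lborel"
  proof -
    have "AE t in lborel. t \<notin> U" using ae by eventually_elim (auto simp: U_def)
    then show ?thesis using \<open>open U\<close> by (subst AE_iff_null_sets) auto
  qed
  ultimately have "U = {}"
    using open_not_negligible negligible_iff_null_sets null_sets_completionI by blast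
  then have eq: "f s = g s" if "s \<in> {0<..<2*pi}" for s using that by (auto simp: U_def)
  have "t \<in> closure {0<..<2*pi}" using t by (subst closure_greaterThanLessThan) auto
  moreover have "closed {s. f s = g s}" by (intro closed_Collect_eq f g)
  moreover have "{0<..<2*pi} \<subseteq> {s. f s = g s}" using eq by auto
  ultimately show ?thesis using closure_minimal by blast
qed

lemma periodic_eq_all:
  assumes "periodic_2pi f" "periodic_2pi g" "\<And>t. t \<in> {0..2*pi} \<Longrightarrow> f t = g t"
  shows "f t = g t"
proof -
  define k where "k = \<lfloor>t / (2*pi)\<rfloor>"
  have "of_int k \<le> t / (2*pi)" "t / (2*pi) < of_int k + 1" unfolding k_def by linarith+
  then have "t + of_int (- k) * (2 * pi) \<in> {0..2*pi}" by (auto simp: field_simps)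
  from assms(3)[OF this] show ?thesis
    using periodic_2pi_of_int[OF assms(1)] periodic_2pi_of_int[OF assms(2)] by metis
qed

lemma eq_fser_if_summable_coeffs:
  assumes f: "continuous_on UNIV f" "periodic_2pi f" and a: "l1 a"
    and fa: "\<And>m. fourier_coeff f m = a m"
  shows "f t = fser a t"
proof (rule periodic_eq_all[OF f(2) periodic_fser])
  have "set_integrable lborel {0..2*pi} f"
    by (intro integrable_continuous_period continuous_on_subset[OF f(1)]) auto
  from AE_eq_fser[OF this a fa]
  show "f t = fser a t" if "t \<in> {0..2*pi}" for t
    by (rule AE_imp_all_continuous[OF _ f(1) continuous_on_fser[OF a] that])
qed

section \<open>Fourier coefficients of smooth kernels\<close>

lemma smooth_continuous: "smooth f \<Longrightarrow> continuous_on UNIV f"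
  unfolding smooth_def by (metis C_k_on.simps(1))

lemma smooth_has_derivative: "smooth f \<Longrightarrow> (f has_derivative frechet_derivative f (at y)) (at y)"
  unfolding smooth_def using frechet_derivative_works by (metis C_k_on.simps(2) UNIV_I)

lemma smooth_directional: "smooth f \<Longrightarrow> smooth (\<lambda>y. frechet_derivative f (at y) v)"
  unfolding smooth_def by (metis C_k_on.simps(2))

lemma frechet_derivative_translate:
  assumes "smooth f" "\<And>y. f (y + c) = f y"
  shows "frechet_derivative f (at (y + c)) = frechet_derivative f (at y)"
proof -
  have "((\<lambda>z. f (z + c)) has_derivative (\<lambda>v. frechet_derivative f (at (y + c)) v)) (at y)"
    by (rule has_derivative_compose[where f = "\<lambda>z. z + c" and f' = "\<lambda>v. v"])
       (auto intro!: derivative_eq_intros smooth_has_derivative[OF assms(1)])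
  then show ?thesis using frechet_derivative_at assms(2) by auto
qed

text \<open>Directional derivatives of the uncurried kernel: smoothness and biperiodicity pass to them
  for every direction at once, the two coordinate directions giving the partial derivatives.\<close>

definition dir_deriv :: "real \<times> real \<Rightarrow> (real \<Rightarrow> real \<Rightarrow> complex) \<Rightarrow> real \<Rightarrow> real \<Rightarrow> complex" where
  "dir_deriv v K t \<tau> = frechet_derivative (\<lambda>(t, \<tau>). K t \<tau>) (at (t, \<tau>)) v"

lemma smooth_biperiodic_dir_deriv:
  assumes K: "smooth_biperiodic K"
  shows "smooth_biperiodic (dir_deriv v K)"
proof -
  let ?f = "\<lambda>(t, \<tau>). K t \<tau>"
  have f: "smooth ?f" using K by (simp add: smooth_biperiodic_def)
  have "smooth (\<lambda>y. frechet_derivative ?f (at y) v)" by (rule smooth_directional[OF f])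
  moreover have "(\<lambda>y. frechet_derivative ?f (at y) v) = (\<lambda>(t, \<tau>). dir_deriv v K t \<tau>)"
    by (auto simp: dir_deriv_def fun_eq_iff)
  moreover have "frechet_derivative ?f (at ((t, \<tau>) + (2*pi, 0))) = frechet_derivative ?f (at (t, \<tau>))"
    "frechet_derivative ?f (at ((t, \<tau>) + (0, 2*pi))) = frechet_derivative ?f (at (t, \<tau>))" for t \<tau>
    by (rule frechet_derivative_translate[OF f];
        use K in \<open>force simp: smooth_biperiodic_def periodic_2pi_def\<close>)+
  ultimately show ?thesis
    by (simp add: smooth_biperiodic_def periodic_2pi_def dir_deriv_def)
qed

lemma dir_deriv_vector_derivative:
  assumes K: "smooth_biperiodic K"
  shows "((\<lambda>\<tau>. K t \<tau>) has_vector_derivative dir_deriv (0, 1) K t \<tau>) (at \<tau>)"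
    and "((\<lambda>t. K t \<tau>) has_vector_derivative dir_deriv (1, 0) K t \<tau>) (at t)"
proof -
  let ?f = "\<lambda>(t, \<tau>). K t \<tau>"
  have f: "smooth ?f" using K by (simp add: smooth_biperiodic_def)
  note d = smooth_has_derivative[OF f, of "(t, \<tau>)"]
  interpret bounded_linear "frechet_derivative ?f (at (t, \<tau>))"
    using d by (rule has_derivative_bounded_linear)
  have e1: "frechet_derivative ?f (at (t, \<tau>)) (0, h) = h *\<^sub>R dir_deriv (0, 1) K t \<tau>" for h
    using scaleR[of h "(0, 1)"] by (simp add: dir_deriv_def)
  have e2: "frechet_derivative ?f (at (t, \<tau>)) (h, 0) = h *\<^sub>R dir_deriv (1, 0) K t \<tau>" for h
    using scaleR[of h "(1, 0)"] by (simp add: dir_deriv_def)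
  have p: "((\<lambda>s. (t, s)) has_derivative (\<lambda>h. (0, h))) (at \<tau>)"
    by (auto intro!: derivative_eq_intros)
  from has_derivative_compose[OF p d] show "((\<lambda>\<tau>. K t \<tau>) has_vector_derivative dir_deriv (0, 1) K t \<tau>) (at \<tau>)"
    by (simp add: has_vector_derivative_def e1)
  have p: "((\<lambda>s. (s, \<tau>)) has_derivative (\<lambda>h. (h, 0))) (at t)"
    by (auto intro!: derivative_eq_intros)
  from has_derivative_compose[OF p d] show "((\<lambda>t. K t \<tau>) has_vector_derivative dir_deriv (1, 0) K t \<tau>) (at t)"
    by (simp add: has_vector_derivative_def e2)
qed

lemma continuous_on_sections:
  fixes K :: "real \<Rightarrow> real \<Rightarrow> complex"
  assumes "continuous_on UNIV (\<lambda>(t, \<tau>). K t \<tau>)"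
  shows "continuous_on S (K t)" "continuous_on S (\<lambda>t. K t \<tau>)"
proof -
  have "continuous_on S (\<lambda>\<tau>. (t, \<tau>))" by (intro continuous_intros)
  from continuous_on_compose2[OF assms this] show "continuous_on S (K t)" by simp
  have "continuous_on S (\<lambda>t. (t, \<tau>))" by (intro continuous_intros)
  from continuous_on_compose2[OF assms this] show "continuous_on S (\<lambda>t. K t \<tau>)" by simp
qed

lemma smooth_biperiodic_continuous:
  assumes "smooth_biperiodic K"
  shows "continuous_on S (\<lambda>(t, \<tau>). K t \<tau>)" "continuous_on T (K t)" "continuous_on T (\<lambda>t. K t \<tau>)"
proof -
  have c: "continuous_on UNIV (\<lambda>(t, \<tau>). K t \<tau>)"
    using assms by (simp add: smooth_biperiodic_def smooth_continuous)
  then show "continuous_on S (\<lambda>(t, \<tau>). K t \<tau>)" by (rule continuous_on_subset) auto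
  show "continuous_on T (K t)" "continuous_on T (\<lambda>t. K t \<tau>)"
    by (rule continuous_on_sections[OF c])+
qed

lemma smooth_biperiodic_bounded:
  assumes K: "smooth_biperiodic K"
  obtains C where "\<And>t \<tau>. norm (K t \<tau>) \<le> C"
proof -
  have "compact ((\<lambda>(t, \<tau>). K t \<tau>) ` ({0..2*pi} \<times> {0..2*pi}))"
    by (rule compact_continuous_image[OF smooth_biperiodic_continuous(1)[OF K] compact_Times[OF compact_Icc compact_Icc]])
  from compact_imp_bounded[OF this]
  obtain C where C: "\<forall>z\<in>(\<lambda>(t, \<tau>). K t \<tau>) ` ({0..2*pi} \<times> {0..2*pi}). norm z \<le> C"
    unfolding bounded_iff by (elim exE)
  have C: "norm (K t \<tau>) \<le> C" if "t \<in> {0..2*pi}" "\<tau> \<in> {0..2*pi}" for t \<tau>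
  proof -
    have "(t, \<tau>) \<in> {0..2*pi} \<times> {0..2*pi}" using that by (rule SigmaI)
    from bspec[OF C imageI[OF this]] show ?thesis by simp
  qed
  have red: "\<exists>s\<in>{0..2*pi}. \<exists>k::int. t = s + of_int k * (2 * pi)" for t
  proof -
    define k where "k = \<lfloor>t / (2*pi)\<rfloor>"
    have "of_int k \<le> t / (2*pi)" "t / (2*pi) < of_int k + 1" unfolding k_def by linarith+
    then have "t - of_int k * (2 * pi) \<in> {0..2*pi}" by (auto simp: field_simps)
    then show ?thesis by (intro bexI[of _ "t - of_int k * (2*pi)"] exI[of _ k]) auto
  qed
  have "norm (K t \<tau>) \<le> C" for t \<tau>
  proof -
    obtain s k where s: "s \<in> {0..2*pi}" "t = s + of_int k * (2 * pi)" using red by blast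
    obtain \<sigma> l where r: "\<sigma> \<in> {0..2*pi}" "\<tau> = \<sigma> + of_int l * (2 * pi)" using red by blast
    have p: "periodic_2pi (\<lambda>t. K t \<sigma>)" "periodic_2pi (K t)" for \<sigma> t
      using K by (auto simp: smooth_biperiodic_def)
    have "K t \<tau> = K s \<sigma>"
      unfolding s(2) r(2) by (simp only: periodic_2pi_of_int[OF p(1)] periodic_2pi_of_int[OF p(2)])
    then show ?thesis using C s r by simp
  qed
  then show thesis by (rule that)
qed

text \<open>Integration by parts; periodicity cancels the boundary terms.\<close>

lemma fourier_coeff_deriv:
  assumes d: "\<And>t. (f has_vector_derivative f' t) (at t)" and f': "continuous_on UNIV f'"
    and per: "periodic_2pi f"
  shows "fourier_coeff f' m = \<i> * of_int m * fourier_coeff f m"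
proof -
  have f: "continuous_on UNIV f"
    by (intro continuous_at_imp_continuous_on ballI has_vector_derivative_continuous[OF d])
  have i1: "set_integrable lborel {0..2*pi} (\<lambda>t. f' t * mode (- m) t)"
    and i2: "set_integrable lborel {0..2*pi} (\<lambda>t. f t * mode (- m) t)"
    by (intro integrable_continuous_period continuous_intros continuous_on_subset[OF f] continuous_on_subset[OF f']; simp)+
  have "((\<lambda>t. f t * (\<i> * of_int (- m) * mode (- m) t) + f' t * mode (- m) t) has_integral
           (f (2*pi) * mode (- m) (2*pi) - f 0 * mode (- m) 0)) {0..2*pi}"
    by (intro fundamental_theorem_of_calculus has_vector_derivative_mult has_vector_derivative_mode
          has_vector_derivative_at_within[OF d]) auto
  moreover have "f (2*pi) = f 0" using per by (metis add_0 periodic_2pi_def)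
  then have z: "f (2*pi) * mode (- m) (2*pi) - f 0 * mode (- m) 0 = 0"
    by (simp only: mode_2pi mode_at_0) simp
  moreover have e: "(\<lambda>t. f t * (\<i> * of_int (- m) * mode (- m) t) + f' t * mode (- m) t)
      = (\<lambda>t. f' t * mode (- m) t - \<i> * of_int m * (f t * mode (- m) t))"
    by (simp add: algebra_simps fun_eq_iff)
  ultimately have "((\<lambda>t. f' t * mode (- m) t - \<i> * of_int m * (f t * mode (- m) t)) has_integral 0) {0..2*pi}"
    by (simp only: z e)
  moreover have "set_integrable lborel {0..2*pi} (\<lambda>t. f' t * mode (- m) t - \<i> * of_int m * (f t * mode (- m) t))"
    using i1 i2 by auto
  ultimately have "(LBINT t:{0..2*pi}. f' t * mode (- m) t - \<i> * of_int m * (f t * mode (- m) t)) = 0"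
    by (simp add: LBINT_period_eq_integral integral_unique)
  then have "(LBINT t:{0..2*pi}. f' t * mode (- m) t) = \<i> * of_int m * (LBINT t:{0..2*pi}. f t * mode (- m) t)"
    using i1 i2 by (subst (asm) set_integral_diff) auto
  then show ?thesis by (simp add: fourier_coeff_alt)
qed

lemma norm_fourier_coeff_le:
  assumes f: "continuous_on UNIV f" and C: "\<And>t. norm (f t) \<le> C"
  shows "norm (fourier_coeff f m) \<le> C"
proof -
  have i: "set_integrable lborel {0..2*pi} (mode (- m))"
    by (intro integrable_continuous_period) (auto intro!: continuous_intros simp: mode_def)
  have "norm (LBINT t:{0..2*pi}. mode (- m) t * f t) \<le> C * (LBINT t:{0..2*pi}. norm (mode (- m) t))"
    by (rule set_integral_mult_norm_le[OF i borel_measurable_continuous_onI[OF f] C])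
  also have "(LBINT t:{0..2*pi}. norm (mode (- m) t)) = 2 * pi"
    by (simp add: set_lebesgue_integral_def)
  finally show ?thesis
    by (simp add: fourier_coeff_alt norm_divide norm_mult mult.commute field_simps)
qed

lemma fourier_coeff_integral:
  assumes "continuous_on UNIV f"
  shows "fourier_coeff f m = 1 / (2 * of_real pi) * integral {0..2*pi} (\<lambda>t. f t * mode (- m) t)"
  unfolding fourier_coeff_alt
  by (subst LBINT_period_eq_integral)
     (auto intro!: integrable_continuous_period continuous_intros continuous_on_subset[OF assms])

lemma continuous_fourier_coeff_param:
  fixes K :: "real \<Rightarrow> real \<Rightarrow> complex"
  assumes "continuous_on UNIV (\<lambda>(t, \<tau>). K t \<tau>)"
  shows "continuous_on UNIV (\<lambda>t. fourier_coeff (K t) l)"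
proof -
  have c: "continuous_on UNIV (K t)" for t
    by (rule continuous_on_sections[OF assms])
  have "continuous_on UNIV (\<lambda>t. integral (cbox 0 (2*pi)) (\<lambda>\<tau>. K t \<tau> * mode (- l) \<tau>))"
    by (rule integral_continuous_on_param)
       (auto simp: case_prod_unfold intro!: continuous_intros continuous_on_subset[OF assms[unfolded case_prod_unfold]])
  then show ?thesis
    unfolding fourier_coeff_integral[OF c] cbox_interval by (intro continuous_on_mult_left)
qed

lemma fourier_coeff_swap:
  fixes K :: "real \<Rightarrow> real \<Rightarrow> complex"
  assumes c: "continuous_on UNIV (\<lambda>(t, \<tau>). K t \<tau>)"
  shows "fourier_coeff (\<lambda>t. fourier_coeff (K t) l) j = fourier_coeff (\<lambda>\<tau>. fourier_coeff (\<lambda>t. K t \<tau>) j) l"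
proof -
  have c1: "continuous_on UNIV (K t)" for t
    by (rule continuous_on_sections[OF c])
  have c2: "continuous_on UNIV (\<lambda>t. K t \<tau>)" for \<tau>
    by (rule continuous_on_sections[OF c])
  have c': "continuous_on UNIV (\<lambda>(\<tau>, t). K t \<tau>)"
  proof -
    have "continuous_on UNIV (\<lambda>x::real \<times> real. (snd x, fst x))" by (intro continuous_intros)
    from continuous_on_compose2[OF c this] show ?thesis by (simp add: case_prod_unfold)
  qed
  have "integral (cbox 0 (2*pi)) (\<lambda>t. integral (cbox 0 (2*pi)) (\<lambda>\<tau>. K t \<tau> * mode (- l) \<tau> * mode (- j) t))
      = integral (cbox 0 (2*pi)) (\<lambda>\<tau>. integral (cbox 0 (2*pi)) (\<lambda>t. K t \<tau> * mode (- l) \<tau> * mode (- j) t))"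
    by (rule integral_swap_continuous)
       (auto simp: case_prod_unfold intro!: continuous_intros continuous_on_subset[OF c[unfolded case_prod_unfold]])
  moreover have e1: "integral {0..2*pi} (\<lambda>\<tau>. K t \<tau> * mode (- l) \<tau> * mode (- j) t)
      = integral {0..2*pi} (\<lambda>\<tau>. K t \<tau> * mode (- l) \<tau>) * mode (- j) t" for t
    by (rule integral_mult_left)
  moreover have e2: "integral {0..2*pi} (\<lambda>t. K t \<tau> * mode (- l) \<tau> * mode (- j) t)
      = integral {0..2*pi} (\<lambda>t. K t \<tau> * mode (- j) t) * mode (- l) \<tau>" for \<tau>
  proof -
    have "(\<lambda>t. K t \<tau> * mode (- l) \<tau> * mode (- j) t) = (\<lambda>t. K t \<tau> * mode (- j) t * mode (- l) \<tau>)"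
      by (simp add: mult_ac)
    then show ?thesis by (simp only: integral_mult_left)
  qed
  ultimately have "integral {0..2*pi} (\<lambda>t. integral {0..2*pi} (\<lambda>\<tau>. K t \<tau> * mode (- l) \<tau>) * mode (- j) t)
      = integral {0..2*pi} (\<lambda>\<tau>. integral {0..2*pi} (\<lambda>t. K t \<tau> * mode (- j) t) * mode (- l) \<tau>)"
    by (simp only: cbox_interval e1 e2)
  moreover have "fourier_coeff (\<lambda>t. fourier_coeff (K t) l) j = 1 / (2 * of_real pi) * (1 / (2 * of_real pi) *
      integral {0..2*pi} (\<lambda>t. integral {0..2*pi} (\<lambda>\<tau>. K t \<tau> * mode (- l) \<tau>) * mode (- j) t))"
    unfolding fourier_coeff_integral[OF continuous_fourier_coeff_param[OF c], of l j]
    by (simp only: fourier_coeff_integral[OF c1] mult.assoc integral_mult_right)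
  moreover have "fourier_coeff (\<lambda>\<tau>. fourier_coeff (\<lambda>t. K t \<tau>) j) l = 1 / (2 * of_real pi) * (1 / (2 * of_real pi) *
      integral {0..2*pi} (\<lambda>\<tau>. integral {0..2*pi} (\<lambda>t. K t \<tau> * mode (- j) t) * mode (- l) \<tau>))"
    unfolding fourier_coeff_integral[OF continuous_fourier_coeff_param[OF c'], of j l]
    by (simp only: fourier_coeff_integral[OF c2] mult.assoc integral_mult_right)
  ultimately show ?thesis by simp
qed

definition dcoef :: "(real \<Rightarrow> real \<Rightarrow> complex) \<Rightarrow> int \<times> int \<Rightarrow> complex" where
  "dcoef K = (\<lambda>(j, l). fourier_coeff (\<lambda>t. fourier_coeff (K t) l) j)"

lemma fourier_coeff_cmult: "fourier_coeff (\<lambda>t. c * f t) m = c * fourier_coeff f m"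
  by (simp add: fourier_coeff_alt mult.assoc)

lemma dcoef_dir_deriv:
  assumes K: "smooth_biperiodic K"
  shows "dcoef (dir_deriv (0, 1) K) (j, l) = \<i> * of_int l * dcoef K (j, l)"
    and "dcoef (dir_deriv (1, 0) K) (j, l) = \<i> * of_int j * dcoef K (j, l)"
proof -
  note cD = smooth_biperiodic_continuous[OF smooth_biperiodic_dir_deriv[OF K]]
  have p: "periodic_2pi (\<lambda>t. K t \<tau>)" "periodic_2pi (K t)" for \<tau> t
    using K by (auto simp: smooth_biperiodic_def)
  have "fourier_coeff (dir_deriv (0, 1) K t) l = \<i> * of_int l * fourier_coeff (K t) l" for t
    by (rule fourier_coeff_deriv[OF dir_deriv_vector_derivative(1)[OF K] cD(2) p(2)])
  then show "dcoef (dir_deriv (0, 1) K) (j, l) = \<i> * of_int l * dcoef K (j, l)"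
    by (simp add: dcoef_def fourier_coeff_cmult)
  have "fourier_coeff (\<lambda>t. dir_deriv (1, 0) K t \<tau>) j = \<i> * of_int j * fourier_coeff (\<lambda>t. K t \<tau>) j" for \<tau>
    by (rule fourier_coeff_deriv[OF dir_deriv_vector_derivative(2)[OF K] cD(3) p(1)])
  then show "dcoef (dir_deriv (1, 0) K) (j, l) = \<i> * of_int j * dcoef K (j, l)"
    by (simp add: dcoef_def fourier_coeff_cmult fourier_coeff_swap[OF cD(1)]
          fourier_coeff_swap[OF smooth_biperiodic_continuous(1)[OF K]])
qed

text \<open>Partial derivatives multiply the coefficients by \<open>\<i> * j\<close> and \<open>\<i> * l\<close>, and the coefficients
  of every smooth biperiodic kernel are bounded by its maximum.\<close>

lemma dcoef_decay:
  assumes "smooth_biperiodic K"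
  shows "\<exists>C. \<forall>j l. \<bar>of_int j\<bar> ^ a * \<bar>of_int l\<bar> ^ b * norm (dcoef K (j, l)) \<le> C"
  using assms
proof (induction a arbitrary: K)
  case 0
  then show ?case
  proof (induction b arbitrary: K)
    case 0
    obtain C where C: "\<And>t \<tau>. norm (K t \<tau>) \<le> C" using smooth_biperiodic_bounded[OF 0] by blast
    have "norm (dcoef K (j, l)) \<le> C" for j l
      unfolding dcoef_def prod.case
      by (intro norm_fourier_coeff_le continuous_fourier_coeff_param C smooth_biperiodic_continuous 0)
    then show ?case by auto
  next
    case (Suc b)
    from Suc.IH[OF smooth_biperiodic_dir_deriv[OF Suc.prems, of "(0, 1)"]]
    obtain C where "\<And>j l. \<bar>of_int l\<bar> ^ b * norm (dcoef (dir_deriv (0, 1) K) (j, l)) \<le> C" by auto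
    then show ?case unfolding dcoef_dir_deriv[OF Suc.prems]
      by (auto simp: norm_mult mult_ac)
  qed
next
  case (Suc a)
  from Suc.IH[OF smooth_biperiodic_dir_deriv[OF Suc.prems, of "(1, 0)"]]
  obtain C where "\<And>j l. \<bar>of_int j\<bar> ^ a * \<bar>of_int l\<bar> ^ b * norm (dcoef (dir_deriv (1, 0) K) (j, l)) \<le> C" by blast
  then show ?case unfolding dcoef_dir_deriv[OF Suc.prems]
    by (auto simp: norm_mult mult_ac)
qed

section \<open>Double Fourier series of smooth kernels\<close>

lemma summable_on_inverse_squares: "(\<lambda>m::int. 1 / (1 + (of_int m)\<^sup>2) :: real) summable_on UNIV"
proof -
  let ?f = "\<lambda>m::int. 1 / (1 + (of_int m)\<^sup>2) :: real"
  have "summable (\<lambda>n. 1 / (1 + (of_nat n)\<^sup>2) :: real)"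
  proof (rule summable_comparison_test')
    show "summable (\<lambda>n. inverse (of_nat n ^ 2) :: real)" by (rule inverse_power_summable) simp
    show "norm (1 / (1 + (of_nat n)\<^sup>2) :: real) \<le> inverse (of_nat n ^ 2)" if "n \<ge> 1" for n
      using that by (simp add: inverse_eq_divide frac_le)
  qed
  then have nat: "(\<lambda>n::nat. 1 / (1 + (of_nat n)\<^sup>2) :: real) summable_on UNIV"
    by (rule summable_nonneg_imp_summable_on) auto
  have "(?f \<circ> int) summable_on UNIV" "(?f \<circ> (\<lambda>n. - int n)) summable_on UNIV"
    using nat by (simp_all add: o_def)
  then have "?f summable_on (range int)" "?f summable_on (range (\<lambda>n. - int n))"
    by (subst summable_on_reindex; simp add: inj_def)+
  then have "?f summable_on (range int \<union> range (\<lambda>n. - int n))" by (rule summable_on_union)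
  moreover have "range int \<union> range (\<lambda>n. - int n) = UNIV"
  proof (intro equalityI subset_UNIV subsetI)
    fix m :: int show "m \<in> range int \<union> range (\<lambda>n. - int n)" by (cases m rule: int_cases2) auto
  qed
  ultimately show ?thesis by simp
qed

text \<open>Decay is expressed by summability against every power, the form in which the operator
  estimates consume it. The exponents are real because they will be Sobolev exponents.\<close>

definition rapid :: "(int \<times> int \<Rightarrow> complex) \<Rightarrow> bool" where
  "rapid \<kappa> \<longleftrightarrow> (\<forall>P\<ge>0. (\<lambda>(j, l). norm (\<kappa> (j, l)) *
      ((1 + (of_int j)\<^sup>2) powr P * (1 + (of_int l)\<^sup>2) powr P)) summable_on UNIV)"

lemma summable_on_product_nonneg:
  fixes f g :: "'a \<Rightarrow> real"
  assumes f: "f summable_on UNIV" "\<And>x. f x \<ge> 0" and g: "g summable_on UNIV" "\<And>x. g x \<ge> 0"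
  shows "(\<lambda>(x, y). f x * g y) summable_on UNIV"
proof (rule nonneg_bdd_above_summable_on)
  show "bdd_above (sum (\<lambda>(x, y). f x * g y) ` {F. F \<subseteq> UNIV \<and> finite F})"
  proof (rule bdd_aboveI2)
    fix F :: "('a \<times> 'a) set" assume "F \<in> {F. F \<subseteq> UNIV \<and> finite F}"
    then have F: "finite F" by simp
    have "sum (\<lambda>(x, y). f x * g y) F \<le> sum (\<lambda>(x, y). f x * g y) (fst ` F \<times> snd ` F)"
      by (rule sum_mono2) (use F f(2) g(2) in \<open>force+\<close>)
    also have "\<dots> = sum f (fst ` F) * sum g (snd ` F)"
      by (simp add: sum.cartesian_product sum_product)
    also have "\<dots> \<le> infsum f UNIV * infsum g UNIV"
      using F by (intro mult_mono finite_sum_le_infsum f g infsum_nonneg sum_nonneg) auto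
    finally show "sum (\<lambda>(x, y). f x * g y) F \<le> infsum f UNIV * infsum g UNIV" .
  qed
qed (use f(2) g(2) in auto)

lemma one_plus_power_le: "x \<ge> 0 \<Longrightarrow> (1 + x :: real) ^ N \<le> 2 ^ N * (1 + x ^ N)"
proof -
  assume x: "x \<ge> 0"
  show ?thesis
  proof (cases "x \<le> 1")
    case True
    then have "(1 + x) ^ N \<le> 2 ^ N" using x by (intro power_mono) auto
    also have "\<dots> \<le> 2 ^ N * (1 + x ^ N)" using x by simp
    finally show ?thesis .
  next
    case False
    then have "(1 + x) ^ N \<le> (2 * x) ^ N" by (intro power_mono) auto
    also have "\<dots> \<le> 2 ^ N * (1 + x ^ N)" by (simp add: power_mult_distrib)
    finally show ?thesis .
  qed
qed

text \<open>Four of the decay bounds, with exponent \<open>0\<close> or \<open>2 * N\<close> in either variable, control the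
  \<open>N\<close>-th power of the product weight. With \<open>N \<ge> P + 1\<close> one power is left over for the summable
  majorant.\<close>

lemma rapid_dcoef:
  assumes K: "smooth_biperiodic K" shows "rapid (dcoef K)"
  unfolding rapid_def
proof (intro allI impI)
  fix P :: real assume P: "P \<ge> 0"
  define N where "N = nat \<lceil>P\<rceil> + 1"
  have N: "P + 1 \<le> real N" unfolding N_def by linarith
  obtain C1 where C1: "\<And>j l. \<bar>of_int j\<bar> ^ 0 * \<bar>of_int l\<bar> ^ 0 * norm (dcoef K (j, l)) \<le> C1" using dcoef_decay[OF K] by blast
  obtain C2 where C2: "\<And>j l. \<bar>of_int j\<bar> ^ (2 * N) * \<bar>of_int l\<bar> ^ 0 * norm (dcoef K (j, l)) \<le> C2" using dcoef_decay[OF K] by blast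
  obtain C3 where C3: "\<And>j l. \<bar>of_int j\<bar> ^ 0 * \<bar>of_int l\<bar> ^ (2 * N) * norm (dcoef K (j, l)) \<le> C3" using dcoef_decay[OF K] by blast
  obtain C4 where C4: "\<And>j l. \<bar>of_int j\<bar> ^ (2 * N) * \<bar>of_int l\<bar> ^ (2 * N) * norm (dcoef K (j, l)) \<le> C4" using dcoef_decay[OF K] by blast
  define C where "C = 4 ^ N * (C1 + C2 + C3 + C4)"
  let ?w = "\<lambda>m::int. 1 + (of_int m)\<^sup>2 :: real"
  have w: "?w m \<ge> 1" "?w m > 0" for m by (auto intro: add_pos_nonneg)
  have bound: "norm (dcoef K (j, l)) * (?w j ^ N * ?w l ^ N) \<le> C" for j l
  proof -
    have "?w j ^ N * ?w l ^ N \<le> (2 ^ N * (1 + (of_int j)\<^sup>2 ^ N)) * (2 ^ N * (1 + (of_int l)\<^sup>2 ^ N))"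
      by (intro mult_mono one_plus_power_le) auto
    also have "\<dots> = 4 ^ N * ((1 + \<bar>of_int j\<bar> ^ (2 * N)) * (1 + \<bar>of_int l\<bar> ^ (2 * N)))"
    proof -
      have 1: "(of_int m)\<^sup>2 ^ N = \<bar>of_int m :: real\<bar> ^ (2 * N)" for m :: int by (simp add: power_mult)
      have 2: "4 ^ N = 2 ^ N * (2 ^ N :: real)" by (simp flip: power_mult_distrib)
      show ?thesis by (simp only: 1 2 mult_ac)
    qed
    finally have "norm (dcoef K (j, l)) * (?w j ^ N * ?w l ^ N)
       \<le> norm (dcoef K (j, l)) * (4 ^ N * ((1 + \<bar>of_int j\<bar> ^ (2 * N)) * (1 + \<bar>of_int l\<bar> ^ (2 * N))))"
      by (rule mult_left_mono) simp
    also have "\<dots> = 4 ^ N * (\<bar>of_int j\<bar> ^ 0 * \<bar>of_int l\<bar> ^ 0 * norm (dcoef K (j, l))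
        + \<bar>of_int j\<bar> ^ (2 * N) * \<bar>of_int l\<bar> ^ 0 * norm (dcoef K (j, l))
        + \<bar>of_int j\<bar> ^ 0 * \<bar>of_int l\<bar> ^ (2 * N) * norm (dcoef K (j, l))
        + \<bar>of_int j\<bar> ^ (2 * N) * \<bar>of_int l\<bar> ^ (2 * N) * norm (dcoef K (j, l)))"
      by (simp add: algebra_simps)
    also have "\<dots> \<le> C" unfolding C_def
      by (intro mult_left_mono add_mono C1 C2 C3 C4) auto
    finally show ?thesis .
  qed
  have le: "?w m powr P * ?w m \<le> ?w m ^ N" for m
  proof -
    have "?w m powr P * ?w m = ?w m powr (P + 1)" using w(2)[of m] by (simp add: powr_add)
    also have "\<dots> \<le> ?w m powr real N" by (rule powr_mono[OF N w(1)])
    finally show ?thesis using w(2)[of m] by (simp add: powr_realpow)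
  qed
  show "(\<lambda>(j, l). norm (dcoef K (j, l)) * (?w j powr P * ?w l powr P)) summable_on UNIV"
  proof (rule summable_on_comparison_test)
    have "(\<lambda>(j, l). (1 / ?w j) * (1 / ?w l)) summable_on UNIV"
      by (rule summable_on_product_nonneg) (auto intro: summable_on_inverse_squares)
    then show "(\<lambda>x. C * (\<lambda>(j, l). (1 / ?w j) * (1 / ?w l)) x) summable_on UNIV"
      by (rule summable_on_cmult_right)
    fix x :: "int \<times> int"
    obtain j l where x: "x = (j, l)" by (cases x)
    have "norm (dcoef K (j, l)) * (?w j powr P * ?w l powr P) * (?w j * ?w l)
       = norm (dcoef K (j, l)) * ((?w j powr P * ?w j) * (?w l powr P * ?w l))" by simp
    also have "\<dots> \<le> norm (dcoef K (j, l)) * (?w j ^ N * ?w l ^ N)"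
      using w by (intro mult_left_mono mult_mono le) (auto simp: less_imp_le)
    also note bound
    finally have "norm (dcoef K (j, l)) * (?w j powr P * ?w l powr P) \<le> C / (?w j * ?w l)"
      using w by (subst pos_le_divide_eq) (auto intro: mult_pos_pos)
    then show "(\<lambda>(j, l). norm (dcoef K (j, l)) * (?w j powr P * ?w l powr P)) x \<le> C * (\<lambda>(j, l). (1 / ?w j) * (1 / ?w l)) x"
      by (simp add: x)
    show "(\<lambda>(j, l). norm (dcoef K (j, l)) * (?w j powr P * ?w l powr P)) x \<ge> 0"
      by (auto simp: x)
  qed
qed

lemma rapid_summable:
  assumes "rapid \<kappa>" shows "(\<lambda>x. norm (\<kappa> x)) summable_on UNIV"
proof -
  have "(\<lambda>(j, l). norm (\<kappa> (j, l)) *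
      ((1 + (of_int j)\<^sup>2) powr 0 * (1 + (of_int l)\<^sup>2) powr 0)) summable_on UNIV"
    using assms unfolding rapid_def by blast
  moreover have "(1 + (of_int j)\<^sup>2 :: real) \<noteq> 0" for j :: int
    by (metis add_nonneg_eq_0_iff zero_le_one zero_le_power2 zero_neq_one)
  ultimately show ?thesis by (simp add: case_prod_unfold)
qed

text \<open>One-variable inversion is used twice, for the coefficient functions \<open>t \<mapsto> fourier_coeff (K t)
  l\<close> and for the sections \<open>K t\<close>; absolute summability merges the iterated sums.\<close>

lemma smooth_biperiodic_double_series:
  assumes K: "smooth_biperiodic K"
  shows "((\<lambda>(j, l). dcoef K (j, l) * mode j t * mode l \<tau>) has_sum K t \<tau>) UNIV"
proof -
  have p: "periodic_2pi (\<lambda>t. K t \<tau>)" "periodic_2pi (K t)" for \<tau> t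
    using K by (auto simp: smooth_biperiodic_def)
  note c = smooth_biperiodic_continuous[OF K]
  have s: "(\<lambda>x. norm (dcoef K x)) summable_on UNIV \<times> UNIV" using rapid_summable[OF rapid_dcoef[OF K]] by simp
  have s': "(\<lambda>(l, j). norm (dcoef K (j, l))) summable_on UNIV \<times> UNIV"
    using s by (subst summable_on_swap) (simp add: case_prod_unfold)
  have sj: "l1 (\<lambda>j. dcoef K (j, l))" for l
    by (rule summable_on_SigmaD1[OF s']) simp
  have sl: "(\<lambda>l. \<Sum>\<^sub>\<infinity>j. norm (dcoef K (j, l))) summable_on UNIV"
    by (rule summable_on_Sigma_banach[OF s'])
  have cl: "fourier_coeff (K t) l = fser (\<lambda>j. dcoef K (j, l)) t" for t l
  proof (rule eq_fser_if_summable_coeffs[OF _ _ sj])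
    show "continuous_on UNIV (\<lambda>t. fourier_coeff (K t) l)"
      by (rule continuous_fourier_coeff_param[OF c(1)])
    show "periodic_2pi (\<lambda>t. fourier_coeff (K t) l)"
      using p(1) by (simp add: periodic_2pi_def fourier_coeff_def)
  qed (simp add: dcoef_def)
  have l1: "l1 (fourier_coeff (K t))" for t
  proof (rule summable_on_comparison_test[OF sl])
    show "norm (fourier_coeff (K t) l) \<le> (\<Sum>\<^sub>\<infinity>j. norm (dcoef K (j, l)))" for l
      unfolding cl by (rule norm_fser_le[OF sj])
  qed simp
  have Kf: "K t \<tau> = fser (fourier_coeff (K t)) \<tau>"
    by (rule eq_fser_if_summable_coeffs[OF c(2) p(2) l1 refl])
  have "((\<lambda>(l, j). dcoef K (j, l) * mode j t * mode l \<tau>) has_sum K t \<tau>) (UNIV \<times> UNIV)"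
  proof (rule has_sum_SigmaI[where g = "\<lambda>l. fourier_coeff (K t) l * mode l \<tau>"])
    show "((\<lambda>l. fourier_coeff (K t) l * mode l \<tau>) has_sum K t \<tau>) UNIV"
      unfolding Kf by (rule fser_has_sum[OF l1])
    show "((\<lambda>j. (\<lambda>(l, j). dcoef K (j, l) * mode j t * mode l \<tau>) (l, j)) has_sum
            fourier_coeff (K t) l * mode l \<tau>) UNIV" for l
      unfolding cl prod.case by (rule has_sum_cmult_left[OF fser_has_sum[OF sj[of l], of t]])
    have e: "(\<lambda>x. norm ((\<lambda>(l, j). dcoef K (j, l) * mode j t * mode l \<tau>) x)) = (\<lambda>(l, j). norm (dcoef K (j, l)))"
      by (auto simp: norm_mult)
    show "(\<lambda>(l, j). dcoef K (j, l) * mode j t * mode l \<tau>) summable_on UNIV \<times> UNIV"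
      by (rule abs_summable_summable, unfold e, rule s')
  qed
  then show ?thesis
    by (subst (asm) has_sum_swap) (simp add: case_prod_unfold)
qed

section \<open>Convolution weights as Fourier multipliers\<close>

definition weight :: "(real \<Rightarrow> real) \<Rightarrow> bool" where
  "weight \<rho> \<longleftrightarrow> periodic_2pi \<rho> \<and> set_integrable lborel {0..2*pi} (\<lambda>s. of_real (\<rho> s) :: complex)"

definition multiplier :: "(real \<Rightarrow> real) \<Rightarrow> int \<Rightarrow> complex" where
  "multiplier \<rho> m = (LBINT s:{0..2*pi}. of_real (\<rho> s) * mode (- m) s)"

lemma weight_translate:
  assumes "weight \<rho>"
  shows "set_integrable lborel {0..2*pi} (\<lambda>\<tau>. of_real (\<rho> (t - \<tau>)) :: complex)"
  by (rule periodic_integral_reflect(1)[of "\<lambda>s. of_real (\<rho> s)"])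
     (use assms in \<open>auto simp: weight_def periodic_2pi_def\<close>)

text \<open>Modes are eigenfunctions of convolution operators.\<close>

lemma weight_convolve_mode:
  assumes \<rho>: "weight \<rho>"
  shows "(LBINT \<tau>:{0..2*pi}. of_real (\<rho> (t - \<tau>)) * mode m \<tau>) = multiplier \<rho> m * mode m t"
proof -
  let ?f = "\<lambda>s. of_real (\<rho> s) * mode (- m) s"
  have per: "periodic_2pi ?f"
    using \<rho> periodic_mode[of "- m"] by (simp add: weight_def periodic_2pi_def)
  have int: "set_integrable lborel {0..2*pi} ?f"
    by (rule set_integrable_mult_bounded[where B = 1]) (use \<rho> in \<open>auto simp: weight_def\<close>)
  have "mode m t * (mode (- m) t * mode m \<tau>) = mode m \<tau>" for \<tau>
    by (metis mode_0 mode_add mult.assoc mult_1 add.right_inverse)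
  then have "of_real (\<rho> (t - \<tau>)) * mode m \<tau> = mode m t * ?f (t - \<tau>)" for \<tau>
    by (simp add: mode_diff_arg mult_ac)
  then have "(LBINT \<tau>:{0..2*pi}. of_real (\<rho> (t - \<tau>)) * mode m \<tau>) = mode m t * (LBINT \<tau>:{0..2*pi}. ?f (t - \<tau>))"
    by (simp only: set_integral_mult_right)
  also have "(LBINT \<tau>:{0..2*pi}. ?f (t - \<tau>)) = multiplier \<rho> m"
    unfolding multiplier_def by (rule periodic_integral_reflect(2)[OF per int])
  finally show ?thesis by simp
qed

lemma norm_multiplier_le:
  assumes "weight \<rho>"
  shows "norm (multiplier \<rho> m) \<le> (LBINT s:{0..2*pi}. norm (of_real (\<rho> s) :: complex))"
  using set_integral_mult_norm_le[of "{0..2*pi}" "\<lambda>s. of_real (\<rho> s)" "mode (- m)" 1] assms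
  by (simp add: multiplier_def weight_def)

text \<open>This treats an integral operator and its discretization at once: \<open>b l\<close> will be the sequence
  shifted by \<open>l\<close>, or the interpolation of that. The triple series is integrated term by term,
  and the terms are then collected according to the output index \<open>m = i + j\<close>.\<close>

lemma weighted_kernel_series:
  fixes \<kappa> :: "int \<times> int \<Rightarrow> complex" and b :: "int \<Rightarrow> int \<Rightarrow> complex"
  assumes \<rho>: "weight \<rho>" and \<kappa>: "(\<lambda>x. norm (\<kappa> x)) summable_on UNIV"
    and b: "\<And>l. l1 (b l)" and A: "\<And>l. (\<Sum>\<^sub>\<infinity>i. norm (b l i)) \<le> A"
  defines "c \<equiv> \<lambda>m. \<Sum>\<^sub>\<infinity>(j, l). \<kappa> (j, l) * (multiplier \<rho> (m - j) * b l (m - j))"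
  shows "l1 c"
    and "(LBINT \<tau>:{0..2*pi}. of_real (\<rho> (t - \<tau>)) * (\<Sum>\<^sub>\<infinity>(j, l). \<kappa> (j, l) * (mode j t * fser (b l) \<tau>))) = fser c t"
proof -
  define R where "R = (LBINT s:{0..2*pi}. norm (of_real (\<rho> s) :: complex))"
  have R: "norm (multiplier \<rho> m) \<le> R" for m unfolding R_def by (rule norm_multiplier_le[OF \<rho>])
  have R0: "R \<ge> 0" using R[of 0] norm_ge_zero order_trans by blast
  define f where "f = (\<lambda>(x::int\<times>int, i::int). \<kappa> x * b (snd x) i)"
  have f: "(\<lambda>z. norm (f z)) summable_on UNIV \<times> UNIV"
    unfolding Infinite_Sum.abs_summable_on_Sigma_iff
  proof (intro conjI ballI)
    show "(\<lambda>i. norm (f (x, i))) summable_on UNIV" for x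
      using summable_on_cmult_right[OF b[of "snd x"], of "norm (\<kappa> x)"] by (simp add: f_def norm_mult)
    have e: "(\<Sum>\<^sub>\<infinity>i. norm (f (x, i))) = norm (\<kappa> x) * (\<Sum>\<^sub>\<infinity>i. norm (b (snd x) i))" for x
      by (simp add: f_def norm_mult infsum_cmult_right')
    show "(\<lambda>x. norm (\<Sum>\<^sub>\<infinity>i. norm (f (x, i)))) summable_on UNIV"
    proof (rule summable_on_comparison_test)
      show "(\<lambda>x. norm (\<kappa> x) * A) summable_on UNIV" by (rule summable_on_cmult_left[OF \<kappa>])
      show "norm (\<Sum>\<^sub>\<infinity>i. norm (f (x, i))) \<le> norm (\<kappa> x) * A" for x
        unfolding e using A[of "snd x"] by (auto simp: abs_mult infsum_nonneg intro!: mult_left_mono)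
    qed simp
  qed
  define h where "h = (\<lambda>(m::int, x::int\<times>int). \<kappa> x * (multiplier \<rho> (m - fst x) * b (snd x) (m - fst x)))"
  have bij: "bij_betw (\<lambda>(x, i). (i + fst x, x)) (UNIV :: ((int \<times> int) \<times> int) set) UNIV"
    by (rule bij_betwI[where g = "\<lambda>(m, x). (x, m - fst x)"]) auto
  have h: "(\<lambda>z. norm (h z)) summable_on UNIV \<times> UNIV"
  proof -
    have "(\<lambda>z. R * norm (f z)) summable_on UNIV" using summable_on_cmult_right[OF f, of R] by simp
    then have "(\<lambda>z. norm (h ((\<lambda>(x, i). (i + fst x, x)) z))) summable_on UNIV"
    proof (rule summable_on_comparison_test)
      fix z :: "(int \<times> int) \<times> int"
      show "norm (h ((\<lambda>(x, i). (i + fst x, x)) z)) \<le> R * norm (f z)"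
        using mult_right_mono[OF R[of "snd z"], of "norm (f z)"]
        by (auto simp: h_def f_def norm_mult split_beta mult_ac)
    qed simp
    then show ?thesis by (subst (asm) summable_on_reindex_bij_betw[OF bij]) simp
  qed
  have hm: "(\<lambda>x. norm (h (m, x))) summable_on UNIV" for m
    using h unfolding Infinite_Sum.abs_summable_on_Sigma_iff by blast
  have c: "((\<lambda>x. h (m, x)) has_sum c m) UNIV" for m
  proof -
    have "c m = (\<Sum>\<^sub>\<infinity>x. h (m, x))" by (simp add: c_def h_def case_prod_unfold)
    then show ?thesis using has_sum_infsum[OF abs_summable_summable[OF hm[of m]]] by simp
  qed
  show "l1 c"
  proof (rule summable_on_comparison_test)
    show "(\<lambda>m. \<Sum>\<^sub>\<infinity>x. norm (h (m, x))) summable_on UNIV"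
      by (rule summable_on_Sigma_banach) (use h in \<open>simp add: case_prod_unfold\<close>)
    show "norm (c m) \<le> (\<Sum>\<^sub>\<infinity>x. norm (h (m, x)))" for m
      by (rule norm_infsum_le[OF c has_sum_infsum[OF hm]]) simp
  qed simp
  define g where "g = (\<lambda>(x, i) \<tau>. f (x, i) * mode (fst x) t * mode i \<tau>)"
  let ?V = "LBINT \<tau>:{0..2*pi}. of_real (\<rho> (t - \<tau>)) * (\<Sum>\<^sub>\<infinity>(j, l). \<kappa> (j, l) * (mode j t * fser (b l) \<tau>))"
  have gs: "(\<Sum>\<^sub>\<infinity>z. g z \<tau>) = (\<Sum>\<^sub>\<infinity>(j, l). \<kappa> (j, l) * (mode j t * fser (b l) \<tau>))" for \<tau>
  proof -
    have ng: "norm (g z \<tau>) = norm (f z)" for z by (cases z) (simp add: g_def norm_mult)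
    have gs: "(\<lambda>z. g z \<tau>) summable_on UNIV \<times> UNIV"
      by (rule abs_summable_summable) (use f in \<open>simp only: ng\<close>)
    have "(\<Sum>\<^sub>\<infinity>z. g z \<tau>) = (\<Sum>\<^sub>\<infinity>x. \<Sum>\<^sub>\<infinity>i. g (x, i) \<tau>)"
      using infsum_Sigma_banach[OF gs] by simp
    also have "\<dots> = (\<Sum>\<^sub>\<infinity>x. \<kappa> x * (mode (fst x) t * fser (b (snd x)) \<tau>))"
    proof (rule infsum_cong)
      fix x :: "int \<times> int"
      have "g (x, i) \<tau> = (\<kappa> x * mode (fst x) t) * (b (snd x) i * mode i \<tau>)" for i
        by (simp add: g_def f_def mult_ac)
      then show "(\<Sum>\<^sub>\<infinity>i. g (x, i) \<tau>) = \<kappa> x * (mode (fst x) t * fser (b (snd x)) \<tau>)"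
        by (simp only: infsum_cmult_right' fser_def mult.assoc)
    qed
    finally show ?thesis by (simp only: case_prod_unfold prod.collapse)
  qed
  have "((\<lambda>z. LBINT \<tau>:{0..2*pi}. of_real (\<rho> (t - \<tau>)) * g z \<tau>) has_sum
     (LBINT \<tau>:{0..2*pi}. of_real (\<rho> (t - \<tau>)) * (\<Sum>\<^sub>\<infinity>z. g z \<tau>))) UNIV"
  proof (rule LBINT_has_sum[OF weight_translate[OF \<rho>]])
    show "(\<lambda>z. norm (f z)) summable_on UNIV" using f by simp
    show "continuous_on UNIV (g z)" for z
      unfolding g_def by (cases z) (auto intro!: continuous_intros)
    show "norm (g z \<tau>) \<le> norm (f z)" for z \<tau>
      by (cases z) (simp add: g_def norm_mult)
  qed
  moreover have "(LBINT \<tau>:{0..2*pi}. of_real (\<rho> (t - \<tau>)) * g z \<tau>) =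
      (\<lambda>(m, x). h (m, x) * mode m t) ((\<lambda>(x, i). (i + fst x, x)) z)" for z
  proof (cases z)
    case (Pair x i)
    have "(\<lambda>\<tau>. of_real (\<rho> (t - \<tau>)) * g (x, i) \<tau>)
        = (\<lambda>\<tau>. (f (x, i) * mode (fst x) t) * (of_real (\<rho> (t - \<tau>)) * mode i \<tau>))"
      by (simp add: g_def mult_ac fun_eq_iff)
    then have "(LBINT \<tau>:{0..2*pi}. of_real (\<rho> (t - \<tau>)) * g z \<tau>) = f (x, i) * mode (fst x) t * (multiplier \<rho> i * mode i t)"
      by (simp only: Pair set_integral_mult_right weight_convolve_mode[OF \<rho>])
    then show ?thesis by (simp add: Pair f_def h_def mode_add mult_ac)
  qed
  ultimately have "((\<lambda>z. (\<lambda>(m, x). h (m, x) * mode m t) ((\<lambda>(x, i). (i + fst x, x)) z)) has_sum ?V) UNIV"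
    by (simp only: gs)
  then have "((\<lambda>(m, x). h (m, x) * mode m t) has_sum ?V) (UNIV \<times> UNIV)"
    by (subst (asm) has_sum_reindex_bij_betw[OF bij]) simp
  then have "((\<lambda>m. c m * mode m t) has_sum ?V) UNIV"
    by (rule has_sum_SigmaD) (auto intro: has_sum_cmult_left[OF c])
  with fser_has_sum[OF \<open>l1 c\<close>] show "?V = fser c t" using has_sum_unique by blast
qed

definition shift :: "int \<Rightarrow> (int \<Rightarrow> complex) \<Rightarrow> int \<Rightarrow> complex" where
  "shift l a i = a (i - l)"

lemma bij_minus_int: "bij_betw (\<lambda>i::int. i - l) UNIV UNIV"
  by (rule bij_betwI[where g = "\<lambda>i. i + l"]) auto

lemma l1_shift: "l1 (shift l a) \<longleftrightarrow> l1 a"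
  using summable_on_reindex_bij_betw[OF bij_minus_int, of "\<lambda>i. norm (a i)" l] by (simp add: shift_def)

lemma infsum_norm_shift: "(\<Sum>\<^sub>\<infinity>i. norm (shift l a i)) = (\<Sum>\<^sub>\<infinity>i. norm (a i))"
  using infsum_reindex_bij_betw[OF bij_minus_int, of "\<lambda>i. norm (a i)" l] by (simp add: shift_def)

lemma fser_shift: "fser (shift l a) t = mode l t * fser a t"
proof -
  have "fser (shift l a) t = (\<Sum>\<^sub>\<infinity>i. (\<lambda>k. mode l t * (a k * mode k t)) (i - l))"
    unfolding fser_def
  proof (rule infsum_cong)
    fix i show "shift l a i * mode i t = mode l t * (a (i - l) * mode (i - l) t)"
      using mode_add[of "i - l" l t] by (simp add: shift_def)
  qed
  also have "\<dots> = mode l t * fser a t"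
    by (subst infsum_reindex_bij_betw[OF bij_minus_int]) (simp add: fser_def infsum_cmult_right')
  finally show ?thesis .
qed

text \<open>For \<open>Q = id\<close> these are the coefficients of an integral operator whose kernel is a double
  Fourier series with coefficients \<open>\<kappa>\<close> times a convolution weight with multiplier \<open>\<mu>\<close>:
  multiply by the mode \<open>l\<close>, convolve, multiply by the mode \<open>j\<close>. The map \<open>Q\<close> acts where the
  discretization interpolates, on the product of the density with the \<open>\<tau>\<close>-dependent part of
  the kernel.\<close>

definition ker_op :: "((int \<Rightarrow> complex) \<Rightarrow> int \<Rightarrow> complex) \<Rightarrow> (int \<times> int \<Rightarrow> complex) \<Rightarrow> (int \<Rightarrow> complex) \<Rightarrow>
    (int \<Rightarrow> complex) \<Rightarrow> int \<Rightarrow> complex" where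
  "ker_op Q \<kappa> \<mu> a m = (\<Sum>\<^sub>\<infinity>(j, l). \<kappa> (j, l) * (\<mu> (m - j) * Q (shift l a) (m - j)))"

lemma weighted_integral_op:
  assumes \<rho>: "weight \<rho>" and K: "smooth_biperiodic K" and a: "l1 a"
  shows "l1 (ker_op id (dcoef K) (multiplier \<rho>) a)"
    and "(LBINT \<tau>:{0..2*pi}. of_real (\<rho> (t - \<tau>)) * (K t \<tau> * fser a \<tau>)) = fser (ker_op id (dcoef K) (multiplier \<rho>) a) t"
proof -
  have b: "l1 (shift l a)" "(\<Sum>\<^sub>\<infinity>i. norm (shift l a i)) \<le> (\<Sum>\<^sub>\<infinity>i. norm (a i))" for l
    using a by (simp_all add: l1_shift infsum_norm_shift)
  note W = weighted_kernel_series[where b = "\<lambda>l. shift l a", OF \<rho> rapid_summable[OF rapid_dcoef[OF K]] b]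
  have op: "ker_op id (dcoef K) (multiplier \<rho>) a
      = (\<lambda>m. \<Sum>\<^sub>\<infinity>(j, l). dcoef K (j, l) * (multiplier \<rho> (m - j) * shift l a (m - j)))"
    by (simp add: ker_op_def fun_eq_iff)
  show "l1 (ker_op id (dcoef K) (multiplier \<rho>) a)"
    unfolding op by (rule W(1))
  have "K t \<tau> * fser a \<tau> = (\<Sum>\<^sub>\<infinity>(j, l). dcoef K (j, l) * (mode j t * fser (shift l a) \<tau>))" for \<tau>
  proof -
    have "K t \<tau> * fser a \<tau> = (\<Sum>\<^sub>\<infinity>x. (\<lambda>(j, l). dcoef K (j, l) * mode j t * mode l \<tau>) x * fser a \<tau>)"
      by (subst infsumI[OF smooth_biperiodic_double_series[OF K], symmetric]) (rule infsum_cmult_left'[symmetric])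
    then show ?thesis by (simp add: fser_shift case_prod_unfold mult.assoc)
  qed
  then show "(LBINT \<tau>:{0..2*pi}. of_real (\<rho> (t - \<tau>)) * (K t \<tau> * fser a \<tau>)) = fser (ker_op id (dcoef K) (multiplier \<rho>) a) t"
    unfolding op W(2)[symmetric] by simp
qed

section \<open>The logarithmic weights\<close>

text \<open>The product of \<open>sin (s / 2)\<close> and \<open>w_log s\<close>, written in the variable \<open>y = sin (s / 2)\<close>; it is
  continuous although \<open>w_log\<close> itself is singular.\<close>

definition y_log :: "real \<Rightarrow> real" where "y_log y = y * ln (4 * y\<^sup>2)"

lemma continuous_on_y_log: "continuous_on S y_log"
proof (rule continuous_at_imp_continuous_on, rule ballI)
  fix y :: real
  show "isCont y_log y"
  proof (cases "y = 0")
    case False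
    then show ?thesis unfolding y_log_def by (auto intro!: continuous_intros)
  next
    case True
    have bound: "norm (y_log z) \<le> \<bar>z\<bar> * ln 4 + 4 * sqrt \<bar>z\<bar>" if z: "\<bar>z\<bar> < 1" for z
    proof (cases "z = 0")
      case True then show ?thesis by (simp add: y_log_def)
    next
      case False
      define r where "r = sqrt \<bar>z\<bar>"
      have r: "r > 0" "r \<le> 1" "\<bar>z\<bar> = r\<^sup>2" using z False by (auto simp: r_def)
      have z2: "z\<^sup>2 = r ^ 4" using r(3) by (metis power2_abs power_mult numeral_Bit0 mult_2 power_add power2_eq_square)
      have "ln (1 / r) \<le> 1 / r" using r(1) ln_le_minus_one[of "1 / r"] by simp
      then have lr: "- ln r \<le> 1 / r" using r(1) by (simp add: ln_div)
      have "ln (4 * z\<^sup>2) = ln 4 + 4 * ln r" unfolding z2 using r(1) by (simp add: ln_mult ln_realpow)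
      moreover have "ln r \<le> 0" using r by simp
      moreover have "- (4 * ln r) \<le> 4 / r" using mult_left_mono[OF lr, of 4] by simp
      moreover have "ln (4::real) \<ge> 0" by simp
      moreover have "4 / r \<ge> 0" using r(1) by simp
      ultimately have "\<bar>ln (4 * z\<^sup>2)\<bar> \<le> ln 4 + 4 / r" by linarith
      then have "r\<^sup>2 * \<bar>ln (4 * z\<^sup>2)\<bar> \<le> r\<^sup>2 * (ln 4 + 4 / r)" by (intro mult_left_mono) auto
      also have "r\<^sup>2 * (ln 4 + 4 / r) = r\<^sup>2 * ln 4 + r\<^sup>2 * (4 / r)" by (rule distrib_left)
      also have "r\<^sup>2 * (4 / r) = 4 * r" using r(1) by (simp add: power2_eq_square)
      finally have "\<bar>z\<bar> * \<bar>ln (4 * z\<^sup>2)\<bar> \<le> \<bar>z\<bar> * ln 4 + 4 * sqrt \<bar>z\<bar>"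
        unfolding r(3)[symmetric] unfolding r_def .
      then show ?thesis by (simp only: y_log_def real_norm_def abs_mult)
    qed
    have "((\<lambda>z. \<bar>z\<bar> * ln 4 + 4 * sqrt \<bar>z\<bar>) \<longlongrightarrow> \<bar>0\<bar> * ln 4 + 4 * sqrt \<bar>0\<bar>) (at (0::real))"
      by (intro tendsto_intros)
    moreover have "\<forall>\<^sub>F z in at (0::real). norm (y_log z) \<le> \<bar>z\<bar> * ln 4 + 4 * sqrt \<bar>z\<bar>"
      using bound by (auto simp: eventually_at intro!: exI[of _ 1])
    ultimately have "(y_log \<longlongrightarrow> 0) (at 0)"
      by (intro Lim_null_comparison[where f = y_log]) auto
    then show ?thesis using True by (simp add: isCont_def y_log_def)
  qed
qed

lemma sin_half_pos: "s \<in> {0<..<2*pi} \<Longrightarrow> sin (s / 2) > 0"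
  by (intro sin_gt_zero) auto

lemma w_log_has_derivative:
  assumes "s \<in> {0<..<2*pi}"
  shows "(w_log has_real_derivative cos (s / 2) / sin (s / 2)) (at s)"
proof -
  have "sin (s / 2) > 0" using assms by (rule sin_half_pos)
  then show ?thesis unfolding w_log_def
    by (auto intro!: derivative_eq_intros simp: power2_eq_square field_simps)
qed

lemma mode_minus_one:
  "mode (- 1) s - 1 = - 2 * \<i> * of_real (sin (s / 2)) * cis (- s / 2)"
proof -
  have c: "cos s = 1 - 2 * (sin (s / 2))\<^sup>2" using cos_double_sin[of "s / 2"] by simp
  have d: "sin s = 2 * sin (s / 2) * cos (s / 2)" using sin_double[of "s / 2"] by simp
  show ?thesis by (simp add: mode_def complex_eq_iff c d power2_eq_square)
qed

lemma mode_plus_one: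
  "mode (- 1) s + 1 = 2 * of_real (cos (s / 2)) * cis (- s / 2)"
proof -
  have c: "cos s = 2 * (cos (s / 2))\<^sup>2 - 1" using cos_double_cos[of "s / 2"] by simp
  have d: "sin s = 2 * sin (s / 2) * cos (s / 2)" using sin_double[of "s / 2"] by simp
  show ?thesis by (simp add: mode_def complex_eq_iff c d power2_eq_square)
qed

lemma mode_of_nat: "mode (- int m) s = mode (- 1) s ^ m"
  by (simp only: mode_def Complex.DeMoivre of_int_minus of_int_of_nat_eq of_int_1 mult_minus_left mult_minus_right mult_1)

text \<open>The product \<open>G\<close> of \<open>mode (- m) s - 1\<close> and \<open>w_log s\<close> is differentiated. Its factor \<open>mode (-
  1) s - 1\<close> vanishes like \<open>sin (s / 2)\<close> at the ends of the period: hence \<open>G\<close> is continuous and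
  zero there, and the term of the derivative that contains the cotangent, the derivative of
  \<open>w_log\<close>, is a trigonometric polynomial. The other term is a multiple of the integrand in
  question.\<close>

lemma w_log_mode_has_integral:
  assumes "m \<ge> 1"
  shows "((\<lambda>s. of_real (w_log s) * mode (- int m) s) has_integral - 2 * of_real pi / of_nat m) {0..2*pi}"
proof -
  let ?z = "mode (- 1)" and ?S = "\<lambda>s. \<Sum>k<m. mode (- 1) s ^ k"
  define G where "G = (\<lambda>s. - 2 * \<i> * of_real (y_log (sin (s / 2))) * cis (- s / 2) * ?S s)"
  have G: "G s = (mode (- int m) s - 1) * of_real (w_log s)" for s
  proof -
    have "(mode (- int m) s - 1) = (mode (- 1) s - 1) * ?S s"
      unfolding mode_of_nat by (rule power_diff_1_eq)
    then show ?thesis by (simp add: mode_minus_one G_def y_log_def w_log_def mult_ac)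
  qed
  have contG: "continuous_on {0..2*pi} G"
    unfolding G_def
    by (intro continuous_intros continuous_on_compose2[OF continuous_on_y_log[of UNIV]]) auto
  \<comment> \<open>the derivative of \<open>G\<close> in the interior of the period\<close>
  define D where "D = (\<lambda>s. - \<i> * of_nat m * (of_real (w_log s) * mode (- int m) s) - \<i> * ((mode (- 1) s + 1) * ?S s))"
  have "(D has_integral (G (2*pi) - G 0)) {0..2*pi}"
  proof (rule fundamental_theorem_of_calculus_interior[OF _ contG])
    fix s assume s: "s \<in> {0<..<2*pi}"
    have sp: "sin (s / 2) > 0" by (rule sin_half_pos[OF s])
    have d2: "((\<lambda>s. of_real (w_log s) :: complex) has_vector_derivative of_real (cos (s / 2) / sin (s / 2))) (at s)"
      by (rule has_vector_derivative_of_real[OF w_log_has_derivative[OF s]])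
    have d3: "((\<lambda>s. mode (- int m) s - 1) has_vector_derivative \<i> * of_int (- int m) * mode (- int m) s) (at s)"
      using has_vector_derivative_diff[OF has_vector_derivative_mode[of "- int m" s UNIV] has_vector_derivative_const[of 1]]
      by simp
    have A: "(G has_vector_derivative
        ((mode (- int m) s - 1) * of_real (cos (s / 2) / sin (s / 2))
          + (\<i> * of_int (- int m) * mode (- int m) s) * of_real (w_log s))) (at s)"
      unfolding G by (rule has_vector_derivative_mult[OF d3 d2])
    have B: "(mode (- int m) s - 1) * of_real (cos (s / 2) / sin (s / 2)) = - \<i> * ((mode (- 1) s + 1) * ?S s)"
    proof -
      have "(mode (- int m) s - 1) = (mode (- 1) s - 1) * ?S s"
        unfolding mode_of_nat by (rule power_diff_1_eq)
      then have "(mode (- int m) s - 1) * of_real (cos (s / 2) / sin (s / 2))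
         = (- 2 * \<i> * of_real (sin (s / 2)) * cis (- s / 2)) * ?S s * of_real (cos (s / 2) / sin (s / 2))"
        by (simp only: mode_minus_one)
      also have "\<dots> = - \<i> * (2 * of_real (cos (s / 2)) * cis (- s / 2) * ?S s)"
        using sp by (simp add: field_simps)
      finally show ?thesis by (simp only: mode_plus_one)
    qed
    have "(mode (- int m) s - 1) * of_real (cos (s / 2) / sin (s / 2))
          + (\<i> * of_int (- int m) * mode (- int m) s) * of_real (w_log s) = D s"
      unfolding B by (simp add: D_def)
    with A show "(G has_vector_derivative D s) (at s)" by (simp only:)
  qed simp
  moreover have "G (2*pi) - G 0 = 0" by (simp add: G_def y_log_def)
  ultimately have D: "(D has_integral 0) {0..2*pi}" by simp
  \<comment> \<open>the only constant term of this trigonometric polynomial comes from \<open>k = 0\<close>\<close>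
  have "((\<lambda>s. (mode (- 1) s + 1) * ?S s) has_integral 2 * of_real pi) {0..2*pi}"
  proof -
    have M: "((\<lambda>s. mode k s) has_integral (if k = 0 then 2 * of_real pi else 0)) {0..2*pi}" for k
    proof -
      have i: "set_integrable lborel {0..2*pi} (mode k)"
        by (intro integrable_continuous_period) (auto intro!: continuous_intros simp: mode_def)
      show ?thesis using set_borel_integral_eq_integral[OF i] LBINT_mode[of k]
        by (metis integrable_integral)
    qed
    have "((\<lambda>s. \<Sum>k<m. mode (- int (Suc k)) s + mode (- int k) s) has_integral
        (\<Sum>k<m. (if - int (Suc k) = 0 then 2 * of_real pi else 0) + (if - int k = 0 then 2 * of_real pi else 0))) {0..2*pi}"
      by (intro has_integral_sum has_integral_add M) auto
    also have "(\<Sum>k<m. (if - int (Suc k) = 0 then 2 * of_real pi else 0) + (if - int k = 0 then 2 * of_real pi else 0))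
        = (2 * of_real pi :: complex)"
      using assms by (simp add: sum.delta)
    also have "(\<lambda>s. \<Sum>k<m. mode (- int (Suc k)) s + mode (- int k) s) = (\<lambda>s. (mode (- 1) s + 1) * ?S s)"
      unfolding mode_of_nat by (simp add: sum_distrib_left algebra_simps sum.distrib)
    finally show ?thesis .
  qed
  from has_integral_add[OF D has_integral_mult_right[OF this, of \<i>]]
  have "((\<lambda>s. - \<i> * of_nat m * (of_real (w_log s) * mode (- int m) s)) has_integral \<i> * (2 * of_real pi)) {0..2*pi}"
    by (simp add: D_def)
  from has_integral_mult_right[OF this, of "\<i> / of_nat m"] show ?thesis
    using assms by (simp add: field_simps)
qed

text \<open>Split \<open>w_log s = w_log s * cos s + (1 - cos s) * w_log s\<close>: the first term is integrable by
  the preceding computation with \<open>m = 1\<close>, the second is continuous. The integral is absolute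
  because \<open>w_log \<le> ln 4\<close>.\<close>

lemma weight_w_log: "weight w_log"
  unfolding weight_def
proof
  show "periodic_2pi w_log"
  proof (simp add: periodic_2pi_def w_log_def, rule allI)
    fix t have "sin ((t + 2 * pi) / 2) = - sin (t / 2)"
      using sin_periodic_pi[of "t / 2"] by (simp add: add_divide_distrib)
    then show "ln (4 * (sin ((t + 2 * pi) / 2))\<^sup>2) = ln (4 * (sin (t / 2))\<^sup>2)" by simp
  qed
  have m [measurable]: "w_log \<in> borel_measurable borel"
    unfolding w_log_def by measurable
  have "((\<lambda>s. Re (of_real (w_log s) * mode (- int 1) s)) has_integral Re (- 2 * of_real pi / of_nat 1)) {0..2*pi}"
    using has_integral_linear[OF w_log_mode_has_integral[of 1] bounded_linear_Re] by (simp add: o_def)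
  then have "(\<lambda>s. w_log s * cos s) integrable_on {0..2*pi}"
    by (auto simp: mode_def integrable_on_def)
  moreover have "(\<lambda>s. 2 * sin (s / 2) * y_log (sin (s / 2))) integrable_on {0..2*pi}"
    by (intro integrable_continuous_interval continuous_intros continuous_on_compose2[OF continuous_on_y_log[of UNIV]]) auto
  ultimately have "(\<lambda>s. w_log s * cos s + 2 * sin (s / 2) * y_log (sin (s / 2))) integrable_on {0..2*pi}"
    by (rule integrable_add)
  moreover have "w_log s * cos s + 2 * sin (s / 2) * y_log (sin (s / 2)) = w_log s" for s
  proof -
    have c: "cos s = 1 - 2 * (sin (s / 2))\<^sup>2" using cos_double_sin[of "s / 2"] by simp
    show ?thesis by (simp add: c w_log_def y_log_def power2_eq_square algebra_simps)
  qed
  ultimately have "w_log integrable_on {0..2*pi}" by simp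
  then have hk: "(\<lambda>s. ln 4 - w_log s) integrable_on {0..2*pi}"
    by (intro integrable_diff) auto
  have nonneg: "ln 4 - w_log s \<ge> 0" for s
  proof (cases "sin (s / 2) = 0")
    case False
    have "(sin (s / 2))\<^sup>2 \<le> 1" by (simp add: abs_square_le_1)
    moreover have "(sin (s / 2))\<^sup>2 > 0" using False by simp
    ultimately show ?thesis unfolding w_log_def by (subst diff_ge_0_iff_ge, subst ln_le_cancel_iff) auto
  qed (simp add: w_log_def)
  have "(\<lambda>s. ln 4 - w_log s) absolutely_integrable_on {0..2*pi}"
    by (rule nonnegative_absolutely_integrable_1[OF hk nonneg])
  then have "integrable lebesgue (\<lambda>s. indicat_real {0..2*pi} s *\<^sub>R (ln 4 - w_log s))"
    by (simp add: set_integrable_def)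
  then have "integrable lborel (\<lambda>s. indicat_real {0..2*pi} s *\<^sub>R (ln 4 - w_log s))"
    by (subst (asm) integrable_completion) auto
  then have i: "set_integrable lborel {0..2*pi} (\<lambda>s. ln 4 - w_log s)" by (simp add: set_integrable_def)
  have "set_integrable lborel {0..2*pi} (\<lambda>s. ln 4 - (ln 4 - w_log s))"
    by (rule set_integral_diff(1)[OF _ i]) (auto intro!: borel_integrable_atLeastAtMost')
  then have "integrable lborel (\<lambda>s. indicat_real {0..2*pi} s *\<^sub>R w_log s)" by (simp add: set_integrable_def)
  from integrable_of_real[OF this, where ?'a = complex]
  show "set_integrable lborel {0..2*pi} (\<lambda>s. of_real (w_log s) :: complex)"
    by (simp add: set_integrable_def scaleR_conv_of_real)
qed

lemma weight_mult_bounded: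
  assumes \<rho>: "weight \<rho>" and c: "continuous_on UNIV c" "periodic_2pi c" and B: "\<And>s. \<bar>c s\<bar> \<le> B"
  shows "weight (\<lambda>s. c s * \<rho> s)"
proof -
  have "set_integrable lborel {0..2*pi} (\<lambda>s. of_real (\<rho> s) * of_real (c s) :: complex)"
    by (rule set_integrable_mult_bounded[where B = B])
       (use \<rho> B in \<open>auto simp: weight_def intro!: borel_measurable_continuous_onI continuous_intros c\<close>)
  then show ?thesis using \<rho> c(2) by (simp add: weight_def periodic_2pi_def mult_ac)
qed

lemma weight_w_one: "weight w_one"
  by (auto simp: weight_def periodic_2pi_def w_one_def intro!: integrable_continuous_period)

lemma w_sin2log_eq: "w_sin2log s = (sin (s / 2))\<^sup>2 * w_log s"
  by (simp add: w_sin2log_def w_log_def)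

lemma weight_w_sin2log: "weight w_sin2log"
proof -
  have "weight (\<lambda>s. (sin (s / 2))\<^sup>2 * w_log s)"
  proof (rule weight_mult_bounded[OF weight_w_log])
    show "periodic_2pi (\<lambda>s. (sin (s / 2))\<^sup>2)"
    proof (unfold periodic_2pi_def, rule allI)
      fix t have "sin ((t + 2 * pi) / 2) = - sin (t / 2)"
        using sin_periodic_pi[of "t / 2"] by (simp add: add_divide_distrib)
      then show "(sin ((t + 2 * pi) / 2))\<^sup>2 = (sin (t / 2))\<^sup>2" by simp
    qed
    show "\<bar>(sin (s / 2))\<^sup>2\<bar> \<le> 1" for s :: real by (simp add: abs_square_le_1)
  qed (auto intro!: continuous_intros)
  then show ?thesis by (simp add: w_sin2log_eq[abs_def])
qed

definition order_one_multiplier :: "(int \<Rightarrow> complex) \<Rightarrow> bool" where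
  "order_one_multiplier \<mu> \<longleftrightarrow> (\<exists>C\<ge>0. \<forall>m. (1 + (of_int m)\<^sup>2) * (norm (\<mu> m))\<^sup>2 \<le> C)"

lemma weight_times_mode_integrable:
  "weight \<rho> \<Longrightarrow> set_integrable lborel {0..2*pi} (\<lambda>s. of_real (\<rho> s) * mode m s)"
  by (rule set_integrable_mult_bounded[where B = 1]) (auto simp: weight_def)

lemma multiplier_w_log:
  assumes "m \<noteq> 0"
  shows "norm (multiplier w_log m) = 2 * pi / \<bar>of_int m\<bar>"
proof -
  have pos: "multiplier w_log (int k) = - 2 * of_real pi / of_nat k" if "k \<ge> 1" for k
    unfolding multiplier_def
    using set_borel_integral_eq_integral(2)[OF weight_times_mode_integrable[OF weight_w_log, of "- int k"]]
      integral_unique[OF w_log_mode_has_integral[OF that]] by simp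
  have "multiplier w_log (- m) = cnj (multiplier w_log m)" for m
    unfolding multiplier_def set_lebesgue_integral_def
    by (subst Bochner_Integration.integral_cnj[symmetric]) (simp add: mode_def cis_cnj)
  then have sym: "norm (multiplier w_log (- m)) = norm (multiplier w_log m)" for m by simp
  obtain k where k: "k \<ge> 1" "m = int k \<or> m = - int k"
  proof (rule that)
    show "nat \<bar>m\<bar> \<ge> 1" using assms by linarith
    show "m = int (nat \<bar>m\<bar>) \<or> m = - int (nat \<bar>m\<bar>)" by linarith
  qed
  then show ?thesis using pos[OF k(1)] sym[of "int k"] by (auto simp: norm_divide norm_mult)
qed

lemma order_one_w_log: "order_one_multiplier (multiplier w_log)"
proof -
  define C where "C = max ((norm (multiplier w_log 0))\<^sup>2) (8 * pi\<^sup>2)"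
  have "(1 + (of_int m)\<^sup>2) * (norm (multiplier w_log m))\<^sup>2 \<le> C" for m
  proof (cases "m = 0")
    case False
    then have m: "1 \<le> (of_int m :: real)\<^sup>2"
      by (metis int_one_le_iff_zero_less of_int_1_le_iff of_int_power zero_less_power2)
    have "(1 + (of_int m)\<^sup>2) * (2 * pi / \<bar>of_int m\<bar>)\<^sup>2 = (1 + (of_int m)\<^sup>2) * (4 * pi\<^sup>2) / (of_int m)\<^sup>2"
      by (simp add: power_divide power_mult_distrib)
    also have "\<dots> \<le> (2 * (of_int m)\<^sup>2) * (4 * pi\<^sup>2) / (of_int m)\<^sup>2"
      using m by (intro divide_right_mono mult_right_mono) auto
    also have "\<dots> = 8 * pi\<^sup>2" using False by simp
    finally show ?thesis using False by (simp add: multiplier_w_log C_def)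
  qed (simp add: C_def)
  then show ?thesis unfolding order_one_multiplier_def by (intro exI[of _ C]) (auto simp: C_def le_max_iff_disj)
qed

lemma order_one_w_one: "order_one_multiplier (multiplier w_one)"
  unfolding order_one_multiplier_def
proof (intro exI conjI allI)
  show "(0::real) \<le> 4 * pi\<^sup>2" by simp
  fix m show "(1 + (of_int m)\<^sup>2) * (norm (multiplier w_one m))\<^sup>2 \<le> 4 * pi\<^sup>2"
    by (simp add: multiplier_def w_one_def LBINT_mode norm_mult power_mult_distrib)
qed

text \<open>The factor \<open>(sin (s / 2))\<^sup>2\<close> is a combination of the modes \<open>0\<close>, \<open>1\<close> and \<open>- 1\<close>.\<close>

lemma multiplier_w_sin2log:
  "multiplier w_sin2log m = multiplier w_log m / 2 - multiplier w_log (m + 1) / 4 - multiplier w_log (m - 1) / 4"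
proof -
  have s: "of_real ((sin (s / 2))\<^sup>2) = (1 / 2 - mode (- 1) s / 4 - mode 1 s / 4 :: complex)" for s
  proof -
    have c: "cos s = 1 - 2 * (sin (s / 2))\<^sup>2" using cos_double_sin[of "s / 2"] by simp
    show ?thesis by (simp add: mode_def complex_eq_iff c field_simps)
  qed
  have "of_real (w_sin2log s) * mode (- m) s = of_real (w_log s) * mode (- m) s / 2
     - of_real (w_log s) * mode (- (m + 1)) s / 4 - of_real (w_log s) * mode (- (m - 1)) s / 4" for s
  proof -
    have "mode (- (m + 1)) s = mode (- m) s * mode (- 1) s" "mode (- (m - 1)) s = mode (- m) s * mode 1 s"
      using mode_add[of "- m" "- 1" s] mode_add[of "- m" 1 s] by simp_all
    then show ?thesis
      by (simp only: w_sin2log_eq of_real_mult s) (simp only: algebra_simps times_divide_eq_left times_divide_eq_right mult_1_right mult_1_left)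
  qed
  then show ?thesis unfolding multiplier_def
    by (simp add: weight_times_mode_integrable[OF weight_w_log] set_integral_diff)
qed

lemma weight_shift_le: "1 + (of_int m)\<^sup>2 \<le> 3 * (1 + (of_int (m + 1))\<^sup>2 :: real)"
  "1 + (of_int m)\<^sup>2 \<le> 3 * (1 + (of_int (m - 1))\<^sup>2 :: real)"
proof -
  have "0 \<le> 2 * (x + 3 / 2)\<^sup>2" "0 \<le> 2 * (x - 3 / 2)\<^sup>2" for x :: real by simp_all
  then have "0 \<le> 2 * x\<^sup>2 + 6 * x + 9 / 2" "0 \<le> 2 * x\<^sup>2 - 6 * x + 9 / 2" for x :: real
    by (simp_all add: power2_eq_square algebra_simps)
  from this(1)[of "of_int m"] this(2)[of "of_int m"]
  show "1 + (of_int m)\<^sup>2 \<le> 3 * (1 + (of_int (m + 1))\<^sup>2 :: real)"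
    "1 + (of_int m)\<^sup>2 \<le> 3 * (1 + (of_int (m - 1))\<^sup>2 :: real)"
    by (simp_all add: power2_eq_square algebra_simps)
qed

lemma order_one_w_sin2log: "order_one_multiplier (multiplier w_sin2log)"
proof -
  obtain C where C: "C \<ge> 0" "\<And>m. (1 + (of_int m)\<^sup>2) * (norm (multiplier w_log m))\<^sup>2 \<le> C"
    using order_one_w_log unfolding order_one_multiplier_def by blast
  let ?\<mu> = "\<lambda>m. norm (multiplier w_log m)"
  have "(1 + (of_int m)\<^sup>2) * (norm (multiplier w_sin2log m))\<^sup>2 \<le> 21 * C" for m
  proof -
    have "norm (multiplier w_sin2log m) \<le> ?\<mu> m + ?\<mu> (m + 1) + ?\<mu> (m - 1)"
      unfolding multiplier_w_sin2log
      using norm_triangle_ineq4[of "multiplier w_log m / 2 - multiplier w_log (m + 1) / 4" "multiplier w_log (m - 1) / 4"]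
        norm_triangle_ineq4[of "multiplier w_log m / 2" "multiplier w_log (m + 1) / 4"]
        norm_ge_zero[of "multiplier w_log m"] norm_ge_zero[of "multiplier w_log (m + 1)"]
        norm_ge_zero[of "multiplier w_log (m - 1)"]
      by (simp only: norm_divide norm_numeral)
    then have "(norm (multiplier w_sin2log m))\<^sup>2 \<le> (?\<mu> m + ?\<mu> (m + 1) + ?\<mu> (m - 1))\<^sup>2"
      by (intro power_mono) auto
    also have "\<dots> \<le> 3 * ((?\<mu> m)\<^sup>2 + (?\<mu> (m + 1))\<^sup>2 + (?\<mu> (m - 1))\<^sup>2)"
    proof -
      have "(a + b + c)\<^sup>2 \<le> 3 * (a\<^sup>2 + b\<^sup>2 + c\<^sup>2)" for a b c :: real
      proof -
        have "0 \<le> (a - b)\<^sup>2 + (a - c)\<^sup>2 + (b - c)\<^sup>2" by simp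
        then show ?thesis by (simp add: power2_eq_square algebra_simps)
      qed
      then show ?thesis .
    qed
    finally have "(1 + (of_int m)\<^sup>2) * (norm (multiplier w_sin2log m))\<^sup>2
        \<le> (1 + (of_int m)\<^sup>2) * (3 * ((?\<mu> m)\<^sup>2 + (?\<mu> (m + 1))\<^sup>2 + (?\<mu> (m - 1))\<^sup>2))"
      by (rule mult_left_mono) simp
    also have "\<dots> = 3 * ((1 + (of_int m)\<^sup>2) * (?\<mu> m)\<^sup>2) + 3 * ((1 + (of_int m)\<^sup>2) * (?\<mu> (m + 1))\<^sup>2)
       + 3 * ((1 + (of_int m)\<^sup>2) * (?\<mu> (m - 1))\<^sup>2)" by (simp only: distrib_left mult.left_commute)
    also have "\<dots> \<le> 3 * C + 3 * (3 * C) + 3 * (3 * C)"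
    proof (intro add_mono mult_left_mono C(2))
      show "(1 + (of_int m)\<^sup>2) * (?\<mu> (m + 1))\<^sup>2 \<le> 3 * C"
        using mult_right_mono[OF weight_shift_le(1)[of m], of "(?\<mu> (m + 1))\<^sup>2"] C(2)[of "m + 1"]
        by (simp only: mult.assoc) simp
      show "(1 + (of_int m)\<^sup>2) * (?\<mu> (m - 1))\<^sup>2 \<le> 3 * C"
        using mult_right_mono[OF weight_shift_le(2)[of m], of "(?\<mu> (m - 1))\<^sup>2"] C(2)[of "m - 1"]
        by (simp only: mult.assoc) simp
    qed auto
    finally show ?thesis by simp
  qed
  then show ?thesis unfolding order_one_multiplier_def using C(1) by (intro exI[of _ "21 * C"]) auto
qed

section \<open>Trigonometric interpolation of Fourier series\<close>

lemma has_sum_sum: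
  fixes f :: "'j \<Rightarrow> 'x \<Rightarrow> complex"
  assumes "finite J" "\<And>j. j \<in> J \<Longrightarrow> (f j has_sum s j) A"
  shows "((\<lambda>x. \<Sum>j\<in>J. f j x) has_sum (\<Sum>j\<in>J. s j)) A"
  using assms by (induction J rule: finite_induct) (auto intro!: has_sum_add)

lemma mode_node: "mode r (node n j) = cis (of_int r * pi / real n) ^ j"
  by (simp only: mode_def node_def Complex.DeMoivre) (simp add: mult_ac)

text \<open>A geometric sum of roots of unity of order \<open>2 * n\<close>. The nodes thus cannot tell apart modes
  whose indices differ by a multiple of \<open>2 * n\<close>.\<close>

lemma sum_mode_nodes:
  assumes n: "n \<ge> 1"
  shows "(\<Sum>j<2*n. mode r (node n j)) = (if 2 * int n dvd r then 2 * of_nat n else 0)"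
proof (cases "2 * int n dvd r")
  case True
  then obtain k where k: "r = 2 * int n * k" by auto
  have "cis (of_int r * pi / real n) = 1"
  proof -
    have "of_int r * pi / real n = 2 * pi * of_int k" using n by (simp add: k)
    then show ?thesis using cis_multiple_2pi[of "of_int k"] by simp
  qed
  then show ?thesis using True by (simp add: mode_node)
next
  case False
  define w where "w = cis (of_int r * pi / real n)"
  have "w \<noteq> 1"
  proof
    assume "w = 1"
    then have "cos (of_int r * pi / real n) = 1" by (simp add: w_def complex_eq_iff)
    then obtain k :: int where "of_int r * pi / real n = of_int k * 2 * pi" by (auto simp: cos_one_2pi_int)
    then have "of_int r = (of_int (2 * int n * k) :: real)" using n by (simp add: field_simps)
    then have "r = 2 * int n * k" by (simp only: of_int_eq_iff)
    with False show False by simp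
  qed
  moreover have "w ^ (2 * n) = 1"
  proof -
    have "w ^ (2 * n) = cis (2 * pi * of_int r)"
      unfolding w_def Complex.DeMoivre using n by (simp add: field_simps)
    then show ?thesis using cis_multiple_2pi[of "of_int r"] by simp
  qed
  ultimately have "(\<Sum>j<2*n. w ^ j) = 0"
    using power_diff_1_eq[of w "2 * n"] by simp
  then show ?thesis using False by (simp add: mode_node w_def)
qed

text \<open>The modes \<open>n\<close> and \<open>- n\<close> agree at the nodes, and the trigonometric space contains only their
  mean \<open>cos (n t)\<close>; the discrete coefficient is therefore shared equally between the two
  indices.\<close>

definition interp_weight :: "nat \<Rightarrow> int \<Rightarrow> complex" where
  "interp_weight n r = (if \<bar>r\<bar> < int n then 1 else if \<bar>r\<bar> = int n then 1 / 2 else 0)"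

definition dft :: "nat \<Rightarrow> (real \<Rightarrow> complex) \<Rightarrow> int \<Rightarrow> complex" where
  "dft n \<phi> r = interp_weight n r / (2 * of_nat n) * (\<Sum>j<2*n. \<phi> (node n j) * mode (- r) (node n j))"

text \<open>Equality of the two extreme coefficients excludes \<open>sin (n t)\<close>.\<close>

definition trig_coeffs :: "nat \<Rightarrow> (int \<Rightarrow> complex) set" where
  "trig_coeffs n = {c. (\<forall>r. \<bar>r\<bar> > int n \<longrightarrow> c r = 0) \<and> c (int n) = c (- int n)}"

lemma fser_finite_support:
  assumes "\<And>r. \<bar>r\<bar> > int n \<Longrightarrow> c r = 0"
  shows "fser c t = (\<Sum>r\<in>{- int n..int n}. c r * mode r t)"
  unfolding fser_def
  by (rule infsumI, rule has_sum_finite_neutralI[of "{- int n..int n}"]) (use assms in auto)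

lemma l1_finite_support:
  assumes "\<And>r. \<bar>r\<bar> > int n \<Longrightarrow> c r = 0"
  shows "l1 c" "(\<Sum>\<^sub>\<infinity>r. norm (c r)) = (\<Sum>r\<in>{- int n..int n}. norm (c r))"
proof -
  have "((\<lambda>r. norm (c r)) has_sum (\<Sum>r\<in>{- int n..int n}. norm (c r))) UNIV"
    by (rule has_sum_finite_neutralI[of "{- int n..int n}"]) (use assms in auto)
  then show "l1 c" "(\<Sum>\<^sub>\<infinity>r. norm (c r)) = (\<Sum>r\<in>{- int n..int n}. norm (c r))"
    by (auto simp: has_sum_iff)
qed

lemma sum_symmetric_interval:
  fixes f :: "int \<Rightarrow> 'a::comm_monoid_add"
  shows "(\<Sum>r\<in>{- int n..int n}. f r) = f 0 + (\<Sum>m=1..n. f (int m) + f (- int m))"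
proof (induction n)
  case (Suc n)
  have "{- int (Suc n)..int (Suc n)} = insert (int (Suc n)) (insert (- int (Suc n)) {- int n..int n})" by auto
  then show ?case using Suc by (simp add: add_ac)
qed simp

lemma mode_int: "mode (int m) t = of_real (cos (real m * t)) + \<i> * of_real (sin (real m * t))"
  "mode (- int m) t = of_real (cos (real m * t)) - \<i> * of_real (sin (real m * t))"
  by (simp_all add: mode_def complex_eq_iff)

lemma trig_space_eq:
  assumes n: "n \<ge> 1"
  shows "trig_space n = fser ` trig_coeffs n"
proof (intro equalityI subsetI)
  fix v assume "v \<in> trig_space n"
  then obtain a b where v: "\<And>t. v t = (\<Sum>m=0..n. a m * of_real (cos (real m * t))) + (\<Sum>m=1..<n. b m * of_real (sin (real m * t)))"
    by (auto simp: trig_space_def)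
  define c where "c = (\<lambda>r::int. if r = 0 then a 0 else if \<bar>r\<bar> < int n then
     (a (nat \<bar>r\<bar>) - \<i> * of_int (sgn r) * b (nat \<bar>r\<bar>)) / 2 else if \<bar>r\<bar> = int n then a n / 2 else 0)"
  have c: "c \<in> trig_coeffs n" using n by (auto simp: trig_coeffs_def c_def)
  have "v t = fser c t" for t
  proof -
    have "fser c t = (\<Sum>r\<in>{- int n..int n}. c r * mode r t)"
      by (rule fser_finite_support) (use n in \<open>auto simp: c_def\<close>)
    also have "\<dots> = c 0 + (\<Sum>m=1..n. c (int m) * mode (int m) t + c (- int m) * mode (- int m) t)"
      by (simp add: sum_symmetric_interval)
    also have "(\<Sum>m=1..n. c (int m) * mode (int m) t + c (- int m) * mode (- int m) t)
        = (\<Sum>m=1..n. a m * of_real (cos (real m * t)) + (if m < n then b m * of_real (sin (real m * t)) else 0))"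
    proof (rule sum.cong[OF refl])
      fix m assume m: "m \<in> {1..n}"
      show "c (int m) * mode (int m) t + c (- int m) * mode (- int m) t
        = a m * of_real (cos (real m * t)) + (if m < n then b m * of_real (sin (real m * t)) else 0)"
        using m unfolding mode_int c_def by (auto simp: field_simps)
    qed
    also have "\<dots> = (\<Sum>m=1..n. a m * of_real (cos (real m * t))) + (\<Sum>m=1..n. if m < n then b m * of_real (sin (real m * t)) else 0)"
      by (rule sum.distrib)
    also have "(\<Sum>m=1..n. if m < n then b m * of_real (sin (real m * t)) else 0) = (\<Sum>m=1..<n. b m * of_real (sin (real m * t)))"
      by (rule sum.mono_neutral_cong_right) auto
    finally show ?thesis by (simp add: v c_def sum.atLeast_Suc_atMost[of 0 n])
  qed
  then show "v \<in> fser ` trig_coeffs n" using c by (auto simp: fun_eq_iff)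
next
  fix v assume "v \<in> fser ` trig_coeffs n"
  then obtain c where c: "c \<in> trig_coeffs n" "v = fser c" by auto
  define a where "a = (\<lambda>m::nat. if m = 0 then c 0 else c (int m) + c (- int m))"
  define b where "b = (\<lambda>m::nat. \<i> * (c (int m) - c (- int m)))"
  have "v t = (\<Sum>m=0..n. a m * of_real (cos (real m * t))) + (\<Sum>m=1..<n. b m * of_real (sin (real m * t)))" for t
  proof -
    have "v t = (\<Sum>r\<in>{- int n..int n}. c r * mode r t)"
      unfolding c(2) by (rule fser_finite_support) (use c(1) in \<open>auto simp: trig_coeffs_def\<close>)
    also have "\<dots> = c 0 + (\<Sum>m=1..n. c (int m) * mode (int m) t + c (- int m) * mode (- int m) t)"
      by (simp add: sum_symmetric_interval)
    also have "(\<Sum>m=1..n. c (int m) * mode (int m) t + c (- int m) * mode (- int m) t)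
        = (\<Sum>m=1..n. a m * of_real (cos (real m * t)) + b m * of_real (sin (real m * t)))"
      by (rule sum.cong[OF refl]) (auto simp: mode_int a_def b_def algebra_simps)
    also have "\<dots> = (\<Sum>m=1..n. a m * of_real (cos (real m * t))) + (\<Sum>m=1..n. b m * of_real (sin (real m * t)))"
      by (rule sum.distrib)
    also have "(\<Sum>m=1..n. b m * of_real (sin (real m * t))) = (\<Sum>m=1..<n. b m * of_real (sin (real m * t)))"
    proof (rule sum.mono_neutral_right)
      show "\<forall>m\<in>{1..n} - {1..<n}. b m * of_real (sin (real m * t)) = 0"
      proof
        fix m assume "m \<in> {1..n} - {1..<n}"
        then have "m = n" by auto
        then show "b m * of_real (sin (real m * t)) = 0" using c(1) by (simp add: b_def trig_coeffs_def)
      qed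
    qed auto
    finally show ?thesis by (simp add: a_def sum.atLeast_Suc_atMost[of 0 n])
  qed
  then show "v \<in> trig_space n" unfolding trig_space_def by blast
qed

lemma dft_in_trig_coeffs:
  assumes n: "n \<ge> 1" shows "dft n \<phi> \<in> trig_coeffs n"
proof -
  have "mode (- int n) (node n j) = mode (int n) (node n j)" for j
  proof -
    have "cis (- pi) = cis pi" by (simp add: complex_eq_iff)
    then show ?thesis using n unfolding mode_node by simp
  qed
  then have "dft n \<phi> (int n) = dft n \<phi> (- int n)" by (simp add: dft_def interp_weight_def)
  then show ?thesis by (auto simp: trig_coeffs_def dft_def interp_weight_def)
qed

text \<open>Aliasing: the coefficient \<open>r\<close> of the interpolant collects all coefficients whose indices are
  congruent to \<open>r\<close> modulo \<open>2 * n\<close>.\<close>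

definition interp :: "nat \<Rightarrow> (int \<Rightarrow> complex) \<Rightarrow> int \<Rightarrow> complex" where
  "interp n a r = interp_weight n r * (\<Sum>\<^sub>\<infinity>m. if 2 * int n dvd m - r then a m else 0)"

lemma l1_if: "l1 a \<Longrightarrow> (\<lambda>m. norm (if P m then a m else 0)) summable_on UNIV"
  by (erule summable_on_comparison_test) auto

lemma dft_fser:
  assumes n: "n \<ge> 1" and a: "l1 a"
  shows "dft n (fser a) = interp n a"
proof
  fix r
  have "((\<lambda>m. a m * mode m (node n j) * mode (- r) (node n j)) has_sum fser a (node n j) * mode (- r) (node n j)) UNIV" for j
    by (rule has_sum_cmult_left[OF fser_has_sum[OF a]])
  then have "((\<lambda>m. \<Sum>j<2*n. a m * mode m (node n j) * mode (- r) (node n j)) has_sum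
      (\<Sum>j<2*n. fser a (node n j) * mode (- r) (node n j))) UNIV"
    by (intro has_sum_sum) auto
  moreover have "(\<Sum>j<2*n. a m * mode m (node n j) * mode (- r) (node n j))
      = (2 * of_nat n) * (if 2 * int n dvd m - r then a m else 0)" for m
  proof -
    have "(\<Sum>j<2*n. a m * mode m (node n j) * mode (- r) (node n j)) = a m * (\<Sum>j<2*n. mode (m - r) (node n j))"
      using mode_add[of m "- r"] by (simp add: sum_distrib_left mult.assoc)
    then show ?thesis by (simp add: sum_mode_nodes[OF n])
  qed
  ultimately have "((\<lambda>m. (2 * of_nat n) * (if 2 * int n dvd m - r then a m else 0)) has_sum
      (\<Sum>j<2*n. fser a (node n j) * mode (- r) (node n j))) UNIV" by simp
  from infsumI[OF this] have "(\<Sum>j<2*n. fser a (node n j) * mode (- r) (node n j))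
      = (2 * of_nat n) * (\<Sum>\<^sub>\<infinity>m. if 2 * int n dvd m - r then a m else 0)"
    by (simp only: infsum_cmult_right')
  then show "dft n (fser a) r = interp n a r"
    using n by (simp add: dft_def interp_def)
qed

lemma interp_trig_coeffs:
  assumes n: "n \<ge> 1" and c: "c \<in> trig_coeffs n"
  shows "interp n c = c"
proof
  fix r
  have s: "c m = 0" if "\<bar>m\<bar> > int n" for m using c that by (simp add: trig_coeffs_def)
  have dvd0: "m = 0" if "2 * int n dvd m" "\<bar>m\<bar> < 2 * int n" for m
    using that zdvd_imp_le[of "2 * int n" "\<bar>m\<bar>"] by force
  show "interp n c r = c r"
  proof (cases "\<bar>r\<bar> < int n")
    case True
    have "((\<lambda>m. if 2 * int n dvd m - r then c m else 0) has_sum c r) UNIV"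
    proof (rule has_sum_finite_neutralI[of "{r}"])
      fix m assume "m \<in> UNIV - {r}"
      then have "m \<noteq> r" by simp
      show "(if 2 * int n dvd m - r then c m else 0) = 0"
      proof (cases "\<bar>m\<bar> \<le> int n")
        case True
        then have "\<bar>m - r\<bar> < 2 * int n" using \<open>\<bar>r\<bar> < int n\<close> by linarith
        then show ?thesis using dvd0[of "m - r"] \<open>m \<noteq> r\<close> by auto
      qed (simp add: s)
    qed auto
    then show ?thesis using True by (simp add: interp_def interp_weight_def infsumI)
  next
    case False
    show ?thesis
    proof (cases "\<bar>r\<bar> = int n")
      case True
      have "((\<lambda>m. if 2 * int n dvd m - r then c m else 0) has_sum 2 * c r) UNIV"
      proof (rule has_sum_finite_neutralI[of "{int n, - int n}"])
        fix m assume m: "m \<in> UNIV - {int n, - int n}"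
        show "(if 2 * int n dvd m - r then c m else 0) = 0"
        proof (cases "\<bar>m\<bar> \<le> int n")
          case True
          then have "\<bar>m - r\<bar> < 2 * int n" "m \<noteq> r" using \<open>\<bar>r\<bar> = int n\<close> m by auto
          then show ?thesis using dvd0[of "m - r"] by auto
        qed (simp add: s)
      next
        have rn: "r = int n \<or> r = - int n" using True by linarith
        have d: "2 * int n dvd int n - r" "2 * int n dvd - int n - r"
          using rn by auto
        have "c (int n) = c r" "c (- int n) = c r" using rn c by (auto simp: trig_coeffs_def)
        then show "2 * c r = (\<Sum>m\<in>{int n, - int n}. if 2 * int n dvd m - r then c m else 0)"
          using d n by simp
      qed auto
      then show ?thesis using True by (simp add: interp_def interp_weight_def infsumI)
    next
      case f: False
      then show ?thesis using False s[of r] by (simp add: interp_def interp_weight_def)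
    qed
  qed
qed

lemma mode_swap_node: "mode r (real_of_int d * pi / real n) = mode d (real_of_int r * pi / real n)"
  by (simp add: mode_def mult_ac)

text \<open>The two halved extreme terms of the kernel \<open>W\<close> agree and make up one full term, so \<open>W\<close> is a
  sum over a full period of \<open>2 * n\<close> indices and orthogonality at the nodes applies.\<close>

lemma fser_dft_node:
  assumes n: "n \<ge> 1" and i: "i < 2 * n"
  shows "fser (dft n \<phi>) (node n i) = \<phi> (node n i)"
proof -
  define W where "W = (\<lambda>d::int. \<Sum>r\<in>{- int n..int n}. interp_weight n r * mode r (real_of_int d * pi / real n))"
  have W: "W d = (if d = 0 then 2 * of_nat n else 0)" if d: "\<bar>d\<bar> < 2 * int n" for d
  proof -
    let ?s = "real_of_int d * pi / real n"
    have per: "mode (int n) ?s = mode (- int n) ?s"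
    proof -
      have "mode (int n) ?s = mode (- int n) ?s * mode (2 * int n) ?s" by (simp flip: mode_add)
      also have "mode (2 * int n) ?s = 1"
        using cis_multiple_2pi[of "of_int d"] n by (simp add: mode_def mult_ac)
      finally show ?thesis by simp
    qed
    have split: "{- int n..int n} = insert (int n) (insert (- int n) {- int n<..<int n})" using n by auto
    have split': "{- int n..<int n} = insert (- int n) {- int n<..<int n}" using n by auto
    have "W d = (mode (int n) ?s / 2 + mode (- int n) ?s / 2) + (\<Sum>r\<in>{- int n<..<int n}. interp_weight n r * mode r ?s)"
      unfolding W_def split using n by (simp add: interp_weight_def)
    also have "(\<Sum>r\<in>{- int n<..<int n}. interp_weight n r * mode r ?s) = (\<Sum>r\<in>{- int n<..<int n}. mode r ?s)"
      by (rule sum.cong) (auto simp: interp_weight_def)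
    also have "(mode (int n) ?s / 2 + mode (- int n) ?s / 2) + \<dots> = (\<Sum>r\<in>{- int n..<int n}. mode r ?s)"
      unfolding split' per by simp
    also have "\<dots> = (\<Sum>k<2*n. mode (int k - int n) ?s)"
      by (rule sum.reindex_bij_witness[of _ "\<lambda>k. int k - int n" "\<lambda>r. nat (r + int n)"]) auto
    also have "\<dots> = mode (- int n) ?s * (\<Sum>k<2*n. mode (int k) ?s)"
      using mode_add[of _ "- int n"] by (simp add: sum_distrib_left mult.commute)
    also have "(\<Sum>k<2*n. mode (int k) ?s) = (\<Sum>k<2*n. mode d (node n k))"
      by (rule sum.cong) (simp_all add: mode_swap_node[of _ d] node_def)
    also have "\<dots> = (if d = 0 then 2 * of_nat n else 0)"
      unfolding sum_mode_nodes[OF n] using zdvd_imp_le[of "2 * int n" "\<bar>d\<bar>"] d by force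
    finally show ?thesis by simp
  qed
  have "fser (dft n \<phi>) (node n i) = (\<Sum>r\<in>{- int n..int n}. dft n \<phi> r * mode r (node n i))"
    by (rule fser_finite_support) (auto simp: dft_def interp_weight_def)
  also have "\<dots> = (\<Sum>r\<in>{- int n..int n}. \<Sum>j<2*n. \<phi> (node n j) / (2 * of_nat n) *
      (interp_weight n r * mode r (real_of_int (int i - int j) * pi / real n)))"
  proof (rule sum.cong[OF refl])
    fix r
    have "mode r (real_of_int (int i - int j) * pi / real n) = mode r (node n i) * mode (- r) (node n j)" for j
      unfolding mode_diff_arg[symmetric] by (simp add: node_def algebra_simps diff_divide_distrib)
    then show "dft n \<phi> r * mode r (node n i) = (\<Sum>j<2*n. \<phi> (node n j) / (2 * of_nat n) *
      (interp_weight n r * mode r (real_of_int (int i - int j) * pi / real n)))"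
      by (simp add: dft_def sum_distrib_left sum_distrib_right mult_ac)
  qed
  also have "\<dots> = (\<Sum>j<2*n. \<phi> (node n j) / (2 * of_nat n) * W (int i - int j))"
    unfolding W_def sum_distrib_left by (rule sum.swap)
  also have "\<dots> = (\<Sum>j<2*n. if j = i then \<phi> (node n i) else 0)"
  proof (rule sum.cong[OF refl])
    fix j assume "j \<in> {..<2*n}"
    then have "\<bar>int i - int j\<bar> < 2 * int n" using i by auto
    from W[OF this] show "\<phi> (node n j) / (2 * of_nat n) * W (int i - int j) = (if j = i then \<phi> (node n i) else 0)"
      using n by auto
  qed
  also have "\<dots> = \<phi> (node n i)" using i by simp
  finally show ?thesis .
qed

lemma trig_interp_eq:
  assumes n: "n \<ge> 1"
  shows "trig_interp n \<phi> = fser (dft n \<phi>)"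
  unfolding trig_interp_def
proof (rule the_equality)
  show "fser (dft n \<phi>) \<in> trig_space n \<and> (\<forall>j<2*n. fser (dft n \<phi>) (node n j) = \<phi> (node n j))"
    using fser_dft_node[OF n] dft_in_trig_coeffs[OF n] by (auto simp: trig_space_eq[OF n])
  fix v assume v: "v \<in> trig_space n \<and> (\<forall>j<2*n. v (node n j) = \<phi> (node n j))"
  then obtain c where c: "c \<in> trig_coeffs n" "v = fser c" by (auto simp: trig_space_eq[OF n])
  have "l1 c" by (rule l1_finite_support(1)[of n]) (use c(1) in \<open>auto simp: trig_coeffs_def\<close>)
  have "c = interp n c" by (rule interp_trig_coeffs[OF n c(1), symmetric])
  also have "\<dots> = dft n v" unfolding c(2) by (rule dft_fser[OF n \<open>l1 c\<close>, symmetric])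
  also have "\<dots> = dft n \<phi>" using v by (simp add: dft_def fun_eq_iff)
  finally show "v = fser (dft n \<phi>)" using c(2) by simp
qed

lemma trig_interp_fser: "n \<ge> 1 \<Longrightarrow> l1 a \<Longrightarrow> trig_interp n (fser a) = fser (interp n a)"
  by (simp add: trig_interp_eq dft_fser)

lemma interp_support: "\<bar>r\<bar> > int n \<Longrightarrow> interp n a r = 0"
  by (simp add: interp_def interp_weight_def)

lemma interp_in_trig_coeffs: "n \<ge> 1 \<Longrightarrow> l1 a \<Longrightarrow> interp n a \<in> trig_coeffs n"
  using dft_in_trig_coeffs dft_fser by metis

lemma norm_interp_le:
  assumes a: "l1 a" shows "norm (interp n a r) \<le> (\<Sum>\<^sub>\<infinity>m. norm (a m))"
proof -
  have "norm (\<Sum>\<^sub>\<infinity>m. if 2 * int n dvd m - r then a m else 0) \<le> (\<Sum>\<^sub>\<infinity>m. norm (a m))"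
    by (rule norm_infsum_le[OF has_sum_infsum[OF abs_summable_summable[OF l1_if[OF a]]] has_sum_infsum[OF a]]) auto
  moreover have "norm (interp_weight n r) \<le> 1" by (simp add: interp_weight_def norm_divide)
  ultimately have "norm (interp n a r) \<le> 1 * (\<Sum>\<^sub>\<infinity>m. norm (a m))"
    unfolding interp_def norm_mult by (intro mult_mono) auto
  then show ?thesis by simp
qed

lemma l1_interp: "l1 (interp n a)"
  by (rule l1_finite_support(1)[of n]) (rule interp_support)

text \<open>The factor \<open>2 * real n + 1\<close> is crude, but the bound is uniform over all shifts of \<open>a\<close>, which
  is what makes the kernel series converge absolutely for fixed \<open>n\<close>.\<close>

lemma infsum_norm_interp_le:
  assumes a: "l1 a" shows "(\<Sum>\<^sub>\<infinity>r. norm (interp n a r)) \<le> (2 * real n + 1) * (\<Sum>\<^sub>\<infinity>m. norm (a m))"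
proof -
  have "(\<Sum>\<^sub>\<infinity>r. norm (interp n a r)) = (\<Sum>r\<in>{- int n..int n}. norm (interp n a r))"
    by (rule l1_finite_support(2)) (rule interp_support)
  also have "\<dots> \<le> (\<Sum>r\<in>{- int n..int n}. (\<Sum>\<^sub>\<infinity>m. norm (a m)))"
    by (intro sum_mono norm_interp_le a)
  also have "\<dots> = (2 * real n + 1) * (\<Sum>\<^sub>\<infinity>m. norm (a m))" by simp
  finally show ?thesis .
qed

text \<open>Interpolation depends on finitely many point values, so it may be applied term by term to
  the Fourier series of the kernel.\<close>

lemma disc_op_fser:
  assumes n: "n \<ge> 1" and \<rho>: "weight \<rho>" and K: "smooth_biperiodic K" and a: "l1 a"
  shows "l1 (ker_op (interp n) (dcoef K) (multiplier \<rho>) a)"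
    and "disc_op n \<rho> K (fser a) t = fser (ker_op (interp n) (dcoef K) (multiplier \<rho>) a) t"
proof -
  have b: "l1 (interp n (shift l a))"
    "(\<Sum>\<^sub>\<infinity>i. norm (interp n (shift l a) i)) \<le> (2 * real n + 1) * (\<Sum>\<^sub>\<infinity>i. norm (a i))" for l
    using a infsum_norm_interp_le[of "shift l a" n] by (simp_all add: l1_shift infsum_norm_shift l1_interp)
  note W = weighted_kernel_series[where b = "\<lambda>l. interp n (shift l a)", OF \<rho> rapid_summable[OF rapid_dcoef[OF K]] b]
  have op: "ker_op (interp n) (dcoef K) (multiplier \<rho>) a
      = (\<lambda>m. \<Sum>\<^sub>\<infinity>(j, l). dcoef K (j, l) * (multiplier \<rho> (m - j) * interp n (shift l a) (m - j)))"
    by (simp add: ker_op_def fun_eq_iff)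
  show "l1 (ker_op (interp n) (dcoef K) (multiplier \<rho>) a)"
    unfolding op by (rule W(1))
  have Ka: "((\<lambda>x. dcoef K x * mode (fst x) t * fser (shift (snd x) a) \<sigma>) has_sum K t \<sigma> * fser a \<sigma>) UNIV" for \<sigma>
    using has_sum_cmult_left[OF smooth_biperiodic_double_series[OF K, of t \<sigma>], of "fser a \<sigma>"]
    by (simp add: fser_shift case_prod_unfold mult.assoc)
  have d: "((\<lambda>x. dcoef K x * mode (fst x) t * interp n (shift (snd x) a) r) has_sum dft n (\<lambda>\<sigma>. K t \<sigma> * fser a \<sigma>) r) UNIV" for r
  proof -
    have "((\<lambda>x. interp_weight n r / (2 * of_nat n) * (\<Sum>j<2*n. dcoef K x * mode (fst x) t * fser (shift (snd x) a) (node n j) * mode (- r) (node n j)))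
        has_sum dft n (\<lambda>\<sigma>. K t \<sigma> * fser a \<sigma>) r) UNIV"
      unfolding dft_def by (intro has_sum_cmult_right has_sum_sum has_sum_cmult_left Ka) auto
    moreover have "interp_weight n r / (2 * of_nat n) * (\<Sum>j<2*n. dcoef K x * mode (fst x) t * fser (shift (snd x) a) (node n j) * mode (- r) (node n j))
       = dcoef K x * mode (fst x) t * dft n (fser (shift (snd x) a)) r" for x
      by (simp add: dft_def sum_distrib_left mult_ac)
    ultimately show ?thesis
      using a by (simp add: dft_fser[OF n] l1_shift)
  qed
  have "trig_interp n (\<lambda>\<sigma>. K t \<sigma> * fser a \<sigma>) \<tau>
     = (\<Sum>\<^sub>\<infinity>(j, l). dcoef K (j, l) * (mode j t * fser (interp n (shift l a)) \<tau>))" for \<tau>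
  proof -
    have "trig_interp n (\<lambda>\<sigma>. K t \<sigma> * fser a \<sigma>) \<tau> = (\<Sum>r\<in>{- int n..int n}. dft n (\<lambda>\<sigma>. K t \<sigma> * fser a \<sigma>) r * mode r \<tau>)"
      unfolding trig_interp_eq[OF n]
      by (rule fser_finite_support) (auto simp: dft_def interp_weight_def)
    moreover have "((\<lambda>x. \<Sum>r\<in>{- int n..int n}. dcoef K x * mode (fst x) t * interp n (shift (snd x) a) r * mode r \<tau>) has_sum
        (\<Sum>r\<in>{- int n..int n}. dft n (\<lambda>\<sigma>. K t \<sigma> * fser a \<sigma>) r * mode r \<tau>)) UNIV"
      by (intro has_sum_sum has_sum_cmult_left d) auto
    moreover have "(\<Sum>r\<in>{- int n..int n}. dcoef K x * mode (fst x) t * interp n (shift (snd x) a) r * mode r \<tau>)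
        = dcoef K x * (mode (fst x) t * fser (interp n (shift (snd x) a)) \<tau>)" for x
      by (subst fser_finite_support[of n]) (simp_all add: interp_support sum_distrib_left mult.assoc)
    ultimately show ?thesis by (simp add: infsumI case_prod_unfold)
  qed
  then show "disc_op n \<rho> K (fser a) t = fser (ker_op (interp n) (dcoef K) (multiplier \<rho>) a) t"
    unfolding disc_op_def op W(2)[symmetric] by simp
qed

section \<open>Sobolev bounds for coefficient sequences\<close>

definition sobw :: "real \<Rightarrow> int \<Rightarrow> real" where
  "sobw p m = (1 + (of_int m)\<^sup>2) powr p"

text \<open>A bound \<open>X\<close> on the square of the Sobolev norm of order \<open>p\<close>. Using finite partial sums makes
  finiteness of the norm part of the assertion.\<close>

definition sob_le :: "real \<Rightarrow> (int \<Rightarrow> complex) \<Rightarrow> real \<Rightarrow> bool" where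
  "sob_le p a X \<longleftrightarrow> (\<forall>M. finite M \<longrightarrow> (\<Sum>m\<in>M. sobw p m * (norm (a m))\<^sup>2) \<le> X)"

lemma one_plus_square_pos: "0 < 1 + (of_int m :: real)\<^sup>2" and one_plus_square_ge_1: "1 \<le> 1 + (of_int m :: real)\<^sup>2"
  by (auto intro: add_pos_nonneg)

lemma sobw_pos [simp]: "0 < sobw p m"
  using one_plus_square_pos[of m] by (simp add: sobw_def)

lemma sobw_nonneg [simp]: "0 \<le> sobw p m"
  by (rule less_imp_le) simp

lemma sobw_0 [simp]: "sobw 0 m = 1"
  using one_plus_square_pos[of m] by (simp add: sobw_def)

lemma sobw_add: "sobw (p + q) m = sobw p m * sobw q m"
  by (simp add: sobw_def powr_add)

lemma sobw_1: "sobw 1 m = 1 + (of_int m)\<^sup>2"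
  using one_plus_square_pos[of m] by (simp add: sobw_def)

lemma sobw_mono: "p \<le> q \<Longrightarrow> sobw p m \<le> sobw q m"
  unfolding sobw_def by (rule powr_mono) (use one_plus_square_ge_1 in auto)

lemma sobw_ge_1: "p \<ge> 0 \<Longrightarrow> 1 \<le> sobw p m"
  using sobw_mono[of 0 p m] by simp

lemma sob_le_nonneg: "sob_le p a X \<Longrightarrow> 0 \<le> X"
  unfolding sob_le_def by (metis finite.emptyI sum.empty)

lemma sob_le_mono: "sob_le p a X \<Longrightarrow> X \<le> Y \<Longrightarrow> sob_le p a Y"
  unfolding sob_le_def by (meson order_trans)

lemma sob_le_mono_exponent:
  assumes "sob_le q a X" "p \<le> q" shows "sob_le p a X"
  unfolding sob_le_def
proof (intro allI impI)
  fix M :: "int set" assume M: "finite M"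
  have "(\<Sum>m\<in>M. sobw p m * (norm (a m))\<^sup>2) \<le> (\<Sum>m\<in>M. sobw q m * (norm (a m))\<^sup>2)"
    by (intro sum_mono mult_right_mono sobw_mono assms(2)) auto
  also have "\<dots> \<le> X" using assms(1) M by (simp add: sob_le_def)
  finally show "(\<Sum>m\<in>M. sobw p m * (norm (a m))\<^sup>2) \<le> X" .
qed

lemma sob_le_term: "sob_le p a X \<Longrightarrow> sobw p m * (norm (a m))\<^sup>2 \<le> X"
  unfolding sob_le_def by (drule spec[of _ "{m}"]) simp

lemma sob_le_zeroD: "sob_le p a 0 \<Longrightarrow> a m = 0"
  using sob_le_term[of p a 0 m] sobw_pos[of p m] by (auto simp: mult_le_0_iff)

lemma sob_le_summable:
  assumes "sob_le p a X"
  shows "(\<lambda>m. sobw p m * (norm (a m))\<^sup>2) summable_on UNIV"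
    and "(\<Sum>\<^sub>\<infinity>m. sobw p m * (norm (a m))\<^sup>2) \<le> X"
proof -
  show s: "(\<lambda>m. sobw p m * (norm (a m))\<^sup>2) summable_on UNIV"
    by (rule nonneg_bdd_above_summable_on) (use assms in \<open>auto simp: sob_le_def intro!: bdd_aboveI2[of _ _ X]\<close>)
  show "(\<Sum>\<^sub>\<infinity>m. sobw p m * (norm (a m))\<^sup>2) \<le> X"
    by (rule infsum_le_finite_sums[OF s]) (use assms in \<open>auto simp: sob_le_def\<close>)
qed

lemma sob_le_of_summable:
  assumes "(\<lambda>m. sobw p m * (norm (a m))\<^sup>2) summable_on UNIV"
  shows "sob_le p a (\<Sum>\<^sub>\<infinity>m. sobw p m * (norm (a m))\<^sup>2)"
  unfolding sob_le_def by (auto intro!: finite_sum_le_infsum assms)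

lemma sob_le_add:
  assumes "sob_le p a X" "sob_le p b Y"
  shows "sob_le p (\<lambda>m. a m + b m) (2 * X + 2 * Y)"
  unfolding sob_le_def
proof (intro allI impI)
  fix M :: "int set" assume M: "finite M"
  have "(norm (a m + b m))\<^sup>2 \<le> 2 * (norm (a m))\<^sup>2 + 2 * (norm (b m))\<^sup>2" for m
  proof -
    have "(norm (a m + b m))\<^sup>2 \<le> (norm (a m) + norm (b m))\<^sup>2"
      by (intro power_mono norm_triangle_ineq) auto
    also have "\<dots> \<le> 2 * (norm (a m))\<^sup>2 + 2 * (norm (b m))\<^sup>2"
      using zero_le_power2[of "norm (a m) - norm (b m)"] by (simp add: power2_eq_square algebra_simps)
    finally show ?thesis .
  qed
  then have "(\<Sum>m\<in>M. sobw p m * (norm (a m + b m))\<^sup>2)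
      \<le> (\<Sum>m\<in>M. sobw p m * (2 * (norm (a m))\<^sup>2 + 2 * (norm (b m))\<^sup>2))"
    by (intro sum_mono mult_left_mono) auto
  also have "\<dots> = 2 * (\<Sum>m\<in>M. sobw p m * (norm (a m))\<^sup>2) + 2 * (\<Sum>m\<in>M. sobw p m * (norm (b m))\<^sup>2)"
    by (simp add: distrib_left sum.distrib sum_distrib_left mult_ac)
  also have "\<dots> \<le> 2 * X + 2 * Y" using assms M by (intro add_mono mult_left_mono) (auto simp: sob_le_def)
  finally show "(\<Sum>m\<in>M. sobw p m * (norm (a m + b m))\<^sup>2) \<le> 2 * X + 2 * Y" .
qed

lemma sob_le_scale:
  assumes "sob_le p a X" shows "sob_le p (\<lambda>m. c * a m) ((norm c)\<^sup>2 * X)"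
  unfolding sob_le_def
proof (intro allI impI)
  fix M :: "int set" assume M: "finite M"
  have "(\<Sum>m\<in>M. sobw p m * (norm (c * a m))\<^sup>2) = (norm c)\<^sup>2 * (\<Sum>m\<in>M. sobw p m * (norm (a m))\<^sup>2)"
    by (simp add: norm_mult power_mult_distrib sum_distrib_left mult_ac)
  also have "\<dots> \<le> (norm c)\<^sup>2 * X" using assms M by (intro mult_left_mono) (auto simp: sob_le_def)
  finally show "(\<Sum>m\<in>M. sobw p m * (norm (c * a m))\<^sup>2) \<le> (norm c)\<^sup>2 * X" .
qed

lemma sob_le_diff:
  assumes "sob_le p a X" "sob_le p b Y"
  shows "sob_le p (\<lambda>m. a m - b m) (2 * X + 2 * Y)"
  using sob_le_add[OF assms(1) sob_le_scale[OF assms(2), of "- 1"]] by simp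

lemma cauchy_schwarz_infsum:
  fixes c :: "'x \<Rightarrow> complex" and u v :: "'x \<Rightarrow> real"
  assumes nn: "\<And>x. x \<in> A \<Longrightarrow> 0 \<le> u x" "\<And>x. x \<in> A \<Longrightarrow> 0 \<le> v x"
    and c: "\<And>x. x \<in> A \<Longrightarrow> (norm (c x))\<^sup>2 \<le> u x * v x"
    and U: "\<And>F. finite F \<Longrightarrow> F \<subseteq> A \<Longrightarrow> sum u F \<le> U" and V: "\<And>F. finite F \<Longrightarrow> F \<subseteq> A \<Longrightarrow> sum v F \<le> V"
  shows "(\<lambda>x. norm (c x)) summable_on A" and "(\<Sum>\<^sub>\<infinity>x\<in>A. norm (c x))\<^sup>2 \<le> U * V"
    and "(norm (\<Sum>\<^sub>\<infinity>x\<in>A. c x))\<^sup>2 \<le> U * V"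
proof -
  have U0: "U \<ge> 0" and V0: "V \<ge> 0" using U[of "{}"] V[of "{}"] by auto
  have fin: "(\<Sum>x\<in>F. norm (c x)) \<le> sqrt (U * V)" if F: "finite F" "F \<subseteq> A" for F
  proof (rule real_le_rsqrt)
    have "(\<Sum>x\<in>F. norm (c x)) \<le> (\<Sum>x\<in>F. sqrt (u x) * sqrt (v x))"
      using F(2) c by (intro sum_mono) (auto simp flip: real_sqrt_mult intro!: real_le_rsqrt)
    then have "(\<Sum>x\<in>F. norm (c x))\<^sup>2 \<le> (\<Sum>x\<in>F. sqrt (u x) * sqrt (v x))\<^sup>2"
      by (intro power_mono sum_nonneg) auto
    also have "\<dots> \<le> (\<Sum>x\<in>F. (sqrt (u x))\<^sup>2) * (\<Sum>x\<in>F. (sqrt (v x))\<^sup>2)"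
      by (rule Cauchy_Schwarz_ineq_sum)
    also have "\<dots> = sum u F * sum v F"
      using nn F(2) by (intro arg_cong2[where f = "(*)"] sum.cong) auto
    also have "\<dots> \<le> U * V" using nn F U0 by (intro mult_mono U V sum_nonneg) auto
    finally show "(\<Sum>x\<in>F. norm (c x))\<^sup>2 \<le> U * V" .
  qed
  show s: "(\<lambda>x. norm (c x)) summable_on A"
    by (rule nonneg_bdd_above_summable_on) (use fin in \<open>auto intro!: bdd_aboveI2\<close>)
  have le: "(\<Sum>\<^sub>\<infinity>x\<in>A. norm (c x)) \<le> sqrt (U * V)"
    by (rule infsum_le_finite_sums[OF s]) (use fin in auto)
  then have "(\<Sum>\<^sub>\<infinity>x\<in>A. norm (c x))\<^sup>2 \<le> (sqrt (U * V))\<^sup>2"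
    by (intro power_mono infsum_nonneg) auto
  then show l2: "(\<Sum>\<^sub>\<infinity>x\<in>A. norm (c x))\<^sup>2 \<le> U * V" using U0 V0 by simp
  have "norm (\<Sum>\<^sub>\<infinity>x\<in>A. c x) \<le> (\<Sum>\<^sub>\<infinity>x\<in>A. norm (c x))" by (rule norm_infsum_bound[OF s])
  then have "(norm (\<Sum>\<^sub>\<infinity>x\<in>A. c x))\<^sup>2 \<le> (\<Sum>\<^sub>\<infinity>x\<in>A. norm (c x))\<^sup>2" by (intro power_mono) auto
  with l2 show "(norm (\<Sum>\<^sub>\<infinity>x\<in>A. c x))\<^sup>2 \<le> U * V" by simp
qed

definition inv_square_sum :: real where
  "inv_square_sum = (\<Sum>\<^sub>\<infinity>m::int. 1 / (1 + (of_int m)\<^sup>2))"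

lemma sum_inverse_squares_le: "finite F \<Longrightarrow> (\<Sum>m\<in>F. 1 / (1 + (of_int m)\<^sup>2)) \<le> inv_square_sum"
  unfolding inv_square_sum_def by (rule finite_sum_le_infsum[OF summable_on_inverse_squares]) auto

lemma inv_square_sum_nonneg: "0 \<le> inv_square_sum"
  using sum_inverse_squares_le[of "{}"] by simp

text \<open>Cauchy-Schwarz against the summable sequence \<open>1 / (1 + m\<^sup>2)\<close>.\<close>

lemma sob_le_l1:
  assumes a: "sob_le p a X" and p: "p \<ge> 1" shows "l1 a"
proof (rule cauchy_schwarz_infsum(1))
  show "(norm (a m))\<^sup>2 \<le> (1 / (1 + (of_int m)\<^sup>2)) * (sobw 1 m * (norm (a m))\<^sup>2)" for m
    using one_plus_square_pos[of m] by (simp add: sobw_1)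
  show "(\<Sum>m\<in>F. sobw 1 m * (norm (a m))\<^sup>2) \<le> X" if "finite F" for F
    using sob_le_mono_exponent[OF a p] that by (simp add: sob_le_def)
qed (auto intro: sum_inverse_squares_le)

text \<open>Peetre's inequality: the price of a shift by \<open>l\<close> is polynomial in \<open>l\<close>.\<close>

lemma sobw_peetre:
  assumes p: "p \<ge> 0" shows "sobw p m \<le> 2 powr p * sobw p l * sobw p (m - l)"
proof -
  let ?u = "of_int (m - l) :: real" and ?l = "of_int l :: real"
  have "1 + (of_int m)\<^sup>2 = 1 + (?u + ?l)\<^sup>2" by simp
  also have "\<dots> \<le> 2 * (1 + ?l\<^sup>2) * (1 + ?u\<^sup>2)"
  proof -
    have "0 \<le> (?u - ?l)\<^sup>2 + 2 * (?u * ?l)\<^sup>2 + 1" by simp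
    then show ?thesis by (simp add: power2_eq_square algebra_simps)
  qed
  finally have "sobw p m \<le> (2 * (1 + ?l\<^sup>2) * (1 + ?u\<^sup>2)) powr p"
    unfolding sobw_def using p one_plus_square_pos[of m] by (intro powr_mono2) auto
  also have "\<dots> = 2 powr p * sobw p l * sobw p (m - l)"
    unfolding sobw_def by (simp only: powr_mult)
  finally show ?thesis .
qed

lemma sob_le_shift:
  assumes a: "sob_le p a X" and p: "p \<ge> 0"
  shows "sob_le p (shift l a) (2 powr p * sobw p l * X)"
  unfolding sob_le_def
proof (intro allI impI)
  fix M :: "int set" assume M: "finite M"
  have "(\<Sum>m\<in>M. sobw p m * (norm (shift l a m))\<^sup>2)
     \<le> (\<Sum>m\<in>M. (2 powr p * sobw p l * sobw p (m - l)) * (norm (a (m - l)))\<^sup>2)"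
    unfolding shift_def by (intro sum_mono mult_right_mono sobw_peetre p) auto
  also have "\<dots> = 2 powr p * sobw p l * (\<Sum>m\<in>M. sobw p (m - l) * (norm (a (m - l)))\<^sup>2)"
    by (simp add: sum_distrib_left mult.assoc)
  also have "(\<Sum>m\<in>M. sobw p (m - l) * (norm (a (m - l)))\<^sup>2) = (\<Sum>m\<in>(\<lambda>m. m - l) ` M. sobw p m * (norm (a m))\<^sup>2)"
    by (subst sum.reindex) (auto simp: inj_on_def)
  also have "2 powr p * sobw p l * \<dots> \<le> 2 powr p * sobw p l * X"
    using a M by (intro mult_left_mono) (auto simp: sob_le_def)
  finally show "(\<Sum>m\<in>M. sobw p m * (norm (shift l a m))\<^sup>2) \<le> 2 powr p * sobw p l * X" .
qed

lemma sob_le_multiplier: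
  assumes \<mu>: "\<And>m. (1 + (of_int m)\<^sup>2) * (norm (\<mu> m))\<^sup>2 \<le> C" and a: "sob_le p a X" and C: "C \<ge> 0"
  shows "sob_le (p + 1) (\<lambda>m. \<mu> m * a m) (C * X)"
  unfolding sob_le_def
proof (intro allI impI)
  fix M :: "int set" assume M: "finite M"
  have "(\<Sum>m\<in>M. sobw (p + 1) m * (norm (\<mu> m * a m))\<^sup>2)
     = (\<Sum>m\<in>M. ((1 + (of_int m)\<^sup>2) * (norm (\<mu> m))\<^sup>2) * (sobw p m * (norm (a m))\<^sup>2))"
    by (simp only: sobw_add sobw_1 norm_mult power_mult_distrib mult_ac)
  also have "\<dots> \<le> (\<Sum>m\<in>M. C * (sobw p m * (norm (a m))\<^sup>2))"
    by (intro sum_mono mult_right_mono \<mu>) auto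
  also have "\<dots> = C * (\<Sum>m\<in>M. sobw p m * (norm (a m))\<^sup>2)" by (simp add: sum_distrib_left)
  also have "\<dots> \<le> C * X" using a M C by (intro mult_left_mono) (auto simp: sob_le_def)
  finally show "(\<Sum>m\<in>M. sobw (p + 1) m * (norm (\<mu> m * a m))\<^sup>2) \<le> C * X" .
qed

text \<open>Cauchy-Schwarz with respect to the weights \<open>norm (\<kappa> x)\<close>, followed by an exchange of the sums
  over \<open>m\<close> and \<open>x\<close>.\<close>

lemma sob_le_series:
  fixes \<kappa> :: "'x \<Rightarrow> complex" and b :: "'x \<Rightarrow> int \<Rightarrow> complex"
  assumes \<kappa>: "(\<lambda>x. norm (\<kappa> x)) summable_on UNIV" and b: "\<And>x. sob_le p (b x) (N x)"
    and N: "(\<lambda>x. norm (\<kappa> x) * N x) summable_on UNIV"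
  shows "(\<lambda>x. norm (\<kappa> x * b x m)) summable_on UNIV"
    and "sob_le p (\<lambda>m. \<Sum>\<^sub>\<infinity>x. \<kappa> x * b x m) ((\<Sum>\<^sub>\<infinity>x. norm (\<kappa> x)) * (\<Sum>\<^sub>\<infinity>x. norm (\<kappa> x) * N x))"
proof -
  let ?K = "\<Sum>\<^sub>\<infinity>x. norm (\<kappa> x)" and ?N = "\<Sum>\<^sub>\<infinity>x. norm (\<kappa> x) * N x"
  let ?v = "\<lambda>m x. norm (\<kappa> x) * (norm (b x m))\<^sup>2"
  have N0: "N x \<ge> 0" for x using sob_le_nonneg[OF b] .
  have K0: "?K \<ge> 0" by (simp add: infsum_nonneg)
  have vle: "?v m x \<le> norm (\<kappa> x) * N x / sobw p m" for m x
    using mult_left_mono[OF sob_le_term[OF b[of x], of m], of "norm (\<kappa> x)"]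
    by (simp add: pos_le_divide_eq mult_ac)
  have vs: "?v m summable_on UNIV" for m
    by (rule summable_on_comparison_test[OF summable_on_cmult_left[OF N, of "inverse (sobw p m)"]])
       (use vle[of _ m] in \<open>auto simp: divide_inverse\<close>)
  have fK: "sum (\<lambda>x. norm (\<kappa> x)) F \<le> ?K" if "finite F" for F
    by (rule finite_sum_le_infsum[OF \<kappa> that]) auto
  have fv: "sum (?v m) F \<le> infsum (?v m) UNIV" if "finite F" for F m
    by (rule finite_sum_le_infsum[OF vs that]) auto
  have c2: "(norm (\<kappa> x * b x m))\<^sup>2 \<le> norm (\<kappa> x) * ?v m x" for x m
    by (simp add: norm_mult power2_eq_square mult_ac)
  note CS = cauchy_schwarz_infsum[of UNIV "\<lambda>x. norm (\<kappa> x)" "?v m" "\<lambda>x. \<kappa> x * b x m" ?K "infsum (?v m) UNIV" for m, OF _ _ c2 fK fv]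
  show "(\<lambda>x. norm (\<kappa> x * b x m)) summable_on UNIV" by (rule CS(1)) auto
  show "sob_le p (\<lambda>m. \<Sum>\<^sub>\<infinity>x. \<kappa> x * b x m) (?K * ?N)"
    unfolding sob_le_def
  proof (intro allI impI)
    fix M :: "int set" assume M: "finite M"
    have "(\<Sum>m\<in>M. sobw p m * (norm (\<Sum>\<^sub>\<infinity>x. \<kappa> x * b x m))\<^sup>2) \<le> (\<Sum>m\<in>M. sobw p m * (?K * infsum (?v m) UNIV))"
      by (intro sum_mono mult_left_mono CS(3)) auto
    also have "\<dots> = ?K * (\<Sum>m\<in>M. sobw p m * infsum (?v m) UNIV)"
      by (simp add: sum_distrib_left mult_ac)
    also have "\<dots> \<le> ?K * ?N"
    proof (rule mult_left_mono[OF _ K0])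
      have hs: "((\<lambda>x. \<Sum>m\<in>M. sobw p m * ?v m x) has_sum (\<Sum>m\<in>M. sobw p m * infsum (?v m) UNIV)) UNIV"
        using M
      proof (induction M rule: finite_induct)
        case (insert m M)
        then show ?case using has_sum_cmult_right[OF has_sum_infsum[OF vs[of m]], of "sobw p m"]
          by (auto intro!: has_sum_add)
      qed simp
      show "(\<Sum>m\<in>M. sobw p m * infsum (?v m) UNIV) \<le> ?N"
      proof (rule has_sum_mono[OF hs has_sum_infsum[OF N]])
        fix x
        have "(\<Sum>m\<in>M. sobw p m * ?v m x) = norm (\<kappa> x) * (\<Sum>m\<in>M. sobw p m * (norm (b x m))\<^sup>2)"
          by (simp add: sum_distrib_left mult_ac)
        also have "\<dots> \<le> norm (\<kappa> x) * N x" using b[of x] M by (intro mult_left_mono) (auto simp: sob_le_def)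
        finally show "(\<Sum>m\<in>M. sobw p m * ?v m x) \<le> norm (\<kappa> x) * N x" .
      qed
    qed
    finally show "(\<Sum>m\<in>M. sobw p m * (norm (\<Sum>\<^sub>\<infinity>x. \<kappa> x * b x m))\<^sup>2) \<le> ?K * ?N" .
  qed
qed

text \<open>The multiplier gains one order; the shifts cost powers of \<open>j\<close> and \<open>l\<close>, which the decay of
  \<open>\<kappa>\<close> absorbs. The constant is the same for all \<open>Q\<close>, and the exponent \<open>s\<close> in the growth
  allowed in \<open>l\<close> is free: so the lemma covers the identity, and also interpolation errors,
  where the order \<open>s\<close> of the shifted sequence exceeds the order \<open>p\<close> of the bound.\<close>

lemma sob_le_ker_op:
  assumes \<kappa>: "rapid \<kappa>" and \<mu>: "order_one_multiplier \<mu>" and p: "p \<ge> 0" and s: "s \<ge> 0"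
  shows "\<exists>C\<ge>0. \<forall>Q a Y. (\<forall>l. sob_le p (Q (shift l a)) (sobw s l * Y)) \<longrightarrow>
      sob_le (p + 1) (ker_op Q \<kappa> \<mu> a) (C * Y) \<and>
      (\<forall>m. (\<lambda>(j, l). \<kappa> (j, l) * (\<mu> (m - j) * Q (shift l a) (m - j))) summable_on UNIV)"
proof -
  obtain C\<mu> where C\<mu>: "C\<mu> \<ge> 0" "\<And>m. (1 + (of_int m)\<^sup>2) * (norm (\<mu> m))\<^sup>2 \<le> C\<mu>"
    using \<mu> unfolding order_one_multiplier_def by blast
  let ?K = "\<Sum>\<^sub>\<infinity>x. norm (\<kappa> x)"
  let ?W = "\<lambda>x. norm (\<kappa> x) * (sobw (p + 1) (fst x) * sobw s (snd x))"
  have ks: "(\<lambda>x. norm (\<kappa> x)) summable_on UNIV" by (rule rapid_summable[OF \<kappa>])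
  define P where "P = max (p + 1) s"
  have P: "P \<ge> 0" "p + 1 \<le> P" "s \<le> P" using p s by (auto simp: P_def)
  have "(\<lambda>(j, l). norm (\<kappa> (j, l)) * (sobw P j * sobw P l)) summable_on UNIV"
    using \<kappa> P(1) unfolding rapid_def sobw_def by blast
  then have Ws: "?W summable_on UNIV"
  proof (rule summable_on_comparison_test)
    fix x :: "int \<times> int"
    show "?W x \<le> (\<lambda>(j, l). norm (\<kappa> (j, l)) * (sobw P j * sobw P l)) x"
      by (cases x) (auto intro!: mult_left_mono mult_mono sobw_mono P)
  qed auto
  define C where "C = ?K * (2 powr (p + 1) * C\<mu> * infsum ?W UNIV)"
  have C0: "C \<ge> 0" unfolding C_def using C\<mu>(1) by (intro mult_nonneg_nonneg infsum_nonneg) auto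
  have main: "sob_le (p + 1) (ker_op Q \<kappa> \<mu> a) (C * Y) \<and>
      (\<forall>m. (\<lambda>(j, l). \<kappa> (j, l) * (\<mu> (m - j) * Q (shift l a) (m - j))) summable_on UNIV)"
    if Q: "\<And>l. sob_le p (Q (shift l a)) (sobw s l * Y)" for Q a Y
  proof -
    define b where "b = (\<lambda>x. shift (fst x) (\<lambda>i. \<mu> i * Q (shift (snd x) a) i))"
    define N where "N = (\<lambda>x. 2 powr (p + 1) * sobw (p + 1) (fst x) * (C\<mu> * (sobw s (snd x) * Y)))"
    have b: "sob_le (p + 1) (b x) (N x)" for x
      unfolding b_def N_def using p by (intro sob_le_shift sob_le_multiplier[OF C\<mu>(2)] Q C\<mu>(1)) auto
    have Ne: "norm (\<kappa> x) * N x = (2 powr (p + 1) * C\<mu> * Y) * ?W x" for x by (simp add: N_def mult_ac)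
    have Ns: "(\<lambda>x. norm (\<kappa> x) * N x) summable_on UNIV"
      unfolding Ne by (rule summable_on_cmult_right[OF Ws])
    have Ni: "(\<Sum>\<^sub>\<infinity>x. norm (\<kappa> x) * N x) = (2 powr (p + 1) * C\<mu> * Y) * infsum ?W UNIV"
      unfolding Ne by (rule infsum_cmult_right')
    note S = sob_le_series[OF ks b Ns]
    have e: "(\<lambda>x. \<kappa> x * b x m) = (\<lambda>(j, l). \<kappa> (j, l) * (\<mu> (m - j) * Q (shift l a) (m - j)))" for m
      by (auto simp: b_def shift_def fun_eq_iff)
    have "sob_le (p + 1) (ker_op Q \<kappa> \<mu> a) (?K * (\<Sum>\<^sub>\<infinity>x. norm (\<kappa> x) * N x))"
      using S(2) unfolding e ker_op_def[abs_def] .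
    moreover have "?K * (\<Sum>\<^sub>\<infinity>x. norm (\<kappa> x) * N x) = C * Y" unfolding Ni C_def by simp
    moreover have "(\<lambda>(j, l). \<kappa> (j, l) * (\<mu> (m - j) * Q (shift l a) (m - j))) summable_on UNIV" for m
      unfolding e[symmetric] by (rule abs_summable_summable) (rule S(1))
    ultimately show ?thesis by simp
  qed
  show ?thesis by (rule exI[of _ C]) (use C0 main in blast)
qed

section \<open>The interpolation error\<close>

text \<open>All indices congruent to \<open>r\<close> modulo \<open>2 * n\<close>, other than \<open>r\<close> itself, have absolute value at
  least \<open>n\<close>. If \<open>\<bar>r\<bar> = n\<close>, half of \<open>a r\<close> is lost as well; then \<open>r\<close> belongs to the set on the
  right and accounts for it.\<close>

lemma interp_error_coeff:
  assumes n: "n \<ge> 1" and a: "l1 a" and r: "\<bar>r\<bar> \<le> int n"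
  shows "norm (interp n a r - a r) \<le> (\<Sum>\<^sub>\<infinity>m\<in>{m. 2 * int n dvd m - r \<and> \<bar>m\<bar> \<ge> int n}. norm (a m))"
proof -
  let ?A = "{m. 2 * int n dvd m - r \<and> \<bar>m\<bar> \<ge> int n}"
  have sA: "a summable_on S" "(\<lambda>m. norm (a m)) summable_on S" for S
    using summable_on_subset_banach[OF a, of S] by (auto intro: abs_summable_summable)
  have inf: "(\<Sum>\<^sub>\<infinity>m. if 2 * int n dvd m - r then a m else 0) = infsum a {m. 2 * int n dvd m - r}"
    by (rule infsum_cong_neutral) auto
  have bd: "norm (infsum a S) \<le> (\<Sum>\<^sub>\<infinity>m\<in>S. norm (a m))" for S
    by (rule norm_infsum_bound[OF sA(2)])
  show ?thesis
  proof (cases "\<bar>r\<bar> < int n")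
    case True
    have e: "{m. 2 * int n dvd m - r} = insert r ?A"
    proof (intro equalityI subsetI)
      fix m assume m: "m \<in> {m. 2 * int n dvd m - r}"
      show "m \<in> insert r ?A"
      proof (cases "m = r")
        case False
        have "2 * int n \<le> \<bar>m - r\<bar>" using m False zdvd_imp_le[of "2 * int n" "\<bar>m - r\<bar>"] by auto
        then have "int n \<le> \<bar>m\<bar>" using r by linarith
        then show ?thesis using m by auto
      qed simp
    qed auto
    have "infsum a (insert r ?A) = a r + infsum a ?A"
      by (rule infsum_insert) (use True sA in auto)
    then have "interp n a r - a r = infsum a ?A"
      using True unfolding interp_def inf e by (simp add: interp_weight_def)
    then show ?thesis using bd[of ?A] by simp
  next
    case False
    then have rn: "r = int n \<or> r = - int n" using r by linarith
    have e: "{m. 2 * int n dvd m - r} = insert r (?A - {r})"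
    proof (intro equalityI subsetI)
      fix m assume m: "m \<in> {m. 2 * int n dvd m - r}"
      show "m \<in> insert r (?A - {r})"
      proof (cases "m = r")
        case f: False
        have "2 * int n \<le> \<bar>m - r\<bar>" using m f zdvd_imp_le[of "2 * int n" "\<bar>m - r\<bar>"] by auto
        then have "int n \<le> \<bar>m\<bar>" using r by linarith
        then show ?thesis using m by auto
      qed simp
    qed auto
    have rA: "?A = insert r (?A - {r})" using rn by auto
    have 1: "infsum a (insert r (?A - {r})) = a r + infsum a (?A - {r})"
      by (rule infsum_insert) (use sA in auto)
    have 2: "(\<Sum>\<^sub>\<infinity>m\<in>insert r (?A - {r}). norm (a m)) = norm (a r) + (\<Sum>\<^sub>\<infinity>m\<in>?A - {r}. norm (a m))"
      by (rule infsum_insert) (use sA in auto)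
    have w: "interp_weight n r = 1 / 2" using rn by (auto simp: interp_weight_def)
    have "interp n a r - a r = infsum a (?A - {r}) / 2 - a r / 2"
      unfolding interp_def inf e 1 w by (simp add: field_simps)
    also have "norm \<dots> \<le> norm (infsum a (?A - {r})) / 2 + norm (a r) / 2"
      using norm_triangle_ineq4[of "infsum a (?A - {r}) / 2" "a r / 2"] by (simp add: norm_divide)
    also have "\<dots> \<le> (\<Sum>\<^sub>\<infinity>m\<in>?A - {r}. norm (a m)) + norm (a r)"
      using bd[of "?A - {r}"] norm_ge_zero[of "infsum a (?A - {r})"] norm_ge_zero[of "a r"] by linarith
    also have "\<dots> = (\<Sum>\<^sub>\<infinity>m\<in>?A. norm (a m))" by (subst rA, subst 2) simp
    finally show ?thesis .
  qed
qed

lemma square_powr: "((real n)\<^sup>2) powr s = real n powr (2 * s)"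
proof -
  have "(real n)\<^sup>2 = real n powr 2" by simp
  then show ?thesis by (simp only: powr_powr)
qed

text \<open>An alias \<open>m = r + 2 * n * k\<close> with \<open>\<bar>m\<bar> \<ge> n\<close> satisfies \<open>\<bar>m\<bar> \<ge> n * max 1 \<bar>k\<bar>\<close>, which compares
  the sum with that of \<open>1 / (1 + k\<^sup>2)\<close>.\<close>

lemma sum_aliases_le:
  assumes n: "n \<ge> 1" and s: "s \<ge> 1" and r: "\<bar>r\<bar> \<le> int n"
    and F: "finite F" "F \<subseteq> {m. 2 * int n dvd m - r \<and> \<bar>m\<bar> \<ge> int n}"
  shows "(\<Sum>m\<in>F. 1 / sobw s m) \<le> 2 * inv_square_sum * real n powr (- 2 * s)"
proof -
  define k where "k = (\<lambda>m. (m - r) div (2 * int n))"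
  have mk: "m = r + 2 * int n * k m" if "m \<in> F" for m
  proof -
    have "2 * int n dvd m - r" using that F by auto
    then show ?thesis by (simp add: k_def)
  qed
  have "inj_on k F" by (rule inj_onI) (metis mk)
  have np: "real n > 0" using n by simp
  have "1 / sobw s m \<le> 2 * real n powr (- 2 * s) * (1 / (1 + (of_int (k m))\<^sup>2))" if m: "m \<in> F" for m
  proof -
    \<comment> \<open>the maximum keeps the lower bound useful for \<open>k m = 0\<close> and lets \<open>g \<le> g powr s\<close>\<close>
    define g where "g = (max 1 ((of_int (k m))\<^sup>2) :: real)"
    have g1: "g \<ge> 1" by (simp add: g_def)
    have "real n * sqrt g \<le> \<bar>of_int m\<bar>"
    proof (cases "k m = 0")
      case True
      have "int n \<le> \<bar>m\<bar>" using F m by auto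
      then have "real n \<le> \<bar>of_int m\<bar>" by linarith
      then show ?thesis using True by (simp add: g_def)
    next
      case False
      then have "1 \<le> \<bar>k m\<bar>" by linarith
      then have "(1::real) \<le> \<bar>of_int (k m)\<bar>" by linarith
      then have "(1::real) \<le> (of_int (k m))\<^sup>2" using one_le_power[of "\<bar>of_int (k m) :: real\<bar>" 2] by simp
      then have sg: "sqrt g = \<bar>of_int (k m)\<bar>" by (simp add: g_def)
      have "int n * 1 \<le> int n * \<bar>k m\<bar>" by (rule mult_left_mono[OF \<open>1 \<le> \<bar>k m\<bar>\<close>]) simp
      then have "int n * \<bar>k m\<bar> \<le> 2 * (int n * \<bar>k m\<bar>) - int n" by linarith
      also have "\<dots> \<le> \<bar>2 * int n * k m\<bar> - \<bar>r\<bar>" using r by (simp add: abs_mult)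
      also have "\<dots> \<le> \<bar>m\<bar>" using mk[OF m] by linarith
      finally have "int n * \<bar>k m\<bar> \<le> \<bar>m\<bar>" .
      then have "real_of_int (int n * \<bar>k m\<bar>) \<le> real_of_int \<bar>m\<bar>" by (simp only: of_int_le_iff)
      then show ?thesis unfolding sg by simp
    qed
    then have "(real n * sqrt g)\<^sup>2 \<le> \<bar>of_int m\<bar>\<^sup>2" using g1 by (intro power_mono) auto
    then have m2: "(real n)\<^sup>2 * g \<le> (of_int m)\<^sup>2" using g1 by (simp add: power_mult_distrib)
    have "real n powr (2 * s) * g \<le> real n powr (2 * s) * g powr s"
      using powr_mono[OF s g1] g1 by (intro mult_left_mono) auto
    also have "real n powr (2 * s) = ((real n)\<^sup>2) powr s"
      by (rule square_powr[symmetric])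
    also have "((real n)\<^sup>2) powr s * g powr s = ((real n)\<^sup>2 * g) powr s" by (rule powr_mult[symmetric]; use g1 in simp)
    also have "\<dots> \<le> (1 + (of_int m)\<^sup>2) powr s" using m2 s g1 by (intro powr_mono2) auto
    finally have le: "real n powr (2 * s) * g \<le> sobw s m" by (simp only: sobw_def square_powr)
    have "(1 + (of_int (k m))\<^sup>2) / 2 \<le> g" by (simp add: g_def)
    then have "real n powr (2 * s) * ((1 + (of_int (k m))\<^sup>2) / 2) \<le> real n powr (2 * s) * g" by (intro mult_left_mono) auto
    with le have "real n powr (2 * s) * ((1 + (of_int (k m))\<^sup>2) / 2) \<le> sobw s m" by linarith
    moreover have "0 < real n powr (2 * s) * ((1 + (of_int (k m))\<^sup>2) / 2)"
      using np one_plus_square_pos[of "k m"] by simp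
    ultimately have "1 / sobw s m \<le> 1 / (real n powr (2 * s) * ((1 + (of_int (k m))\<^sup>2) / 2))"
      by (intro divide_left_mono) auto
    also have "\<dots> = 2 * real n powr (- 2 * s) * (1 / (1 + (of_int (k m))\<^sup>2))"
      by (simp add: powr_minus field_simps)
    finally show ?thesis .
  qed
  then have "(\<Sum>m\<in>F. 1 / sobw s m) \<le> (\<Sum>m\<in>F. 2 * real n powr (- 2 * s) * (1 / (1 + (of_int (k m))\<^sup>2)))"
    by (rule sum_mono)
  also have "\<dots> = 2 * real n powr (- 2 * s) * (\<Sum>m\<in>k ` F. 1 / (1 + (of_int m)\<^sup>2))"
    by (simp add: sum.reindex[OF \<open>inj_on k F\<close>] sum_distrib_left o_def)
  also have "\<dots> \<le> 2 * real n powr (- 2 * s) * inv_square_sum"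
    using F(1) by (intro mult_left_mono sum_inverse_squares_le) auto
  finally show ?thesis by (simp add: mult_ac)
qed

lemma card_aliases_le:
  assumes n: "n \<ge> 1"
  shows "card {r. \<bar>r\<bar> \<le> int n \<and> 2 * int n dvd m - r} \<le> 2"
proof -
  \<comment> \<open>the representative of \<open>m\<close> modulo \<open>2 * n\<close> in the interval from \<open>- n\<close> to \<open>n - 1\<close>\<close>
  define r0 where "r0 = (m + int n) mod (2 * int n) - int n"
  have "0 \<le> (m + int n) mod (2 * int n)" "(m + int n) mod (2 * int n) < 2 * int n" using n by simp_all
  then have r0: "- int n \<le> r0" "r0 < int n" by (auto simp: r0_def)
  have "{r. \<bar>r\<bar> \<le> int n \<and> 2 * int n dvd m - r} \<subseteq> {r0, r0 + 2 * int n}"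
  proof
    fix r assume r: "r \<in> {r. \<bar>r\<bar> \<le> int n \<and> 2 * int n dvd m - r}"
    have "2 * int n dvd m - r0"
    proof -
      have "m - r0 = 2 * int n * ((m + int n) div (2 * int n))"
        unfolding r0_def using mult_div_mod_eq[of "2 * int n" "m + int n"] by linarith
      then show ?thesis by simp
    qed
    moreover have "2 * int n dvd m - r" using r by simp
    ultimately have "2 * int n dvd (m - r0) - (m - r)" by (rule dvd_diff)
    then obtain k where k: "r - r0 = 2 * int n * k" by auto
    have "\<bar>r\<bar> \<le> int n" using r by simp
    then have "2 * int n * (- 1) < 2 * int n * k" "2 * int n * k \<le> 2 * int n * 1" using k r0 by linarith+
    moreover have "0 < 2 * int n" using n by simp
    ultimately have "- 1 < k" "k \<le> 1"
      unfolding mult_less_cancel_left_pos[OF \<open>0 < 2 * int n\<close>] mult_le_cancel_left_pos[OF \<open>0 < 2 * int n\<close>] by blast+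
    then have "k = 0 \<or> k = 1" by linarith
    then show "r \<in> {r0, r0 + 2 * int n}" using k by auto
  qed
  then have "card {r. \<bar>r\<bar> \<le> int n \<and> 2 * int n dvd m - r} \<le> card {r0, r0 + 2 * int n}"
    by (intro card_mono) auto
  also have "\<dots> \<le> 2" by (simp add: card_insert_if)
  finally show ?thesis .
qed

text \<open>For \<open>\<bar>r\<bar> \<le> n\<close> the error consists of aliases and is bounded by Cauchy-Schwarz; since every
  index is an alias of at most two such \<open>r\<close>, summing over \<open>r\<close> counts each coefficient at most
  twice. For \<open>\<bar>r\<bar> > n\<close> the interpolant vanishes and the error is a tail of \<open>a\<close>. The exponents
  are doubled because \<open>sob_le\<close> bounds squared norms.\<close>

lemma sob_le_interp_error:
  assumes s: "s \<ge> 1" and p: "0 \<le> p" "p \<le> s"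
  shows "\<exists>C\<ge>0. \<forall>n\<ge>1. \<forall>a X. sob_le s a X \<longrightarrow>
      sob_le p (\<lambda>m. interp n a m - a m) (C * real n powr (- 2 * (s - p)) * X)"
proof -
  define C where "C = 4 * 2 powr p * inv_square_sum + 1"
  have C: "C \<ge> 0" using inv_square_sum_nonneg by (simp add: C_def)
  have "sob_le p (\<lambda>m. interp n a m - a m) (C * real n powr (- 2 * (s - p)) * X)"
    if n: "n \<ge> 1" and a: "sob_le s a X" for n a X
    unfolding sob_le_def
  proof (intro allI impI)
    fix M :: "int set" assume M: "finite M"
    have al: "l1 a" by (rule sob_le_l1[OF a s])
    have X0: "X \<ge> 0" by (rule sob_le_nonneg[OF a])
    have np: "real n \<ge> 1" using n by simp
    let ?d = "\<lambda>r. interp n a r - a r" and ?g = "\<lambda>m. sobw s m * (norm (a m))\<^sup>2"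
    let ?A = "\<lambda>r. {m. 2 * int n dvd m - r \<and> \<bar>m\<bar> \<ge> int n}"
    define V where "V = (\<lambda>r. infsum (\<lambda>m. if m \<in> ?A r then ?g m else 0) UNIV)"
    have gs: "?g summable_on UNIV" "infsum ?g UNIV \<le> X" using sob_le_summable[OF a] by auto
    have Vs: "(\<lambda>m. if m \<in> ?A r then ?g m else 0) summable_on UNIV" for r
      by (rule summable_on_comparison_test[OF gs(1)]) auto
    have np2: "real n powr (- 2 * s) * real n powr (2 * p) = real n powr (- 2 * (s - p))"
      by (simp add: algebra_simps flip: powr_add)
    have low: "sobw p r * (norm (?d r))\<^sup>2 \<le> 2 powr p * (2 * inv_square_sum) * real n powr (- 2 * (s - p)) * V r"
      if r: "\<bar>r\<bar> \<le> int n" for r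
    proof -
      have "(norm (?d r))\<^sup>2 \<le> (\<Sum>\<^sub>\<infinity>m\<in>?A r. norm (a m))\<^sup>2"
        by (intro power_mono interp_error_coeff n al r) auto
      also have "\<dots> \<le> (2 * inv_square_sum * real n powr (- 2 * s)) * V r"
      proof (rule cauchy_schwarz_infsum(2))
        show "(\<Sum>m\<in>F. 1 / sobw s m) \<le> 2 * inv_square_sum * real n powr (- 2 * s)" if "finite F" "F \<subseteq> ?A r" for F
          by (rule sum_aliases_le[OF n s r that])
        show "sum ?g F \<le> V r" if "finite F" "F \<subseteq> ?A r" for F
        proof -
          have "sum ?g F = (\<Sum>m\<in>F. if m \<in> ?A r then ?g m else 0)" using that(2) by (intro sum.cong) auto
          also have "\<dots> \<le> V r" unfolding V_def by (rule finite_sum_le_infsum[OF Vs that(1)]) auto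
          finally show ?thesis .
        qed
        show "(norm (a m))\<^sup>2 \<le> 1 / sobw s m * ?g m" for m
          using less_imp_neq[OF sobw_pos[of s m]] by simp
      qed auto
      finally have "sobw p r * (norm (?d r))\<^sup>2 \<le> sobw p r * ((2 * inv_square_sum * real n powr (- 2 * s)) * V r)"
        by (rule mult_left_mono) simp
      also have "\<dots> \<le> (2 powr p * real n powr (2 * p)) * ((2 * inv_square_sum * real n powr (- 2 * s)) * V r)"
      proof (rule mult_right_mono)
        have "(of_int r)\<^sup>2 \<le> (real n)\<^sup>2" using r by (intro abs_le_square_iff[THEN iffD1]) auto
        moreover have "1 \<le> (real n)\<^sup>2" using np one_le_power by blast
        ultimately have "1 + (of_int r)\<^sup>2 \<le> 2 * (real n)\<^sup>2" by linarith
        then have "sobw p r \<le> (2 * (real n)\<^sup>2) powr p"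
          unfolding sobw_def using p(1) one_plus_square_pos[of r] by (intro powr_mono2) auto
        also have "\<dots> = 2 powr p * real n powr (2 * p)" by (simp only: powr_mult square_powr)
        finally show "sobw p r \<le> 2 powr p * real n powr (2 * p)" .
        show "0 \<le> 2 * inv_square_sum * real n powr (- 2 * s) * V r"
          unfolding V_def using inv_square_sum_nonneg by (intro mult_nonneg_nonneg infsum_nonneg) auto
      qed
      also have "\<dots> = 2 powr p * (2 * inv_square_sum) * (real n powr (- 2 * s) * real n powr (2 * p)) * V r" by (simp only: mult_ac)
      finally show ?thesis unfolding np2 .
    qed
    define M1 where "M1 = {r\<in>M. \<bar>r\<bar> \<le> int n}"
    define M2 where "M2 = {r\<in>M. \<not> \<bar>r\<bar> \<le> int n}"
    have fin: "finite M1" "finite M2" using M by (auto simp: M1_def M2_def)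
    have VX: "(\<Sum>r\<in>M1. V r) \<le> 2 * X"
    proof -
      have hs: "((\<lambda>m. \<Sum>r\<in>M1. if m \<in> ?A r then ?g m else 0) has_sum (\<Sum>r\<in>M1. V r)) UNIV"
        using fin(1)
      proof (induction M1 rule: finite_induct)
        case (insert r M1)
        then show ?case using has_sum_infsum[OF Vs[of r]] by (auto intro!: has_sum_add simp: V_def)
      qed simp
      have "(\<Sum>r\<in>M1. V r) \<le> 2 * infsum ?g UNIV"
      proof (rule has_sum_mono[OF hs has_sum_cmult_right[OF has_sum_infsum[OF gs(1)]]])
        fix m
        have "(\<Sum>r\<in>M1. if m \<in> ?A r then ?g m else 0) = (\<Sum>r\<in>{r\<in>M1. m \<in> ?A r}. ?g m)"
          by (rule sum.inter_filter[symmetric, OF fin(1)])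
        also have "\<dots> = real (card {r\<in>M1. m \<in> ?A r}) * ?g m" by simp
        also have "\<dots> \<le> 2 * ?g m"
        proof (rule mult_right_mono)
          have "finite {r. \<bar>r\<bar> \<le> int n \<and> 2 * int n dvd m - r}"
            by (rule finite_subset[of _ "{- int n..int n}"]) auto
          then have "card {r\<in>M1. m \<in> ?A r} \<le> card {r. \<bar>r\<bar> \<le> int n \<and> 2 * int n dvd m - r}"
            by (intro card_mono) (auto simp: M1_def)
          with card_aliases_le[OF n, of m] show "real (card {r\<in>M1. m \<in> ?A r}) \<le> 2" by linarith
        qed simp
        finally show "(\<Sum>r\<in>M1. if m \<in> ?A r then ?g m else 0) \<le> 2 * ?g m" .
      qed
      with gs(2) show ?thesis by linarith
    qed
    have S1: "(\<Sum>r\<in>M1. sobw p r * (norm (?d r))\<^sup>2) \<le> 4 * 2 powr p * inv_square_sum * real n powr (- 2 * (s - p)) * X"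
    proof -
      have "(\<Sum>r\<in>M1. sobw p r * (norm (?d r))\<^sup>2) \<le> (\<Sum>r\<in>M1. 2 powr p * (2 * inv_square_sum) * real n powr (- 2 * (s - p)) * V r)"
        by (intro sum_mono low) (auto simp: M1_def)
      also have "\<dots> = 2 powr p * (2 * inv_square_sum) * real n powr (- 2 * (s - p)) * (\<Sum>r\<in>M1. V r)"
        by (simp add: sum_distrib_left)
      also have "\<dots> \<le> 2 powr p * (2 * inv_square_sum) * real n powr (- 2 * (s - p)) * (2 * X)"
        using inv_square_sum_nonneg by (intro mult_left_mono VX) auto
      finally show ?thesis by simp
    qed
    have S2: "(\<Sum>r\<in>M2. sobw p r * (norm (?d r))\<^sup>2) \<le> real n powr (- 2 * (s - p)) * X"
    proof -
      have "(\<Sum>r\<in>M2. sobw p r * (norm (?d r))\<^sup>2) \<le> (\<Sum>r\<in>M2. real n powr (- 2 * (s - p)) * ?g r)"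
      proof (rule sum_mono)
        fix r assume "r \<in> M2"
        then have r: "\<bar>r\<bar> > int n" by (auto simp: M2_def)
        have "(real n)\<^sup>2 \<le> (of_int r)\<^sup>2" using r by (intro abs_le_square_iff[THEN iffD1]) auto
        then have "(real n)\<^sup>2 \<le> 1 + (of_int r)\<^sup>2" by linarith
        then have "(1 + (of_int r)\<^sup>2) powr (p - s) \<le> ((real n)\<^sup>2) powr (p - s)"
          using np p(2) by (intro powr_mono2') auto
        also have "\<dots> = real n powr (- 2 * (s - p))"
          by (simp only: square_powr) (simp add: algebra_simps)
        finally have "sobw (p - s) r \<le> real n powr (- 2 * (s - p))" by (simp add: sobw_def)
        then have "sobw (p - s) r * ?g r \<le> real n powr (- 2 * (s - p)) * ?g r" by (rule mult_right_mono) simp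
        moreover have "sobw (p - s) r * ?g r = sobw p r * (norm (a r))\<^sup>2"
          using sobw_add[of "p - s" s r] by simp
        ultimately show "sobw p r * (norm (?d r))\<^sup>2 \<le> real n powr (- 2 * (s - p)) * ?g r"
          using r by (simp add: interp_support)
      qed
      also have "\<dots> = real n powr (- 2 * (s - p)) * (\<Sum>r\<in>M2. ?g r)" by (simp add: sum_distrib_left)
      also have "\<dots> \<le> real n powr (- 2 * (s - p)) * X"
        using a fin(2) by (intro mult_left_mono) (auto simp: sob_le_def)
      finally show ?thesis .
    qed
    have "(\<Sum>r\<in>M. sobw p r * (norm (?d r))\<^sup>2) = (\<Sum>r\<in>M1. sobw p r * (norm (?d r))\<^sup>2) + (\<Sum>r\<in>M2. sobw p r * (norm (?d r))\<^sup>2)"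
    proof -
      have "M = M1 \<union> M2" "M1 \<inter> M2 = {}" by (auto simp: M1_def M2_def)
      then show ?thesis using fin by (simp add: sum.union_disjoint)
    qed
    also have "\<dots> \<le> C * real n powr (- 2 * (s - p)) * X"
      using S1 S2 by (simp add: C_def algebra_simps)
    finally show "(\<Sum>r\<in>M. sobw p r * (norm (?d r))\<^sup>2) \<le> C * real n powr (- 2 * (s - p)) * X" .
  qed
  with C show ?thesis by blast
qed

section \<open>Smoothing operators and their approximations\<close>

text \<open>The common domain of the operators on sequences; its elements are coefficients of continuous
  functions.\<close>

definition h1 :: "(int \<Rightarrow> complex) \<Rightarrow> bool" where
  "h1 a \<longleftrightarrow> (\<exists>X. sob_le 1 a X)"

lemma h1I: "sob_le p a X \<Longrightarrow> p \<ge> 1 \<Longrightarrow> h1 a"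
  unfolding h1_def using sob_le_mono_exponent by blast

lemma h1_l1: "h1 a \<Longrightarrow> l1 a"
  unfolding h1_def using sob_le_l1 by blast

lemma h1_add: "h1 a \<Longrightarrow> h1 b \<Longrightarrow> h1 (\<lambda>m. a m + b m)"
  unfolding h1_def using sob_le_add by blast

lemma h1_scale: "h1 a \<Longrightarrow> h1 (\<lambda>m. c * a m)"
  unfolding h1_def using sob_le_scale by blast

lemma h1_diff: "h1 a \<Longrightarrow> h1 b \<Longrightarrow> h1 (\<lambda>m. a m - b m)"
  unfolding h1_def using sob_le_diff by blast

definition linear_seq :: "((int \<Rightarrow> complex) \<Rightarrow> int \<Rightarrow> complex) \<Rightarrow> bool" where
  "linear_seq T \<longleftrightarrow> (\<forall>a. h1 a \<longrightarrow> h1 (T a)) \<and>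
     (\<forall>a b c d. h1 a \<longrightarrow> h1 b \<longrightarrow> T (\<lambda>m. c * a m + d * b m) = (\<lambda>m. c * T a m + d * T b m))"

definition bounded_seq :: "((int \<Rightarrow> complex) \<Rightarrow> int \<Rightarrow> complex) \<Rightarrow> bool" where
  "bounded_seq T \<longleftrightarrow> (\<forall>p\<ge>1. \<exists>C\<ge>0. \<forall>a X. sob_le p a X \<longrightarrow> sob_le p (T a) (C * X))"

definition smoothing_seq :: "((int \<Rightarrow> complex) \<Rightarrow> int \<Rightarrow> complex) \<Rightarrow> bool" where
  "smoothing_seq T \<longleftrightarrow> (\<forall>p\<ge>1. \<exists>C\<ge>0. \<forall>a X. sob_le p a X \<longrightarrow> sob_le (p + 1) (T a) (C * X))"

text \<open>In terms of norms the rate is \<open>n\<close> to the power \<open>- (q + 1)\<close>; the factor \<open>2\<close> appears because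
  \<open>sob_le\<close> bounds squared norms. The case \<open>q = 0\<close> is convergence in operator norm.\<close>

definition approx_seq :: "((int \<Rightarrow> complex) \<Rightarrow> int \<Rightarrow> complex) \<Rightarrow> (nat \<Rightarrow> (int \<Rightarrow> complex) \<Rightarrow> int \<Rightarrow> complex) \<Rightarrow> bool" where
  "approx_seq T Tn \<longleftrightarrow> linear_seq T \<and> bounded_seq T \<and> (\<forall>n\<ge>1. linear_seq (Tn n)) \<and>
     (\<forall>p\<ge>1. \<forall>q\<ge>0. \<exists>C\<ge>0. \<forall>n\<ge>1. \<forall>a X. sob_le (p + q) a X \<longrightarrow>
        sob_le p (\<lambda>m. Tn n a m - T a m) (C * real n powr (- 2 * (q + 1)) * X))"

lemma linear_seqD:
  assumes "linear_seq T" "h1 a" "h1 b"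
  shows "T (\<lambda>m. c * a m + d * b m) = (\<lambda>m. c * T a m + d * T b m)" "h1 (T a)"
    "T (\<lambda>m. a m - b m) = (\<lambda>m. T a m - T b m)" "T (\<lambda>m. a m + b m) = (\<lambda>m. T a m + T b m)"
    "T (\<lambda>m. c * a m) = (\<lambda>m. c * T a m)"
proof -
  have L: "T (\<lambda>m. c * a m + d * b m) = (\<lambda>m. c * T a m + d * T b m)" for c d
    using assms unfolding linear_seq_def by blast
  show "T (\<lambda>m. c * a m + d * b m) = (\<lambda>m. c * T a m + d * T b m)" by (rule L)
  show "h1 (T a)" using assms unfolding linear_seq_def by blast
  show "T (\<lambda>m. a m - b m) = (\<lambda>m. T a m - T b m)" using L[of 1 "- 1"] by simp
  show "T (\<lambda>m. a m + b m) = (\<lambda>m. T a m + T b m)" using L[of 1 1] by simp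
  show "T (\<lambda>m. c * a m) = (\<lambda>m. c * T a m)" using L[of c 0] by simp
qed

lemma linear_seq_id: "linear_seq (\<lambda>a. a)"
  by (simp add: linear_seq_def)

lemma linear_seq_combine:
  assumes "linear_seq T" "linear_seq S"
  shows "linear_seq (\<lambda>a m. c * T a m + d * S a m)"
  using assms unfolding linear_seq_def
  by (auto intro!: h1_add h1_scale simp: algebra_simps)

lemma linear_seq_compose:
  assumes "linear_seq T" "linear_seq S" shows "linear_seq (\<lambda>a. T (S a))"
  using assms unfolding linear_seq_def by auto

lemma smoothing_imp_bounded: "smoothing_seq T \<Longrightarrow> bounded_seq T"
  unfolding smoothing_seq_def bounded_seq_def
proof (intro allI impI)
  fix p :: real assume "p \<ge> 1" and "\<forall>p\<ge>1. \<exists>C\<ge>0. \<forall>a X. sob_le p a X \<longrightarrow> sob_le (p + 1) (T a) (C * X)"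
  then obtain C where C: "C \<ge> 0" "\<And>a X. sob_le p a X \<Longrightarrow> sob_le (p + 1) (T a) (C * X)" by blast
  have "sob_le p (T a) (C * X)" if "sob_le p a X" for a X
    by (rule sob_le_mono_exponent[OF C(2)[OF that]]) simp
  with C(1) show "\<exists>C\<ge>0. \<forall>a X. sob_le p a X \<longrightarrow> sob_le p (T a) (C * X)" by blast
qed

lemma sob_le_combine:
  assumes "sob_le p a (A * X)" "sob_le p b (B * X)"
  shows "sob_le p (\<lambda>m. c * a m + d * b m) ((2 * (norm c)\<^sup>2 * A + 2 * (norm d)\<^sup>2 * B) * X)"
  by (rule sob_le_mono[OF sob_le_add[OF sob_le_scale[OF assms(1)] sob_le_scale[OF assms(2)]]])
     (simp add: algebra_simps)

lemma bounded_seq_combine: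
  assumes "bounded_seq T" "bounded_seq S" shows "bounded_seq (\<lambda>a m. c * T a m + d * S a m)"
  unfolding bounded_seq_def
proof (intro allI impI)
  fix p :: real assume p: "p \<ge> 1"
  obtain A where A: "A \<ge> 0" "\<And>a X. sob_le p a X \<Longrightarrow> sob_le p (T a) (A * X)"
    using assms(1) p unfolding bounded_seq_def by blast
  obtain B where B: "B \<ge> 0" "\<And>a X. sob_le p a X \<Longrightarrow> sob_le p (S a) (B * X)"
    using assms(2) p unfolding bounded_seq_def by blast
  show "\<exists>C\<ge>0. \<forall>a X. sob_le p a X \<longrightarrow> sob_le p (\<lambda>m. c * T a m + d * S a m) (C * X)"
    by (rule exI[of _ "2 * (norm c)\<^sup>2 * A + 2 * (norm d)\<^sup>2 * B"])
       (use A B sob_le_combine in auto)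
qed

lemma smoothing_seq_combine:
  assumes "smoothing_seq T" "smoothing_seq S" shows "smoothing_seq (\<lambda>a m. c * T a m + d * S a m)"
  unfolding smoothing_seq_def
proof (intro allI impI)
  fix p :: real assume p: "p \<ge> 1"
  obtain A where A: "A \<ge> 0" "\<And>a X. sob_le p a X \<Longrightarrow> sob_le (p + 1) (T a) (A * X)"
    using assms(1) p unfolding smoothing_seq_def by blast
  obtain B where B: "B \<ge> 0" "\<And>a X. sob_le p a X \<Longrightarrow> sob_le (p + 1) (S a) (B * X)"
    using assms(2) p unfolding smoothing_seq_def by blast
  show "\<exists>C\<ge>0. \<forall>a X. sob_le p a X \<longrightarrow> sob_le (p + 1) (\<lambda>m. c * T a m + d * S a m) (C * X)"
    by (rule exI[of _ "2 * (norm c)\<^sup>2 * A + 2 * (norm d)\<^sup>2 * B"])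
       (use A B sob_le_combine in auto)
qed

lemma smoothing_seq_compose:
  assumes "smoothing_seq T" "bounded_seq S" shows "smoothing_seq (\<lambda>a. T (S a))"
  unfolding smoothing_seq_def
proof (intro allI impI)
  fix p :: real assume p: "p \<ge> 1"
  obtain A where A: "A \<ge> 0" "\<And>a X. sob_le p a X \<Longrightarrow> sob_le (p + 1) (T a) (A * X)"
    using assms(1) p unfolding smoothing_seq_def by blast
  obtain B where B: "B \<ge> 0" "\<And>a X. sob_le p a X \<Longrightarrow> sob_le p (S a) (B * X)"
    using assms(2) p unfolding bounded_seq_def by blast
  show "\<exists>C\<ge>0. \<forall>a X. sob_le p a X \<longrightarrow> sob_le (p + 1) (T (S a)) (C * X)"
    by (rule exI[of _ "A * B"]) (use A B in \<open>auto simp: mult.assoc\<close>)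
qed

lemma bounded_seq_compose:
  assumes "bounded_seq T" "bounded_seq S" shows "bounded_seq (\<lambda>a. T (S a))"
  unfolding bounded_seq_def
proof (intro allI impI)
  fix p :: real assume p: "p \<ge> 1"
  obtain A where A: "A \<ge> 0" "\<And>a X. sob_le p a X \<Longrightarrow> sob_le p (T a) (A * X)"
    using assms(1) p unfolding bounded_seq_def by blast
  obtain B where B: "B \<ge> 0" "\<And>a X. sob_le p a X \<Longrightarrow> sob_le p (S a) (B * X)"
    using assms(2) p unfolding bounded_seq_def by blast
  show "\<exists>C\<ge>0. \<forall>a X. sob_le p a X \<longrightarrow> sob_le p (T (S a)) (C * X)"
    by (rule exI[of _ "A * B"]) (use A B in \<open>auto simp: mult.assoc\<close>)
qed

lemma approx_seqD:
  assumes "approx_seq T Tn" "p \<ge> 1" "q \<ge> 0"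
  shows "\<exists>C\<ge>0. \<forall>n\<ge>1. \<forall>a X. sob_le (p + q) a X \<longrightarrow>
        sob_le p (\<lambda>m. Tn n a m - T a m) (C * real n powr (- 2 * (q + 1)) * X)"
proof -
  from assms(1) have H: "\<forall>p\<ge>1. \<forall>q\<ge>0. \<exists>C\<ge>0. \<forall>n\<ge>1. \<forall>a X. sob_le (p + q) a X \<longrightarrow>
        sob_le p (\<lambda>m. Tn n a m - T a m) (C * real n powr (- 2 * (q + 1)) * X)"
    unfolding approx_seq_def by (elim conjE)
  from H[rule_format, OF assms(2,3)] show ?thesis .
qed

lemma approx_seq_uniform_bound:
  assumes T: "approx_seq T Tn" and p: "p \<ge> 1"
  shows "\<exists>C\<ge>0. \<forall>n\<ge>1. \<forall>a X. sob_le p a X \<longrightarrow> sob_le p (Tn n a) (C * X)"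
proof -
  obtain A where A: "A \<ge> 0" "\<And>n a X. n \<ge> 1 \<Longrightarrow> sob_le (p + 0) a X \<Longrightarrow>
        sob_le p (\<lambda>m. Tn n a m - T a m) (A * real n powr (- 2 * (0 + 1)) * X)"
    using approx_seqD[OF T p order_refl] by blast
  obtain B where B: "B \<ge> 0" "\<And>a X. sob_le p a X \<Longrightarrow> sob_le p (T a) (B * X)"
    using T p unfolding approx_seq_def bounded_seq_def by blast
  show ?thesis
  proof (intro exI[of _ "2 * A + 2 * B"] conjI allI impI)
    show "2 * A + 2 * B \<ge> 0" using A(1) B(1) by simp
    fix n :: nat and a X assume n: "n \<ge> 1" and a: "sob_le p a X"
    have "real n powr (- 2 * (0 + 1)) \<le> real n powr 0" using n by (intro powr_mono) auto
    then have le: "real n powr (- 2 * (0 + 1)) \<le> 1" using n by simp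
    have "A * real n powr (- 2 * (0 + 1)) * X \<le> A * 1 * X"
      by (intro mult_right_mono mult_left_mono le A(1) sob_le_nonneg[OF a])
    then have le2: "A * real n powr (- 2 * (0 + 1)) * X \<le> A * X" by simp
    have "sob_le (p + 0) a X" using a by simp
    from sob_le_mono[OF A(2)[OF n this] le2] have "sob_le p (\<lambda>m. Tn n a m - T a m) (A * X)" .
    from sob_le_add[OF this B(2)[OF a]] show "sob_le p (Tn n a) ((2 * A + 2 * B) * X)"
      by (simp add: algebra_simps)
  qed
qed

lemma approx_seq_id: "approx_seq (\<lambda>a. a) (\<lambda>n a. a)"
  unfolding approx_seq_def bounded_seq_def
proof (intro conjI allI impI linear_seq_id)
  fix p q :: real
  show "\<exists>C\<ge>0. \<forall>a X. sob_le p a X \<longrightarrow> sob_le p a (C * X)" by (rule exI[of _ 1]) simp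
  show "\<exists>C\<ge>0. \<forall>n\<ge>1. \<forall>a X. sob_le (p + q) a X \<longrightarrow> sob_le p (\<lambda>m. a m - a m) (C * real n powr (- 2 * (q + 1)) * X)"
    by (rule exI[of _ 0]) (simp add: sob_le_def)
qed

lemma approx_seq_combine:
  assumes T: "approx_seq T Tn" and S: "approx_seq S Sn"
  shows "approx_seq (\<lambda>a m. c * T a m + d * S a m) (\<lambda>n a m. c * Tn n a m + d * Sn n a m)"
  unfolding approx_seq_def
proof (intro conjI allI impI)
  show "linear_seq (\<lambda>a m. c * T a m + d * S a m)" "bounded_seq (\<lambda>a m. c * T a m + d * S a m)"
    using T S by (auto simp: approx_seq_def intro: linear_seq_combine bounded_seq_combine)
  show "linear_seq (\<lambda>a m. c * Tn n a m + d * Sn n a m)" if "n \<ge> 1" for n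
    using T S that by (auto simp: approx_seq_def intro: linear_seq_combine)
  fix p q :: real assume p: "p \<ge> 1" "q \<ge> 0"
  obtain A where A: "A \<ge> 0" "\<And>n a X. n \<ge> 1 \<Longrightarrow> sob_le (p + q) a X \<Longrightarrow>
        sob_le p (\<lambda>m. Tn n a m - T a m) (A * real n powr (- 2 * (q + 1)) * X)" using approx_seqD[OF T p] by blast
  obtain B where B: "B \<ge> 0" "\<And>n a X. n \<ge> 1 \<Longrightarrow> sob_le (p + q) a X \<Longrightarrow>
        sob_le p (\<lambda>m. Sn n a m - S a m) (B * real n powr (- 2 * (q + 1)) * X)" using approx_seqD[OF S p] by blast
  define C where "C = 2 * (norm c)\<^sup>2 * A + 2 * (norm d)\<^sup>2 * B"
  have C0: "C \<ge> 0" using A(1) B(1) by (simp add: C_def)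
  have "sob_le p (\<lambda>m. (c * Tn n a m + d * Sn n a m) - (c * T a m + d * S a m)) (C * real n powr (- 2 * (q + 1)) * X)"
    if n: "n \<ge> 1" and a: "sob_le (p + q) a X" for n a X
  proof -
    have e: "(\<lambda>m. c * (Tn n a m - T a m) + d * (Sn n a m - S a m)) = (\<lambda>m. (c * Tn n a m + d * Sn n a m) - (c * T a m + d * S a m))"
      by (simp add: algebra_simps)
    from sob_le_combine[OF A(2)[OF n a, unfolded mult.assoc] B(2)[OF n a, unfolded mult.assoc], of c d]
    show ?thesis unfolding e C_def by (simp only: mult.assoc)
  qed
  with C0 show "\<exists>C\<ge>0. \<forall>n\<ge>1. \<forall>a X. sob_le (p + q) a X \<longrightarrow>
     sob_le p (\<lambda>m. (c * Tn n a m + d * Sn n a m) - (c * T a m + d * S a m)) (C * real n powr (- 2 * (q + 1)) * X)"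
    by blast
qed

text \<open>Write \<open>T\<^sub>n S\<^sub>n - T S = (T\<^sub>n - T) S\<^sub>n + T (S\<^sub>n - S)\<close>; the first term uses that \<open>S\<^sub>n\<close> is
  bounded of order \<open>p + q\<close> uniformly in \<open>n\<close>.\<close>

lemma approx_seq_compose:
  assumes T: "approx_seq T Tn" and S: "approx_seq S Sn"
  shows "approx_seq (\<lambda>a. T (S a)) (\<lambda>n a. Tn n (Sn n a))"
  unfolding approx_seq_def
proof (intro conjI allI impI)
  have lT: "linear_seq T" "bounded_seq T" and lS: "linear_seq S" "bounded_seq S"
    using T S by (auto simp: approx_seq_def)
  show "linear_seq (\<lambda>a. T (S a))" "bounded_seq (\<lambda>a. T (S a))"
    using lT lS by (auto intro: linear_seq_compose bounded_seq_compose)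
  show "linear_seq (\<lambda>a. Tn n (Sn n a))" if "n \<ge> 1" for n
    using T S that by (auto simp: approx_seq_def intro: linear_seq_compose)
  fix p q :: real assume p: "p \<ge> 1" "q \<ge> 0"
  obtain A where A: "A \<ge> 0" "\<And>n a X. n \<ge> 1 \<Longrightarrow> sob_le (p + q) a X \<Longrightarrow>
        sob_le p (\<lambda>m. Tn n a m - T a m) (A * real n powr (- 2 * (q + 1)) * X)" using approx_seqD[OF T p] by blast
  obtain B where B: "B \<ge> 0" "\<And>n a X. n \<ge> 1 \<Longrightarrow> sob_le (p + q) a X \<Longrightarrow>
        sob_le p (\<lambda>m. Sn n a m - S a m) (B * real n powr (- 2 * (q + 1)) * X)" using approx_seqD[OF S p] by blast
  have pq: "p + q \<ge> 1" using p by simp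
  obtain D where D: "D \<ge> 0" "\<And>n a X. n \<ge> 1 \<Longrightarrow> sob_le (p + q) a X \<Longrightarrow> sob_le (p + q) (Sn n a) (D * X)"
    using approx_seq_uniform_bound[OF S pq] by blast
  obtain E where E: "E \<ge> 0" "\<And>a X. sob_le p a X \<Longrightarrow> sob_le p (T a) (E * X)"
    using lT(2) p(1) unfolding bounded_seq_def by blast
  define C where "C = 2 * (A * D) + 2 * (E * B)"
  have C0: "C \<ge> 0" using A(1) B(1) D(1) E(1) by (simp add: C_def)
  have "sob_le p (\<lambda>m. Tn n (Sn n a) m - T (S a) m) (C * real n powr (- 2 * (q + 1)) * X)"
    if n: "n \<ge> 1" and a: "sob_le (p + q) a X" for n a X
  proof -
    have ha: "h1 a" by (rule h1I[OF a pq])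
    have hs: "h1 (Sn n a)" "h1 (S a)"
      using S n ha by (auto simp: approx_seq_def linear_seq_def)
    have "sob_le p (\<lambda>m. (Tn n (Sn n a) m - T (Sn n a) m) + T (\<lambda>m. Sn n a m - S a m) m)
       (2 * (A * real n powr (- 2 * (q + 1)) * (D * X)) + 2 * (E * (B * real n powr (- 2 * (q + 1)) * X)))"
      by (intro sob_le_add A(2)[OF n D(2)[OF n a]] E(2) B(2)[OF n a])
    then show ?thesis
      by (simp add: linear_seqD(3)[OF lT(1) hs] C_def algebra_simps)
  qed
  with C0 show "\<exists>C\<ge>0. \<forall>n\<ge>1. \<forall>a X. sob_le (p + q) a X \<longrightarrow>
     sob_le p (\<lambda>m. Tn n (Sn n a) m - T (S a) m) (C * real n powr (- 2 * (q + 1)) * X)"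
    by blast
qed

lemma interp_linear:
  assumes "l1 a" "l1 b"
  shows "interp n (\<lambda>m. c * a m + d * b m) = (\<lambda>m. c * interp n a m + d * interp n b m)"
proof
  fix r
  let ?i = "\<lambda>a m. if 2 * int n dvd m - r then a m else (0::complex)"
  have s: "?i a summable_on UNIV" "?i b summable_on UNIV"
    by (rule abs_summable_summable, rule l1_if, fact)+
  have "infsum (?i (\<lambda>m. c * a m + d * b m)) UNIV = infsum (\<lambda>m. c * ?i a m + d * ?i b m) UNIV"
    by (rule infsum_cong) auto
  also have "\<dots> = c * infsum (?i a) UNIV + d * infsum (?i b) UNIV"
    using s by (subst infsum_add) (auto simp: infsum_cmult_right' intro: summable_on_cmult_right)
  finally show "interp n (\<lambda>m. c * a m + d * b m) r = c * interp n a r + d * interp n b r"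
    by (simp add: interp_def algebra_simps)
qed

lemma sob_le_interp:
  assumes p: "p \<ge> 1"
  shows "\<exists>C\<ge>0. \<forall>n\<ge>1. \<forall>a X. sob_le p a X \<longrightarrow> sob_le p (interp n a) (C * X)"
proof -
  obtain C where C: "C \<ge> 0" "\<And>n a X. n \<ge> 1 \<Longrightarrow> sob_le p a X \<Longrightarrow>
      sob_le p (\<lambda>m. interp n a m - a m) (C * real n powr (- 2 * (p - p)) * X)"
    using sob_le_interp_error[of p p] p by auto
  have "sob_le p (interp n a) ((2 * C + 2) * X)" if "n \<ge> 1" "sob_le p a X" for n a X
    using sob_le_add[OF C(2)[OF that] that(2)] that(1) by (simp add: algebra_simps)
  with C(1) show ?thesis by (intro exI[of _ "2 * C + 2"]) auto
qed

lemma linear_seq_ker_op: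
  assumes \<kappa>: "rapid \<kappa>" and \<mu>: "order_one_multiplier \<mu>"
    and Q: "\<And>a b c d. l1 a \<Longrightarrow> l1 b \<Longrightarrow> Q (\<lambda>m. c * a m + d * b m) = (\<lambda>m. c * Q a m + d * Q b m)"
    and C: "C \<ge> 0" "\<And>a X. sob_le 1 a X \<Longrightarrow> sob_le 1 (Q a) (C * X)"
  shows "linear_seq (ker_op Q \<kappa> \<mu>)"
    and "h1 a \<Longrightarrow> (\<lambda>(j, l). \<kappa> (j, l) * (\<mu> (m - j) * Q (shift l a) (m - j))) summable_on UNIV"
proof -
  let ?t = "\<lambda>a m (j, l). \<kappa> (j, l) * (\<mu> (m - j) * Q (shift l a) (m - j))"
  obtain E where E: "E \<ge> 0" "\<And>Q a Y. (\<And>l. sob_le 1 (Q (shift l a)) (sobw 1 l * Y)) \<Longrightarrow>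
      sob_le (1 + 1) (ker_op Q \<kappa> \<mu> a) (E * Y) \<and>
      (\<forall>m. (\<lambda>(j, l). \<kappa> (j, l) * (\<mu> (m - j) * Q (shift l a) (m - j))) summable_on UNIV)"
    using sob_le_ker_op[OF \<kappa> \<mu>, of 1 1] by auto
  have K: "h1 (ker_op Q \<kappa> \<mu> a)" "\<And>m. ?t a m summable_on UNIV" if a: "h1 a" for a
  proof -
    obtain X where X: "sob_le 1 a X" using a by (auto simp: h1_def)
    have "sob_le 1 (Q (shift l a)) (sobw 1 l * (C * 2 * X))" for l
      using C(2)[OF sob_le_shift[OF X, of l]] by (simp add: mult_ac)
    from E(2)[OF this] show "h1 (ker_op Q \<kappa> \<mu> a)" "\<And>m. ?t a m summable_on UNIV"
      by (auto intro: h1I)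
  qed
  show "(\<lambda>(j, l). \<kappa> (j, l) * (\<mu> (m - j) * Q (shift l a) (m - j))) summable_on UNIV" if "h1 a"
    by (rule K(2)[OF that])
  show "linear_seq (ker_op Q \<kappa> \<mu>)" unfolding linear_seq_def
  proof (intro conjI allI impI K(1))
    fix a b c d assume ab: "h1 a" "h1 b"
    show "ker_op Q \<kappa> \<mu> (\<lambda>m. c * a m + d * b m) = (\<lambda>m. c * ker_op Q \<kappa> \<mu> a m + d * ker_op Q \<kappa> \<mu> b m)"
    proof
      fix m
      have "shift l (\<lambda>m. c * a m + d * b m) = (\<lambda>m. c * shift l a m + d * shift l b m)" for l
        by (simp add: shift_def fun_eq_iff)
      then have "Q (shift l (\<lambda>m. c * a m + d * b m)) = (\<lambda>m. c * Q (shift l a) m + d * Q (shift l b) m)" for l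
        using Q[of "shift l a" "shift l b" c d] ab by (simp add: l1_shift h1_l1)
      then have "ker_op Q \<kappa> \<mu> (\<lambda>m. c * a m + d * b m) m = infsum (\<lambda>x. c * ?t a m x + d * ?t b m x) UNIV"
        unfolding ker_op_def by (intro infsum_cong) (auto simp: algebra_simps)
      also have "\<dots> = c * infsum (?t a m) UNIV + d * infsum (?t b m) UNIV"
        using K(2)[OF ab(1), of m] K(2)[OF ab(2), of m]
        by (subst infsum_add) (auto simp: infsum_cmult_right' intro: summable_on_cmult_right)
      finally show "ker_op Q \<kappa> \<mu> (\<lambda>m. c * a m + d * b m) m = c * ker_op Q \<kappa> \<mu> a m + d * ker_op Q \<kappa> \<mu> b m"
        by (simp add: ker_op_def)
    qed
  qed
qed

lemma smoothing_ker_op: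
  assumes \<kappa>: "rapid \<kappa>" and \<mu>: "order_one_multiplier \<mu>"
  shows "smoothing_seq (ker_op id \<kappa> \<mu>)"
  unfolding smoothing_seq_def
proof (intro allI impI)
  fix p :: real assume p: "p \<ge> 1"
  obtain E where E: "E \<ge> 0" "\<And>Q a Y. (\<And>l. sob_le p (Q (shift l a)) (sobw p l * Y)) \<Longrightarrow>
      sob_le (p + 1) (ker_op Q \<kappa> \<mu> a) (E * Y)"
    using sob_le_ker_op[OF \<kappa> \<mu>, of p p] p by (metis (no_types, lifting) order_trans zero_le_one)
  have "sob_le (p + 1) (ker_op id \<kappa> \<mu> a) (E * 2 powr p * X)" if "sob_le p a X" for a X
    using E(2)[of id a "2 powr p * X"] sob_le_shift[OF that] p by (simp add: mult_ac)
  then show "\<exists>C\<ge>0. \<forall>a X. sob_le p a X \<longrightarrow> sob_le (p + 1) (ker_op id \<kappa> \<mu> a) (C * X)"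
    using E(1) by (intro exI[of _ "E * 2 powr p"]) auto
qed

text \<open>The difference is \<open>ker_op\<close> with the interpolation error in the place of \<open>Q\<close>. Measuring that
  error one order lower improves its rate by a factor \<open>1 / n\<close>, and the multiplier gives the
  order back.\<close>

lemma approx_ker_op:
  assumes \<kappa>: "rapid \<kappa>" and \<mu>: "order_one_multiplier \<mu>"
  shows "approx_seq (ker_op id \<kappa> \<mu>) (\<lambda>n. ker_op (interp n) \<kappa> \<mu>)"
  unfolding approx_seq_def
proof (intro conjI allI impI)
  have idb: "sob_le 1 (id a) (1 * X)" if "sob_le 1 a X" for a X using that by simp
  note Lid = linear_seq_ker_op[OF \<kappa> \<mu>, of id 1, OF _ _ idb]
  show "linear_seq (ker_op id \<kappa> \<mu>)" by (rule Lid(1)) auto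
  show "bounded_seq (ker_op id \<kappa> \<mu>)" by (rule smoothing_imp_bounded[OF smoothing_ker_op[OF \<kappa> \<mu>]])
  obtain Ci where Ci: "Ci \<ge> 0" "\<And>n a X. n \<ge> 1 \<Longrightarrow> sob_le 1 a X \<Longrightarrow> sob_le 1 (interp n a) (Ci * X)"
    using sob_le_interp[of 1] by auto
  note Ln = linear_seq_ker_op[OF \<kappa> \<mu>, of "interp n" Ci for n, OF interp_linear Ci(1) Ci(2)]
  show "linear_seq (ker_op (interp n) \<kappa> \<mu>)" if "n \<ge> 1" for n
    using that by (intro Ln(1))
  fix p q :: real assume p: "p \<ge> 1" "q \<ge> 0"
  define s where "s = p + q"
  have s: "s \<ge> 1" "0 \<le> p - 1" "p - 1 \<le> s" using p by (auto simp: s_def)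
  obtain A where A: "A \<ge> 0" "\<And>n a X. n \<ge> 1 \<Longrightarrow> sob_le s a X \<Longrightarrow>
      sob_le (p - 1) (\<lambda>m. interp n a m - a m) (A * real n powr (- 2 * (s - (p - 1))) * X)"
    using sob_le_interp_error[OF s] by blast
  have s0: "s \<ge> 0" using s by simp
  obtain E where E: "E \<ge> 0" "\<And>Q a Y. (\<And>l. sob_le (p - 1) (Q (shift l a)) (sobw s l * Y)) \<Longrightarrow>
      sob_le (p - 1 + 1) (ker_op Q \<kappa> \<mu> a) (E * Y)"
    using sob_le_ker_op[OF \<kappa> \<mu> s(2) s0] by (metis (no_types, lifting))
  define C where "C = E * (A * 2 powr s)"
  have C0: "C \<ge> 0" using A(1) E(1) by (simp add: C_def)
  have "sob_le p (\<lambda>m. ker_op (interp n) \<kappa> \<mu> a m - ker_op id \<kappa> \<mu> a m) (C * real n powr (- 2 * (q + 1)) * X)"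
    if n: "n \<ge> 1" and a: "sob_le (p + q) a X" for n a X
  proof -
    let ?D = "\<lambda>b m. interp n b m - b m"
    have a': "sob_le s a X" using a by (simp add: s_def)
    have h: "h1 a" by (rule h1I[OF a' s(1)])
    have sq: "s - (p - 1) = q + 1" by (simp add: s_def)
    have "sob_le (p - 1) (?D (shift l a)) (sobw s l * (A * real n powr (- 2 * (q + 1)) * 2 powr s * X))" for l
      using A(2)[OF n sob_le_shift[OF a' s0, of l]] unfolding sq by (simp add: mult_ac)
    from E(2)[OF this] have "sob_le p (ker_op ?D \<kappa> \<mu> a) (E * (A * real n powr (- 2 * (q + 1)) * 2 powr s * X))" by simp
    moreover have "ker_op ?D \<kappa> \<mu> a = (\<lambda>m. ker_op (interp n) \<kappa> \<mu> a m - ker_op id \<kappa> \<mu> a m)"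
    proof
      fix m
      have 1: "(\<lambda>(j, l). \<kappa> (j, l) * (\<mu> (m - j) * interp n (shift l a) (m - j))) summable_on UNIV"
        using n h by (intro Ln(2))
      have 2: "(\<lambda>(j, l). \<kappa> (j, l) * (\<mu> (m - j) * id (shift l a) (m - j))) summable_on UNIV"
        by (rule Lid(2)) (use h in auto)
      show "ker_op ?D \<kappa> \<mu> a m = ker_op (interp n) \<kappa> \<mu> a m - ker_op id \<kappa> \<mu> a m"
      proof -
        have "ker_op (interp n) \<kappa> \<mu> a m - ker_op id \<kappa> \<mu> a m = ker_op (interp n) \<kappa> \<mu> a m + - ker_op id \<kappa> \<mu> a m" by simp
        also have "\<dots> = (\<Sum>\<^sub>\<infinity>x. (\<lambda>(j, l). \<kappa> (j, l) * (\<mu> (m - j) * interp n (shift l a) (m - j))) x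
            + - (\<lambda>(j, l). \<kappa> (j, l) * (\<mu> (m - j) * id (shift l a) (m - j))) x)"
          unfolding ker_op_def
          by (rule infsumI[symmetric], intro has_sum_add has_sum_uminusI has_sum_infsum 1 2)
        also have "\<dots> = ker_op ?D \<kappa> \<mu> a m"
          unfolding ker_op_def by (intro infsum_cong) (auto simp: algebra_simps)
        finally show ?thesis ..
      qed
    qed
    ultimately show ?thesis by (simp add: C_def mult_ac)
  qed
  with C0 show "\<exists>C\<ge>0. \<forall>n\<ge>1. \<forall>a X. sob_le (p + q) a X \<longrightarrow>
     sob_le p (\<lambda>m. ker_op (interp n) \<kappa> \<mu> a m - ker_op id \<kappa> \<mu> a m) (C * real n powr (- 2 * (q + 1)) * X)"
    by blast
qed

section \<open>Compactness and equations of the second kind\<close>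

text \<open>By Tychonoff's theorem a product of discs is compact, and a countable product is metrizable,
  hence sequentially compact.\<close>

lemma convergent_coordinates_subsequence:
  fixes b :: "nat \<Rightarrow> int \<Rightarrow> complex"
  assumes "\<And>k m. norm (b k m) \<le> D m"
  shows "\<exists>r. strict_mono r \<and> (\<forall>m. convergent (\<lambda>k. b (r k) m))"
proof -
  let ?S = "PiE UNIV (\<lambda>m. cball (0::complex) (D m))"
  have "compactin (product_topology (\<lambda>_. euclidean) UNIV) ?S"
    by (subst compactin_PiE) auto
  then have "compact ?S" by (simp add: euclidean_product_topology)
  then have "seq_compact ?S" by (simp add: compact_eq_seq_compact_metric)
  moreover have "\<forall>k. b k \<in> ?S" using assms by (auto simp: PiE_UNIV_domain)
  ultimately obtain l r where lr: "strict_mono r" "(b \<circ> r) \<longlonglongrightarrow> l"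
    unfolding seq_compact_def by blast
  have "(\<lambda>k. b (r k) m) \<longlonglongrightarrow> l m" for m
  proof -
    have "isCont (\<lambda>f::int \<Rightarrow> complex. f m) l"
      using continuous_on_eq_continuous_at[OF open_UNIV, THEN iffD1, OF continuous_on_product_coordinates] by blast
    from isCont_tendsto_compose[OF this lr(2)] show ?thesis by (simp add: o_def)
  qed
  then show ?thesis using lr(1) by (auto simp: convergent_def)
qed

definition sob_Cauchy :: "real \<Rightarrow> (nat \<Rightarrow> int \<Rightarrow> complex) \<Rightarrow> bool" where
  "sob_Cauchy p b \<longleftrightarrow> (\<forall>\<epsilon>>0. \<exists>K. \<forall>k\<ge>K. \<forall>l\<ge>K. sob_le p (\<lambda>m. b k m - b l m) \<epsilon>)"

text \<open>Rellich's argument: finitely many indices are handled by coordinatewise convergence, and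
  beyond \<open>R\<close> the bound of order \<open>p + 1\<close> makes the tail of order \<open>p\<close> small.\<close>

lemma sob_Cauchy_compact:
  assumes b: "\<And>k. sob_le (p + 1) (b k) C" and conv: "\<And>m. convergent (\<lambda>k. b k m)"
  shows "sob_Cauchy p b"
  unfolding sob_Cauchy_def
proof (intro allI impI)
  fix \<epsilon> :: real assume e: "\<epsilon> > 0"
  have C0: "C \<ge> 0" by (rule sob_le_nonneg[OF b])
  obtain R :: nat where R: "8 * C / \<epsilon> < real R" using reals_Archimedean2 by blast
  define J where "J = {- int R..int R}"
  have "(\<lambda>k. b k m) \<longlonglongrightarrow> lim (\<lambda>k. b k m)" for m using conv convergent_LIMSEQ_iff by blast
  then have "Cauchy (\<lambda>k. b k m)" for m by (rule LIMSEQ_imp_Cauchy)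
  then have "\<forall>m. \<exists>K. \<forall>k\<ge>K. \<forall>l\<ge>K. norm (b k m - b l m) < sqrt (\<epsilon> / (2 * (2 * real R + 1) * sobw p m))"
    using e by (intro allI CauchyD) (auto intro!: divide_pos_pos mult_pos_pos)
  then obtain K where K: "\<And>m k l. k \<ge> K m \<Longrightarrow> l \<ge> K m \<Longrightarrow>
      norm (b k m - b l m) < sqrt (\<epsilon> / (2 * (2 * real R + 1) * sobw p m))" by metis
  define K0 where "K0 = Max (K ` J)"
  have K0: "K m \<le> K0" if "m \<in> J" for m unfolding K0_def using that by (intro Max_ge) (auto simp: J_def)
  show "\<exists>K. \<forall>k\<ge>K. \<forall>l\<ge>K. sob_le p (\<lambda>m. b k m - b l m) \<epsilon>"
  proof (intro exI allI impI)
    fix k l assume kl: "K0 \<le> k" "K0 \<le> l"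
    show "sob_le p (\<lambda>m. b k m - b l m) \<epsilon>" unfolding sob_le_def
    proof (intro allI impI)
      fix M :: "int set" assume M: "finite M"
      let ?d = "\<lambda>m. (norm (b k m - b l m))\<^sup>2"
      have low: "sobw p m * ?d m \<le> \<epsilon> / (2 * (2 * real R + 1))" if m: "m \<in> J" for m
      proof -
        have "norm (b k m - b l m) \<le> sqrt (\<epsilon> / (2 * (2 * real R + 1) * sobw p m))"
          using K[of m k l] K0[OF m] kl by auto
        then have "?d m \<le> (sqrt (\<epsilon> / (2 * (2 * real R + 1) * sobw p m)))\<^sup>2" by (intro power_mono) auto
        also have "\<dots> = \<epsilon> / (2 * (2 * real R + 1) * sobw p m)" using e by simp
        finally have "sobw p m * ?d m \<le> sobw p m * (\<epsilon> / (2 * (2 * real R + 1) * sobw p m))"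
          by (rule mult_left_mono) simp
        also have "\<dots> = \<epsilon> / (2 * (2 * real R + 1))" using less_imp_neq[OF sobw_pos[of p m]] by simp
        finally show ?thesis .
      qed
      have "(\<Sum>m\<in>M \<inter> J. sobw p m * ?d m) \<le> (\<Sum>m\<in>J. sobw p m * ?d m)"
        by (rule sum_mono2) (auto simp: J_def)
      also have "\<dots> \<le> (\<Sum>m\<in>J. \<epsilon> / (2 * (2 * real R + 1)))" by (intro sum_mono low)
      also have "\<dots> = (2 * real R + 1) * (\<epsilon> / (2 * (2 * real R + 1)))" by (simp add: J_def)
      also have "\<dots> = \<epsilon> / 2" by (simp add: field_simps)
      finally have S1: "(\<Sum>m\<in>M \<inter> J. sobw p m * ?d m) \<le> \<epsilon> / 2" .
      have D: "sob_le (p + 1) (\<lambda>m. b k m - b l m) (2 * C + 2 * C)" by (rule sob_le_diff[OF b b])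
      have "(\<Sum>m\<in>M - J. sobw p m * ?d m) * real R \<le> (\<Sum>m\<in>M - J. sobw (p + 1) m * ?d m)"
        unfolding sum_distrib_right
      proof (rule sum_mono)
        fix m assume "m \<in> M - J"
        then have "int R \<le> \<bar>m\<bar>" by (auto simp: J_def)
        then have "real R \<le> \<bar>of_int m\<bar>" by linarith
        also have "\<bar>of_int m\<bar> \<le> 1 + (of_int m :: real)\<^sup>2"
        proof -
          have "0 \<le> (\<bar>of_int m\<bar> - 1)\<^sup>2 + \<bar>of_int m :: real\<bar>" by (intro add_nonneg_nonneg) auto
          then show ?thesis by (simp add: power2_eq_square algebra_simps)
        qed
        finally have "real R \<le> sobw 1 m" by (simp add: sobw_1)
        then have "(sobw p m * ?d m) * real R \<le> (sobw p m * ?d m) * sobw 1 m" by (intro mult_left_mono) auto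
        also have "\<dots> = sobw (p + 1) m * ?d m" by (simp add: sobw_add)
        finally show "(sobw p m * ?d m) * real R \<le> sobw (p + 1) m * ?d m" .
      qed
      also have "\<dots> \<le> 2 * C + 2 * C" using D[unfolded sob_le_def, rule_format, of "M - J"] M by simp
      also have "\<dots> = 4 * C" by simp
      finally have "(\<Sum>m\<in>M - J. sobw p m * ?d m) * real R \<le> 4 * C" .
      moreover have "0 \<le> 8 * C / \<epsilon>" using C0 e by simp
      with R have "0 < real R" by linarith
      ultimately have "(\<Sum>m\<in>M - J. sobw p m * ?d m) \<le> 4 * C / real R" by (simp add: pos_le_divide_eq)
      also have "\<dots> \<le> \<epsilon> / 2" using R e \<open>0 < real R\<close> by (simp add: field_simps)
      finally have S2: "(\<Sum>m\<in>M - J. sobw p m * ?d m) \<le> \<epsilon> / 2" .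
      have "(\<Sum>m\<in>M. sobw p m * ?d m) = (\<Sum>m\<in>M \<inter> J. sobw p m * ?d m) + (\<Sum>m\<in>M - J. sobw p m * ?d m)"
        by (rule sum.Int_Diff[OF M])
      with S1 S2 show "(\<Sum>m\<in>M. sobw p m * ?d m) \<le> \<epsilon>" by linarith
    qed
  qed
qed

lemma sob_complete:
  assumes C: "sob_Cauchy p b"
  shows "\<exists>a. \<forall>\<epsilon>>0. \<exists>K. \<forall>k\<ge>K. sob_le p (\<lambda>m. b k m - a m) \<epsilon>"
proof -
  have "Cauchy (\<lambda>k. b k m)" for m
  proof (rule CauchyI)
    fix e :: real assume e: "e > 0"
    then have "sobw p m * e\<^sup>2 / 2 > 0" by simp
    then obtain K where K: "\<And>k l. k \<ge> K \<Longrightarrow> l \<ge> K \<Longrightarrow> sob_le p (\<lambda>m. b k m - b l m) (sobw p m * e\<^sup>2 / 2)"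
      using C unfolding sob_Cauchy_def by blast
    show "\<exists>K. \<forall>k\<ge>K. \<forall>l\<ge>K. norm (b k m - b l m) < e"
    proof (intro exI allI impI)
      fix k l assume "K \<le> k" "K \<le> l"
      from sob_le_term[OF K[OF this], of m]
      have "sobw p m * (norm (b k m - b l m))\<^sup>2 \<le> sobw p m * (e\<^sup>2 / 2)" by simp
      then have "(norm (b k m - b l m))\<^sup>2 \<le> e\<^sup>2 / 2" using sobw_pos[of p m] by (simp only: mult_le_cancel_left_pos)
      also have "\<dots> < e\<^sup>2" using e by simp
      finally show "norm (b k m - b l m) < e" using e by (auto intro: power2_less_imp_less)
    qed
  qed
  then have "\<forall>m. \<exists>a. (\<lambda>k. b k m) \<longlonglongrightarrow> a" using Cauchy_convergent_iff convergent_def by blast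
  then obtain a where a: "\<And>m. (\<lambda>k. b k m) \<longlonglongrightarrow> a m" by metis
  show ?thesis
  proof (rule exI[of _ a], intro allI impI)
    fix \<epsilon> :: real assume e: "\<epsilon> > 0"
    then obtain K where K: "\<And>k l. k \<ge> K \<Longrightarrow> l \<ge> K \<Longrightarrow> sob_le p (\<lambda>m. b k m - b l m) \<epsilon>"
      using C unfolding sob_Cauchy_def by blast
    have "sob_le p (\<lambda>m. b k m - a m) \<epsilon>" if k: "k \<ge> K" for k
      unfolding sob_le_def
    proof (intro allI impI)
      fix M :: "int set" assume M: "finite M"
      have "(\<lambda>l. \<Sum>m\<in>M. sobw p m * (norm (b k m - b l m))\<^sup>2) \<longlonglongrightarrow> (\<Sum>m\<in>M. sobw p m * (norm (b k m - a m))\<^sup>2)"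
        by (intro tendsto_intros a)
      moreover have "\<forall>l\<ge>K. (\<Sum>m\<in>M. sobw p m * (norm (b k m - b l m))\<^sup>2) \<le> \<epsilon>"
        using K[OF k] M unfolding sob_le_def by blast
      ultimately show "(\<Sum>m\<in>M. sobw p m * (norm (b k m - a m))\<^sup>2) \<le> \<epsilon>"
        using LIMSEQ_le_const2 by blast
    qed
    then show "\<exists>K. \<forall>k\<ge>K. sob_le p (\<lambda>m. b k m - a m) \<epsilon>" by blast
  qed
qed

text \<open>Otherwise there are sequences \<open>a k\<close> of norm one whose images under \<open>c0 + B\<close> tend to zero. As
  \<open>B\<close> gains an order, the \<open>B (a k)\<close> converge along a subsequence, and therefore so do the \<open>a
  k\<close>. The limit is annihilated by \<open>c0 + B\<close>, hence zero, in contradiction to the norm.\<close>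

lemma second_kind_coercive:
  fixes c0 :: complex
  assumes c0: "c0 \<noteq> 0" and lin: "linear_seq B" and sm: "smoothing_seq B"
    and inj: "\<And>a. h1 a \<Longrightarrow> (\<And>m. c0 * a m + B a m = 0) \<Longrightarrow> (\<And>m. a m = 0)"
    and p: "p \<ge> 1"
  shows "\<exists>C\<ge>0. \<forall>a X Y. sob_le p a X \<longrightarrow> sob_le p (\<lambda>m. c0 * a m + B a m) Y \<longrightarrow> sob_le p a (C * Y)"
proof (rule ccontr)
  let ?A = "\<lambda>a m. c0 * a m + B a m"
  have linA: "linear_seq ?A" using linear_seq_combine[OF linear_seq_id lin, of c0 1] by simp
  assume neg: "\<not> ?thesis"
  \<comment> \<open>normalized counterexamples; that the norm is not small is recorded by the failure of the bound \<open>1 / 2\<close>\<close>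
  have "\<exists>a. sob_le p a 1 \<and> sob_le p (?A a) (1 / real (Suc k)) \<and> \<not> sob_le p a (1 / 2)" for k
  proof -
    obtain a X Y where aXY: "sob_le p a X" "sob_le p (?A a) Y" "\<not> sob_le p a (real (Suc k) * Y)"
      using neg by (metis of_nat_0_le_iff)
    define N where "N = (\<Sum>\<^sub>\<infinity>m. sobw p m * (norm (a m))\<^sup>2)"
    have N: "sob_le p a N" unfolding N_def by (rule sob_le_of_summable[OF sob_le_summable(1)[OF aXY(1)]])
    have Nmin: "N \<le> Z" if "sob_le p a Z" for Z unfolding N_def by (rule sob_le_summable(2)[OF that])
    have Y0: "Y \<ge> 0" by (rule sob_le_nonneg[OF aXY(2)])
    have NY: "N > real (Suc k) * Y" using aXY(3) sob_le_mono[OF N] by (meson not_le)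
    then have N0: "N > 0" using Y0 by (smt (verit) mult_nonneg_nonneg of_nat_0_le_iff)
    define s where "s = complex_of_real (1 / sqrt N)"
    have s2: "(norm s)\<^sup>2 = 1 / N" using N0 by (simp add: s_def norm_divide power_divide)
    have ha: "h1 a" by (rule h1I[OF aXY(1) p])
    have 1: "sob_le p (\<lambda>m. s * a m) 1" using sob_le_scale[OF N, of s] N0 by (simp add: s2)
    have "sob_le p (?A (\<lambda>m. s * a m)) (1 / N * Y)"
      using sob_le_scale[OF aXY(2), of s] unfolding linear_seqD(5)[OF linA ha ha] s2 .
    moreover have "1 / N * Y \<le> 1 / real (Suc k)" using NY N0 by (simp add: field_simps)
    ultimately have 2: "sob_le p (?A (\<lambda>m. s * a m)) (1 / real (Suc k))" by (rule sob_le_mono)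
    have "\<not> sob_le p (\<lambda>m. s * a m) (1 / 2)"
    proof
      assume h: "sob_le p (\<lambda>m. s * a m) (1 / 2)"
      have "s \<noteq> 0" using N0 by (simp add: s_def)
      then have "(norm (1 / s))\<^sup>2 = N" using s2 by (simp add: norm_divide power_divide)
      then have "sob_le p a (N * (1 / 2))" using sob_le_scale[OF h, of "1 / s"] \<open>s \<noteq> 0\<close> by simp
      from Nmin[OF this] N0 show False by simp
    qed
    with 1 2 show ?thesis by blast
  qed
  then obtain a where a: "\<And>k. sob_le p (a k) 1" "\<And>k. sob_le p (?A (a k)) (1 / real (Suc k))" "\<And>k. \<not> sob_le p (a k) (1 / 2)"
    by metis
  obtain Cb where Cb: "Cb \<ge> 0" "\<And>a X. sob_le p a X \<Longrightarrow> sob_le (p + 1) (B a) (Cb * X)"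
    using sm p unfolding smoothing_seq_def by blast
  have b: "sob_le (p + 1) (B (a k)) Cb" for k using Cb(2)[OF a(1)] by simp
  have "norm (B (a k) m) \<le> sqrt Cb" for k m
  proof (rule real_le_rsqrt)
    have "1 * (norm (B (a k) m))\<^sup>2 \<le> sobw (p + 1) m * (norm (B (a k) m))\<^sup>2"
      using p by (intro mult_right_mono sobw_ge_1) auto
    also have "\<dots> \<le> Cb" by (rule sob_le_term[OF b])
    finally show "(norm (B (a k) m))\<^sup>2 \<le> Cb" by simp
  qed
  from convergent_coordinates_subsequence[of "\<lambda>k. B (a k)" "\<lambda>_. sqrt Cb", OF this]
  obtain r where r: "strict_mono r" "\<And>m. convergent (\<lambda>k. B (a (r k)) m)" by blast
  have CB: "sob_Cauchy p (\<lambda>k. B (a (r k)))" by (rule sob_Cauchy_compact[OF b r(2)])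
  have "sob_Cauchy p (\<lambda>k. a (r k))"
    unfolding sob_Cauchy_def
  proof (intro allI impI)
    fix \<epsilon> :: real assume e: "\<epsilon> > 0"
    \<comment> \<open>the triangle inequality for squared norms doubles twice: the three contributions add up to \<open>10 * \<delta>\<close>\<close>
    define \<delta> where "\<delta> = (norm c0)\<^sup>2 * \<epsilon> / 10"
    have d: "\<delta> > 0" using e c0 by (simp add: \<delta>_def)
    obtain K where K: "\<And>k l. k \<ge> K \<Longrightarrow> l \<ge> K \<Longrightarrow> sob_le p (\<lambda>m. B (a (r k)) m - B (a (r l)) m) \<delta>"
      using CB d unfolding sob_Cauchy_def by blast
    obtain L where L: "1 / real (Suc L) < \<delta>" using d nat_approx_posE by blast
    have Ak: "sob_le p (?A (a (r k))) \<delta>" if "k \<ge> L" for k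
    proof (rule sob_le_mono[OF a(2)])
      have "L \<le> r k" using that strict_mono_imp_increasing[OF r(1), of k] by linarith
      then have "1 / real (Suc (r k)) \<le> 1 / real (Suc L)" by (intro divide_left_mono) auto
      with L show "1 / real (Suc (r k)) \<le> \<delta>" by linarith
    qed
    show "\<exists>K. \<forall>k\<ge>K. \<forall>l\<ge>K. sob_le p (\<lambda>m. a (r k) m - a (r l) m) \<epsilon>"
    proof (intro exI allI impI)
      fix k l assume kl: "max K L \<le> k" "max K L \<le> l"
      have "sob_le p (\<lambda>m. (?A (a (r k)) m - ?A (a (r l)) m) - (B (a (r k)) m - B (a (r l)) m)) (2 * (2 * \<delta> + 2 * \<delta>) + 2 * \<delta>)"
        using kl by (intro sob_le_diff Ak K) auto
      from sob_le_scale[OF this, of "1 / c0"]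
      have "sob_le p (\<lambda>m. 1 / c0 * ((?A (a (r k)) m - ?A (a (r l)) m) - (B (a (r k)) m - B (a (r l)) m))) ((norm (1 / c0))\<^sup>2 * (10 * \<delta>))"
        by simp
      moreover have "(\<lambda>m. 1 / c0 * ((?A (a (r k)) m - ?A (a (r l)) m) - (B (a (r k)) m - B (a (r l)) m)))
          = (\<lambda>m. a (r k) m - a (r l) m)"
        using c0 by (simp add: fun_eq_iff field_simps)
      moreover have "(norm (1 / c0))\<^sup>2 * (10 * \<delta>) = \<epsilon>"
        using c0 by (simp add: \<delta>_def norm_divide power_divide)
      ultimately show "sob_le p (\<lambda>m. a (r k) m - a (r l) m) \<epsilon>" by (simp only:)
    qed
  qed
  from sob_complete[OF this] obtain z where
    z: "\<And>\<epsilon>. \<epsilon> > 0 \<Longrightarrow> \<exists>K. \<forall>k\<ge>K. sob_le p (\<lambda>m. a (r k) m - z m) \<epsilon>" by blast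
  have hak: "h1 (a k)" for k by (rule h1I[OF a(1) p])
  have hz: "h1 z"
  proof -
    obtain K where "sob_le p (\<lambda>m. a (r K) m - z m) 1" using z[of 1] by auto
    from sob_le_diff[OF a(1)[of "r K"] this] have "sob_le p z (2 * 1 + 2 * 1)" by simp
    then show ?thesis by (rule h1I[OF _ p])
  qed
  obtain CA where CA: "CA \<ge> 0" "\<And>a X. sob_le p a X \<Longrightarrow> sob_le p (?A a) (CA * X)"
  proof -
    have "bounded_seq (\<lambda>a. a)" using approx_seq_id by (simp add: approx_seq_def)
    from bounded_seq_combine[OF this smoothing_imp_bounded[OF sm], of c0 1]
    have "bounded_seq ?A" by simp
    with p that show ?thesis unfolding bounded_seq_def by blast
  qed
  have small: "sob_le p (?A z) \<epsilon>" if e: "\<epsilon> > 0" for \<epsilon>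
  proof -
    define \<delta> where "\<delta> = \<epsilon> / (2 * (1 + CA))"
    have "\<delta> * (2 * (1 + CA)) = \<epsilon>" using CA(1) by (simp add: \<delta>_def)
    then have d: "\<delta> > 0" "2 * \<delta> + 2 * (CA * \<delta>) = \<epsilon>" using e CA(1) by (simp add: \<delta>_def, simp add: algebra_simps)
    obtain K where K: "\<And>k. k \<ge> K \<Longrightarrow> sob_le p (\<lambda>m. a (r k) m - z m) \<delta>" using z[OF d(1)] by blast
    obtain L where L: "1 / real (Suc L) < \<delta>" using d nat_approx_posE by blast
    define k where "k = max K L"
    have "L \<le> r k" using strict_mono_imp_increasing[OF r(1), of k] by (auto simp: k_def)
    then have "1 / real (Suc (r k)) \<le> 1 / real (Suc L)" by (intro divide_left_mono) auto
    then have "1 / real (Suc (r k)) \<le> \<delta>" using L by linarith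
    from sob_le_diff[OF sob_le_mono[OF a(2) this] CA(2)[OF K[of k]]]
    have "sob_le p (\<lambda>m. ?A (a (r k)) m - ?A (\<lambda>m. a (r k) m - z m) m) (2 * \<delta> + 2 * (CA * \<delta>))"
      by (simp add: k_def)
    moreover have "?A (a (r k)) m - ?A (\<lambda>m. a (r k) m - z m) m = ?A z m" for m
      using fun_cong[OF linear_seqD(3)[OF linA hak hz], of "r k" m] by simp
    ultimately show ?thesis unfolding d(2) by (simp only:)
  qed
  have "?A z m = 0" for m
  proof (rule ccontr)
    assume "?A z m \<noteq> 0"
    then have "sobw p m * (norm (?A z m))\<^sup>2 > 0" by simp
    moreover from sob_le_term[OF small, of "sobw p m * (norm (?A z m))\<^sup>2 / 2" m] this
    have "sobw p m * (norm (?A z m))\<^sup>2 \<le> sobw p m * (norm (?A z m))\<^sup>2 / 2" by simp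
    ultimately show False by linarith
  qed
  then have z0: "z m = 0" for m by (rule inj[OF hz])
  obtain K where "sob_le p (\<lambda>m. a (r K) m - z m) (1 / 2)" using z[of "1 / 2"] by auto
  then show False using a(3)[of "r K"] by (simp add: z0)
qed

section \<open>Stability and solvability of projected equations\<close>

text \<open>Write \<open>P B\<^sub>n - B = P (B\<^sub>n - B) + (P - I) B\<close>; the second term is of size \<open>1 / n\<close> because \<open>B\<close>
  gains one order.\<close>

lemma nystrom_consistency:
  assumes B: "approx_seq B Bn" and sm: "smoothing_seq B" and p: "p \<ge> 1"
  shows "\<exists>E\<ge>0. \<forall>n\<ge>1. \<forall>a X. sob_le p a X \<longrightarrow>
     sob_le p (\<lambda>m. interp n (Bn n a) m - B a m) (E * real n powr (- 2) * X)"
proof -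
  obtain P where P: "P \<ge> 0" "\<And>n a X. n \<ge> 1 \<Longrightarrow> sob_le p a X \<Longrightarrow> sob_le p (interp n a) (P * X)"
    using sob_le_interp[OF p] by blast
  obtain A where A: "A \<ge> 0" "\<And>n a X. n \<ge> 1 \<Longrightarrow> sob_le (p + 0) a X \<Longrightarrow>
        sob_le p (\<lambda>m. Bn n a m - B a m) (A * real n powr (- 2 * (0 + 1)) * X)"
    using approx_seqD[OF B p order_refl] by blast
  obtain S where S: "S \<ge> 0" "\<And>a X. sob_le p a X \<Longrightarrow> sob_le (p + 1) (B a) (S * X)"
    using sm p unfolding smoothing_seq_def by blast
  have p1: "p + 1 \<ge> 1" "0 \<le> p" "p \<le> p + 1" using p by auto
  obtain I where I: "I \<ge> 0" "\<And>n a X. n \<ge> 1 \<Longrightarrow> sob_le (p + 1) a X \<Longrightarrow>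
      sob_le p (\<lambda>m. interp n a m - a m) (I * real n powr (- 2 * (p + 1 - p)) * X)"
    using sob_le_interp_error[OF p1] by blast
  define E where "E = 2 * (P * A) + 2 * (I * S)"
  have "sob_le p (\<lambda>m. interp n (Bn n a) m - B a m) (E * real n powr (- 2) * X)"
    if n: "n \<ge> 1" and a: "sob_le p a X" for n a X
  proof -
    have ha: "h1 a" by (rule h1I[OF a p])
    have h: "h1 (Bn n a)" "h1 (B a)" using B n ha by (auto simp: approx_seq_def linear_seq_def)
    have a0: "sob_le (p + 0) a X" using a by simp
    have d: "interp n (\<lambda>m. Bn n a m - B a m) = (\<lambda>m. interp n (Bn n a) m - interp n (B a) m)"
      using interp_linear[OF h1_l1[OF h(1)] h1_l1[OF h(2)], of n 1 "- 1"] by simp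
    have "sob_le p (\<lambda>m. interp n (\<lambda>m. Bn n a m - B a m) m + (interp n (B a) m - B a m))
      (2 * (P * (A * real n powr (- 2 * (0 + 1)) * X)) + 2 * (I * real n powr (- 2 * (p + 1 - p)) * (S * X)))"
      by (intro sob_le_add P(2)[OF n] A(2)[OF n a0] I(2)[OF n] S(2) a)
    then show ?thesis by (simp add: d E_def algebra_simps)
  qed
  moreover have "E \<ge> 0" using P(1) A(1) I(1) S(1) by (simp add: E_def)
  ultimately show ?thesis by blast
qed

text \<open>The perturbation \<open>P B\<^sub>n - B\<close> contributes at most half of the squared norm of \<open>a\<close> once \<open>n\<close> is
  large, and is absorbed into the left-hand side.\<close>

lemma nystrom_stability:
  assumes B: "approx_seq B Bn" and sm: "smoothing_seq B" and p: "p \<ge> 1"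
    and C: "C \<ge> 0" "\<And>a X Y. sob_le p a X \<Longrightarrow> sob_le p (\<lambda>m. c0 * a m + B a m) Y \<Longrightarrow> sob_le p a (C * Y)"
  shows "\<exists>N\<ge>1. \<forall>n\<ge>N. \<forall>a X Y. sob_le p a X \<longrightarrow>
     sob_le p (\<lambda>m. c0 * a m + interp n (Bn n a) m) Y \<longrightarrow> sob_le p a (4 * C * Y)"
proof -
  obtain E where E: "E \<ge> 0" "\<And>n a X. n \<ge> 1 \<Longrightarrow> sob_le p a X \<Longrightarrow>
     sob_le p (\<lambda>m. interp n (Bn n a) m - B a m) (E * real n powr (- 2) * X)"
    using nystrom_consistency[OF B sm p] by blast
  obtain N0 :: nat where N0: "4 * C * E < real N0" using reals_Archimedean2 by blast
  define N where "N = max 1 N0"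
  have "sob_le p a (4 * C * Y)"
    if n: "n \<ge> N" and a: "sob_le p a X" and Y: "sob_le p (\<lambda>m. c0 * a m + interp n (Bn n a) m) Y" for n a X Y
  proof -
    have n1: "n \<ge> 1" "N0 \<le> n" using n by (auto simp: N_def)
    define Z where "Z = (\<Sum>\<^sub>\<infinity>m. sobw p m * (norm (a m))\<^sup>2)"
    have Z: "sob_le p a Z" unfolding Z_def by (rule sob_le_of_summable[OF sob_le_summable(1)[OF a]])
    have Z0: "Z \<ge> 0" by (rule sob_le_nonneg[OF Z])
    have "sob_le p (\<lambda>m. (c0 * a m + interp n (Bn n a) m) - (interp n (Bn n a) m - B a m))
       (2 * Y + 2 * (E * real n powr (- 2) * Z))"
      by (rule sob_le_diff[OF Y E(2)[OF n1(1) Z]])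
    then have "sob_le p (\<lambda>m. c0 * a m + B a m) (2 * Y + 2 * (E * real n powr (- 2) * Z))" by simp
    from sob_le_summable(2)[OF C(2)[OF a this]]
    have Zle: "Z \<le> C * (2 * Y + 2 * (E * real n powr (- 2) * Z))" by (simp add: Z_def)
    have small: "C * (2 * (E * real n powr (- 2) * Z)) \<le> Z / 2"
    proof -
      have "4 * C * E \<le> real n" using N0 n1 by linarith
      also have "\<dots> \<le> (real n)\<^sup>2" using n1 by (simp add: power2_eq_square)
      finally have "4 * C * E / (real n)\<^sup>2 \<le> 1" using n1 by (simp add: field_simps)
      then have "4 * C * E * real n powr (- 2) \<le> 1" by (simp add: powr_minus divide_inverse)
      from mult_right_mono[OF this Z0] show ?thesis by simp
    qed
    have "C * (2 * Y + 2 * (E * real n powr (- 2) * Z)) = 2 * C * Y + C * (2 * (E * real n powr (- 2) * Z))"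
      by (simp only: distrib_left mult.assoc mult.left_commute)
    with Zle small have "Z \<le> 4 * C * Y" by linarith
    with Z show ?thesis by (rule sob_le_mono)
  qed
  then show ?thesis by (intro exI[of _ N]) (auto simp: N_def)
qed

text \<open>The equation for \<open>b\<close> turns \<open>(c0 + P B\<^sub>n) (b - a)\<close> into \<open>c0 (P a - a) + P (B - B\<^sub>n) a\<close>, in
  which only the smooth sequence \<open>a\<close> occurs.\<close>

lemma nystrom_residual:
  assumes B: "approx_seq B Bn" and p: "p \<ge> 1" and q: "q \<ge> 0"
  shows "\<exists>E\<ge>0. \<forall>n\<ge>1. \<forall>a b X. sob_le (p + q) a X \<longrightarrow> h1 b \<longrightarrow>
     (\<forall>m. c0 * b m + interp n (Bn n b) m = interp n (\<lambda>m. c0 * a m + B a m) m) \<longrightarrow>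
     sob_le p (\<lambda>m. c0 * (b m - a m) + interp n (Bn n (\<lambda>m. b m - a m)) m) (E * real n powr (- 2 * q) * X)"
proof -
  obtain P where P: "P \<ge> 0" "\<And>n a X. n \<ge> 1 \<Longrightarrow> sob_le p a X \<Longrightarrow> sob_le p (interp n a) (P * X)"
    using sob_le_interp[OF p] by blast
  obtain A where A: "A \<ge> 0" "\<And>n a X. n \<ge> 1 \<Longrightarrow> sob_le (p + q) a X \<Longrightarrow>
        sob_le p (\<lambda>m. Bn n a m - B a m) (A * real n powr (- 2 * (q + 1)) * X)"
    using approx_seqD[OF B p q] by blast
  have pq: "p + q \<ge> 1" "0 \<le> p" "p \<le> p + q" using p q by auto
  obtain I where I: "I \<ge> 0" "\<And>n a X. n \<ge> 1 \<Longrightarrow> sob_le (p + q) a X \<Longrightarrow>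
      sob_le p (\<lambda>m. interp n a m - a m) (I * real n powr (- 2 * (p + q - p)) * X)"
    using sob_le_interp_error[OF pq] by blast
  define E where "E = 2 * ((norm c0)\<^sup>2 * I) + 2 * (P * A)"
  have "sob_le p (\<lambda>m. c0 * (b m - a m) + interp n (Bn n (\<lambda>m. b m - a m)) m) (E * real n powr (- 2 * q) * X)"
    if n: "n \<ge> 1" and a: "sob_le (p + q) a X" and hb: "h1 b"
      and eq: "\<And>m. c0 * b m + interp n (Bn n b) m = interp n (\<lambda>m. c0 * a m + B a m) m" for n a b X
  proof -
    have ha: "h1 a" by (rule h1I[OF a pq(1)])
    have lin: "linear_seq B" "linear_seq (Bn n)" using B n by (auto simp: approx_seq_def)
    have h: "h1 (B a)" "h1 (Bn n a)" "h1 (Bn n b)" using lin ha hb by (auto simp: linear_seq_def)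
    have i1: "interp n (\<lambda>m. c0 * a m + B a m) = (\<lambda>m. c0 * interp n a m + interp n (B a) m)"
      using interp_linear[OF h1_l1[OF ha] h1_l1[OF h(1)], of n c0 1] by simp
    have i2: "interp n (Bn n (\<lambda>m. b m - a m)) = (\<lambda>m. interp n (Bn n b) m - interp n (Bn n a) m)"
      using interp_linear[OF h1_l1[OF h(3)] h1_l1[OF h(2)], of n 1 "- 1"]
      by (simp add: linear_seqD(3)[OF lin(2) hb ha])
    have i3: "interp n (\<lambda>m. Bn n a m - B a m) = (\<lambda>m. interp n (Bn n a) m - interp n (B a) m)"
      using interp_linear[OF h1_l1[OF h(2)] h1_l1[OF h(1)], of n 1 "- 1"] by simp
    have e: "c0 * (b m - a m) + interp n (Bn n (\<lambda>m. b m - a m)) m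
        = c0 * (interp n a m - a m) - interp n (\<lambda>m. Bn n a m - B a m) m" for m
      using eq[of m] unfolding i1 i2 i3 by (simp add: algebra_simps)
    have "sob_le p (\<lambda>m. c0 * (interp n a m - a m) - interp n (\<lambda>m. Bn n a m - B a m) m)
      (2 * ((norm c0)\<^sup>2 * (I * real n powr (- 2 * (p + q - p)) * X)) + 2 * (P * (A * real n powr (- 2 * (q + 1)) * X)))"
      by (intro sob_le_diff sob_le_scale I(2)[OF n a] P(2)[OF n] A(2)[OF n a])
    then have "sob_le p (\<lambda>m. c0 * (b m - a m) + interp n (Bn n (\<lambda>m. b m - a m)) m)
      (2 * ((norm c0)\<^sup>2 * (I * real n powr (- 2 * (p + q - p)) * X)) + 2 * (P * (A * real n powr (- 2 * (q + 1)) * X)))"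
      unfolding e .
    then show ?thesis
    proof (rule sob_le_mono)
      have "real n powr (- 2 * (q + 1)) \<le> real n powr (- 2 * q)" using n by (intro powr_mono) auto
      then have "2 * (P * (A * real n powr (- 2 * (q + 1)) * X)) \<le> 2 * (P * (A * real n powr (- 2 * q) * X))"
        using P(1) A(1) sob_le_nonneg[OF a] by (intro mult_left_mono mult_right_mono) auto
      then show "2 * ((norm c0)\<^sup>2 * (I * real n powr (- 2 * (p + q - p)) * X)) + 2 * (P * (A * real n powr (- 2 * (q + 1)) * X))
          \<le> E * real n powr (- 2 * q) * X" by (simp add: E_def algebra_simps)
    qed
  qed
  moreover have "E \<ge> 0" using P(1) A(1) I(1) by (simp add: E_def)
  ultimately show ?thesis by blast
qed

lemma trig_coeffs_sob_le:
  assumes "c \<in> trig_coeffs n" shows "\<exists>X. sob_le p c X"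
proof -
  have z: "c m = 0" if "m \<notin> {- int n..int n}" for m using assms that by (auto simp: trig_coeffs_def)
  have "sob_le p c (\<Sum>m\<in>{- int n..int n}. sobw p m * (norm (c m))\<^sup>2)"
    unfolding sob_le_def
  proof (intro allI impI)
    fix M :: "int set" assume M: "finite M"
    have "(\<Sum>m\<in>M. sobw p m * (norm (c m))\<^sup>2) = (\<Sum>m\<in>M \<inter> {- int n..int n}. sobw p m * (norm (c m))\<^sup>2)"
      using M z by (intro sum.mono_neutral_right) auto
    also have "\<dots> \<le> (\<Sum>m\<in>{- int n..int n}. sobw p m * (norm (c m))\<^sup>2)"
      by (intro sum_mono2) auto
    finally show "(\<Sum>m\<in>M. sobw p m * (norm (c m))\<^sup>2) \<le> (\<Sum>m\<in>{- int n..int n}. sobw p m * (norm (c m))\<^sup>2)" .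
  qed
  then show ?thesis by blast
qed

lemma trig_coeffs_h1: "c \<in> trig_coeffs n \<Longrightarrow> h1 c"
  unfolding h1_def by (rule trig_coeffs_sob_le)

text \<open>Linear algebra in a space of finite dimension. Since \<open>T\<close> is linear only on the sequences in
  \<open>h1\<close>, it is first composed with a projection \<open>\<pi>\<close> of all sequences onto \<open>trig_coeffs n\<close>. A
  basis of that space is mapped to an independent set of the same cardinality, which therefore
  spans it.\<close>

lemma trig_coeffs_injective_imp_surjective:
  assumes lin: "linear_seq T" and maps: "\<And>c. c \<in> trig_coeffs n \<Longrightarrow> T c \<in> trig_coeffs n"
    and inj: "\<And>c. c \<in> trig_coeffs n \<Longrightarrow> (\<And>m. T c m = 0) \<Longrightarrow> (\<And>m. c m = 0)"
    and y: "y \<in> trig_coeffs n"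
  shows "\<exists>c\<in>trig_coeffs n. T c = y"
proof -
  let ?sc = "\<lambda>(c::complex) (f::int \<Rightarrow> complex) m. c * f m"
  let ?V = "trig_coeffs n"
  have vs: "vector_space ?sc"
    by unfold_locales (auto simp: fun_eq_iff algebra_simps)
  interpret vector_space ?sc by (rule vs)
  interpret vp: vector_space_pair ?sc ?sc by (intro vector_space_pair.intro vs)
  define \<pi> where "\<pi> = (\<lambda>(c::int \<Rightarrow> complex) m. if \<bar>m\<bar> < int n then c m
      else if \<bar>m\<bar> = int n then (c (int n) + c (- int n)) / 2 else 0)"
  have \<pi>V: "\<pi> c \<in> ?V" for c by (auto simp: \<pi>_def trig_coeffs_def)
  have \<pi>id: "\<pi> c = c" if "c \<in> ?V" for c
  proof
    fix m
    consider "\<bar>m\<bar> < int n" | "m = int n" | "m = - int n" | "\<bar>m\<bar> > int n" by linarith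
    then show "\<pi> c m = c m" by cases (use that in \<open>auto simp: \<pi>_def trig_coeffs_def\<close>)
  qed
  have \<pi>lin: "\<pi> (\<lambda>m. s * c m + t * d m) = (\<lambda>m. s * \<pi> c m + t * \<pi> d m)" for s t c d
    by (auto simp: \<pi>_def fun_eq_iff field_simps)
  have h\<pi>: "h1 (\<pi> c)" for c by (rule trig_coeffs_h1[OF \<pi>V])
  define T' where "T' = (\<lambda>c. T (\<pi> c))"
  have T'lin: "T' (\<lambda>m. s * c m + t * d m) = (\<lambda>m. s * T' c m + t * T' d m)" for s t c d
    unfolding T'_def \<pi>lin by (rule linear_seqD(1)[OF lin h\<pi> h\<pi>])
  have lT': "Vector_Spaces.linear ?sc ?sc T'"
    unfolding Vector_Spaces.linear_iff
  proof (intro conjI allI vs)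
    show "T' (x + z) = T' x + T' z" for x z
      using T'lin[of 1 x 1 z] by (simp add: plus_fun_def)
    show "T' (?sc c x) = ?sc c (T' x)" for c x
      using T'lin[of c x 0 x] by simp
  qed
  have sub: "subspace ?V"
    by (rule subspaceI) (auto simp: trig_coeffs_def)
  define S where "S = (\<lambda>r. \<pi> (\<lambda>m. if m = r then 1 else 0)) ` {- int n..int n}"
  have VS: "?V \<subseteq> span S"
  proof
    fix c assume c: "c \<in> ?V"
    have "c = (\<Sum>r\<in>{- int n..int n}. ?sc (c r) (\<pi> (\<lambda>m. if m = r then 1 else 0)))"
    proof
      fix m
      have p: "\<pi> (\<lambda>m. \<Sum>r\<in>J. c r * (if m = r then 1 else 0)) = (\<lambda>m. \<Sum>r\<in>J. c r * \<pi> (\<lambda>m. if m = r then 1 else 0) m)"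
        if "finite J" for J :: "int set" using that
      proof (induction J rule: finite_induct)
        case empty then show ?case by (auto simp: \<pi>_def)
      next
        case (insert r J)
        then show ?case using \<pi>lin[of "c r" "\<lambda>m. if m = r then 1 else 0" 1 "\<lambda>m. \<Sum>r\<in>J. c r * (if m = r then 1 else 0)"] by simp
      qed
      have "c = (\<lambda>m. \<Sum>r\<in>{- int n..int n}. c r * (if m = r then 1 else 0))"
      proof
        fix x
        have "(\<Sum>r\<in>{- int n..int n}. c r * (if x = r then 1 else 0)) = (\<Sum>r\<in>{- int n..int n}. if r = x then c x else 0)"
          by (rule sum.cong) auto
        also have "\<dots> = (if x \<in> {- int n..int n} then c x else 0)" by (rule sum.delta) simp
        finally show "c x = (\<Sum>r\<in>{- int n..int n}. c r * (if x = r then 1 else 0))"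
          using c by (auto simp: trig_coeffs_def)
      qed
      then have "\<pi> c = \<pi> (\<lambda>m. \<Sum>r\<in>{- int n..int n}. c r * (if m = r then 1 else 0))" by (rule arg_cong)
      also have "\<dots> = (\<lambda>m. \<Sum>r\<in>{- int n..int n}. c r * \<pi> (\<lambda>m. if m = r then 1 else 0) m)" by (rule p) simp
      finally have "c = (\<lambda>m. \<Sum>r\<in>{- int n..int n}. c r * \<pi> (\<lambda>m. if m = r then 1 else 0) m)" unfolding \<pi>id[OF c] .
      from fun_cong[OF this, of m]
      have "c m = (\<Sum>r\<in>{- int n..int n}. c r * \<pi> (\<lambda>m. if m = r then 1 else 0) m)" .
      moreover have "(\<Sum>r\<in>J. ?sc (c r) (f r)) m = (\<Sum>r\<in>J. c r * f r m)" if "finite J" for J and f :: "int \<Rightarrow> int \<Rightarrow> complex"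
        using that by (induction J rule: finite_induct) auto
      ultimately show "c m = (\<Sum>r\<in>{- int n..int n}. ?sc (c r) (\<pi> (\<lambda>m. if m = r then 1 else 0))) m" by (simp only: finite_atLeastAtMost_int)
    qed
    also have "\<dots> \<in> span S"
      by (intro span_sum span_scale span_base) (auto simp: S_def)
    finally show "c \<in> span S" .
  qed
  obtain B where B: "B \<subseteq> ?V" "independent B" "?V \<subseteq> span B"
    using maximal_independent_subset[of ?V] by blast
  have spB: "span B = ?V" using B sub by (metis span_minimal subset_antisym)
  have finS: "finite S" by (simp add: S_def)
  have "B \<subseteq> span S" using B(1) VS by blast
  from independent_span_bound[OF finS B(2) this] have finB: "finite B" by simp
  have T'V: "T' c \<in> ?V" for c unfolding T'_def by (rule maps[OF \<pi>V])
  have injT': "inj_on T' (span B)"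
    unfolding spB
  proof (rule inj_onI)
    fix c d assume cd: "c \<in> ?V" "d \<in> ?V" "T' c = T' d"
    have "(\<lambda>m. c m - d m) \<in> ?V" using cd by (auto simp: trig_coeffs_def)
    moreover have "T (\<lambda>m. c m - d m) m = 0" for m
      using linear_seqD(3)[OF lin trig_coeffs_h1[OF cd(1)] trig_coeffs_h1[OF cd(2)]] cd
      by (simp add: T'_def \<pi>id)
    ultimately have "c m - d m = 0" for m by (rule inj)
    then show "c = d" by (auto simp: fun_eq_iff)
  qed
  have ind: "independent (T' ` B)"
    by (rule vp.linear_independent_injective_image[OF lT' B(2) injT'])
  have "card (T' ` B) = card B"
    using injT' span_superset by (intro card_image) (blast intro: inj_on_subset)
  have "y \<in> span (T' ` B)"
  proof (rule ccontr)
    assume ny: "y \<notin> span (T' ` B)"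
    then have "y \<notin> T' ` B" using span_base by blast
    have "independent (insert y (T' ` B))" using ind ny by (simp add: independent_insert)
    moreover have "insert y (T' ` B) \<subseteq> span B" unfolding spB using y T'V by auto
    ultimately have "card (insert y (T' ` B)) \<le> card B" using independent_span_bound[OF finB] by blast
    then show False using \<open>y \<notin> T' ` B\<close> finB \<open>card (T' ` B) = card B\<close> by simp
  qed
  then have "y \<in> T' ` ?V" using vp.linear_span_image[OF lT', of B] spB by simp
  then obtain c where "c \<in> ?V" "y = T' c" by blast
  then show ?thesis using \<pi>id by (auto simp: T'_def)
qed

section \<open>The integral equation for coefficient sequences\<close>

definition represents :: "((real \<Rightarrow> complex) \<Rightarrow> real \<Rightarrow> complex) \<Rightarrow> ((int \<Rightarrow> complex) \<Rightarrow> int \<Rightarrow> complex) \<Rightarrow> bool" where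
  "represents F T \<longleftrightarrow> (\<forall>a. l1 a \<longrightarrow> l1 (T a) \<and> F (fser a) = fser (T a))"

lemma l1_combine: "l1 a \<Longrightarrow> l1 b \<Longrightarrow> l1 (\<lambda>m. c * a m + d * b m)"
proof -
  assume a: "l1 a" "l1 b"
  have "(\<lambda>m. norm c * norm (a m) + norm d * norm (b m)) summable_on UNIV"
    using a by (intro summable_on_add summable_on_cmult_right)
  then show ?thesis
    by (rule summable_on_comparison_test) (auto intro: norm_triangle_le simp: norm_mult)
qed

lemma fser_combine:
  assumes "l1 a" "l1 b"
  shows "fser (\<lambda>m. c * a m + d * b m) t = c * fser a t + d * fser b t"
proof -
  have "((\<lambda>m. c * (a m * mode m t) + d * (b m * mode m t)) has_sum (c * fser a t + d * fser b t)) UNIV"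
    by (intro has_sum_add has_sum_cmult_right fser_has_sum assms)
  then have "((\<lambda>m. (c * a m + d * b m) * mode m t) has_sum (c * fser a t + d * fser b t)) UNIV"
    by (simp add: algebra_simps)
  then show ?thesis unfolding fser_def by (rule infsumI)
qed

lemma represents_ident: "represents (\<lambda>\<phi>. \<phi>) (\<lambda>a. a)"
  by (simp add: represents_def)

lemma represents_combine:
  assumes "represents F T" "represents G S"
  shows "represents (\<lambda>\<phi> s. c * F \<phi> s + d * G \<phi> s) (\<lambda>a m. c * T a m + d * S a m)"
  using assms by (auto simp: represents_def fser_combine fun_eq_iff intro: l1_combine)

lemma represents_compose:
  assumes "represents F T" "represents G S"
  shows "represents (\<lambda>\<phi>. F (G \<phi>)) (\<lambda>a. T (S a))"
  using assms by (auto simp: represents_def)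

lemma represents_interp: "n \<ge> 1 \<Longrightarrow> represents (trig_interp n) (interp n)"
  by (simp add: represents_def trig_interp_fser l1_interp)

text \<open>The factors \<open>1\<close> make this literally a linear combination of the shape treated by
  \<open>represents_combine\<close>, \<open>smoothing_seq_combine\<close> and \<open>approx_seq_combine\<close>.\<close>

definition split_op :: "((int \<Rightarrow> complex) \<Rightarrow> int \<Rightarrow> complex) \<Rightarrow> (real \<Rightarrow> real) \<Rightarrow> (real \<Rightarrow> real \<Rightarrow> complex) \<Rightarrow>
    (real \<Rightarrow> real \<Rightarrow> complex) \<Rightarrow> (int \<Rightarrow> complex) \<Rightarrow> int \<Rightarrow> complex" where
  "split_op Q \<rho> L1 L2 a m = 1 * ker_op Q (dcoef L1) (multiplier \<rho>) a m + 1 * ker_op Q (dcoef L2) (multiplier w_one) a m"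

lemma represents_disc_split_op:
  assumes "n \<ge> 1" "weight \<rho>" "is_splitting \<rho> L L1 L2"
  shows "represents (disc_split_op n \<rho> L1 L2) (split_op (interp n) \<rho> L1 L2)"
proof -
  have s: "smooth_biperiodic L1" "smooth_biperiodic L2" using assms(3) by (auto simp: is_splitting_def)
  have "represents (disc_op n \<rho> L1) (ker_op (interp n) (dcoef L1) (multiplier \<rho>))"
    "represents (disc_op n w_one L2) (ker_op (interp n) (dcoef L2) (multiplier w_one))"
    using disc_op_fser[OF assms(1)] assms(2) weight_w_one s by (auto simp: represents_def fun_eq_iff)
  from represents_combine[OF this, of 1 1] show ?thesis
    by (simp add: split_op_def[abs_def] disc_split_op_def[abs_def])
qed

text \<open>The splitting is assumed off the diagonal only, but for fixed \<open>t\<close> the diagonal meets the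
  line in countably many points.\<close>

lemma integral_op_splitting:
  assumes spl: "is_splitting \<rho> L L1 L2"
  shows "integral_op L \<phi> t = (LBINT \<tau>:{0..2*pi}. (L1 t \<tau> * of_real (\<rho> (t - \<tau>)) + L2 t \<tau>) * \<phi> \<tau>)"
  unfolding integral_op_def set_lebesgue_integral_def
proof (rule integral_discrete_difference[where X = "{\<tau>. sin ((t - \<tau>) / 2) = 0}"])
  have "{\<tau>. sin ((t - \<tau>) / 2) = 0} \<subseteq> range (\<lambda>i::int. t - 2 * (of_int i * pi))"
  proof
    fix \<tau> assume "\<tau> \<in> {\<tau>. sin ((t - \<tau>) / 2) = 0}"
    then obtain i :: int where "(t - \<tau>) / 2 = of_int i * pi" by (auto simp: sin_zero_iff_int2)
    then have "\<tau> = t - 2 * (of_int i * pi)" by (simp add: field_simps)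
    then show "\<tau> \<in> range (\<lambda>i::int. t - 2 * (of_int i * pi))" by blast
  qed
  then show "countable {\<tau>. sin ((t - \<tau>) / 2) = 0}" by (rule countable_subset) simp
  fix \<tau> assume "\<tau> \<notin> {\<tau>. sin ((t - \<tau>) / 2) = 0}"
  then show "indicat_real {0..2*pi} \<tau> *\<^sub>R (L t \<tau> * \<phi> \<tau>)
     = indicat_real {0..2*pi} \<tau> *\<^sub>R ((L1 t \<tau> * of_real (\<rho> (t - \<tau>)) + L2 t \<tau>) * \<phi> \<tau>)"
    using spl by (simp add: is_splitting_def)
qed auto

lemma weighted_integrable:
  assumes \<rho>: "weight \<rho>" and K: "smooth_biperiodic K" and a: "l1 a"
  shows "set_integrable lborel {0..2*pi} (\<lambda>\<tau>. of_real (\<rho> (t - \<tau>)) * (K t \<tau> * fser a \<tau>))"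
proof -
  obtain C where C: "\<And>t \<tau>. norm (K t \<tau>) \<le> C" using smooth_biperiodic_bounded[OF K] by blast
  have "norm (K t \<tau> * fser a \<tau>) \<le> C * (\<Sum>\<^sub>\<infinity>m. norm (a m))" for \<tau>
    unfolding norm_mult by (intro mult_mono C norm_fser_le a order_trans[OF norm_ge_zero C]) auto
  moreover have "(\<lambda>\<tau>. K t \<tau> * fser a \<tau>) \<in> borel_measurable borel"
    by (intro borel_measurable_continuous_onI continuous_intros smooth_biperiodic_continuous[OF K] continuous_on_fser a)
  ultimately show ?thesis by (intro set_integrable_mult_bounded weight_translate \<rho>)
qed

lemma represents_integral_op:
  assumes \<rho>: "weight \<rho>" and spl: "is_splitting \<rho> L L1 L2"
  shows "represents (integral_op L) (split_op id \<rho> L1 L2)"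
  unfolding represents_def
proof (intro allI impI conjI)
  fix a assume a: "l1 a"
  have s: "smooth_biperiodic L1" "smooth_biperiodic L2" using spl by (auto simp: is_splitting_def)
  note W1 = weighted_integral_op[OF \<rho> s(1) a] and W2 = weighted_integral_op[OF weight_w_one s(2) a]
  show "l1 (split_op id \<rho> L1 L2 a)"
    unfolding split_op_def[abs_def] by (intro l1_combine W1(1) W2(1))
  show "integral_op L (fser a) = fser (split_op id \<rho> L1 L2 a)"
  proof
    fix t
    have "integral_op L (fser a) t = (LBINT \<tau>:{0..2*pi}. of_real (\<rho> (t - \<tau>)) * (L1 t \<tau> * fser a \<tau>)
        + of_real (w_one (t - \<tau>)) * (L2 t \<tau> * fser a \<tau>))"
      unfolding integral_op_splitting[OF spl] by (simp add: w_one_def algebra_simps)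
    also have "\<dots> = fser (ker_op id (dcoef L1) (multiplier \<rho>) a) t + fser (ker_op id (dcoef L2) (multiplier w_one) a) t"
      by (subst set_integral_add(2)[OF weighted_integrable[OF \<rho> s(1) a] weighted_integrable[OF weight_w_one s(2) a]])
         (simp only: W1(2) W2(2))
    also have "\<dots> = fser (split_op id \<rho> L1 L2 a) t"
      unfolding split_op_def[abs_def] fser_combine[OF W1(1) W2(1)] by simp
    finally show "integral_op L (fser a) t = fser (split_op id \<rho> L1 L2 a) t" .
  qed
qed

lemma integral_op_cong_AE:
  assumes \<rho>: "\<rho> \<in> borel_measurable borel" and spl: "is_splitting \<rho> L L1 L2"
    and m: "\<phi> \<in> borel_measurable borel" "\<psi> \<in> borel_measurable borel"
    and ae: "AE \<tau> in lborel. \<tau> \<in> {0..2*pi} \<longrightarrow> \<phi> \<tau> = \<psi> \<tau>"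
  shows "integral_op L \<phi> = integral_op L \<psi>"
proof
  fix t
  have s: "smooth_biperiodic L1" "smooth_biperiodic L2" using spl by (auto simp: is_splitting_def)
  have [measurable]: "L1 t \<in> borel_measurable borel" "L2 t \<in> borel_measurable borel"
    by (intro borel_measurable_continuous_onI smooth_biperiodic_continuous s)+
  note [measurable] = \<rho> m
  show "integral_op L \<phi> t = integral_op L \<psi> t"
    unfolding integral_op_splitting[OF spl]
  proof (rule set_lebesgue_integral_cong_AE)
    show "AE \<tau>\<in>{0..2*pi} in lborel. (L1 t \<tau> * of_real (\<rho> (t - \<tau>)) + L2 t \<tau>) * \<phi> \<tau>
      = (L1 t \<tau> * of_real (\<rho> (t - \<tau>)) + L2 t \<tau>) * \<psi> \<tau>"
      using ae by eventually_elim auto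
  qed measurable
qed

lemma smoothing_split_op:
  assumes "order_one_multiplier (multiplier \<rho>)" "is_splitting \<rho> L L1 L2"
  shows "smoothing_seq (split_op id \<rho> L1 L2)"
proof -
  have s: "smooth_biperiodic L1" "smooth_biperiodic L2" using assms(2) by (auto simp: is_splitting_def)
  show ?thesis unfolding split_op_def[abs_def]
    by (intro smoothing_seq_combine smoothing_ker_op rapid_dcoef s assms(1) order_one_w_one)
qed

lemma approx_split_op:
  assumes "order_one_multiplier (multiplier \<rho>)" "is_splitting \<rho> L L1 L2"
  shows "approx_seq (split_op id \<rho> L1 L2) (\<lambda>n. split_op (interp n) \<rho> L1 L2)"
proof -
  have s: "smooth_biperiodic L1" "smooth_biperiodic L2" using assms(2) by (auto simp: is_splitting_def)
  show ?thesis unfolding split_op_def[abs_def]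
    by (intro approx_seq_combine approx_ker_op rapid_dcoef s assms(1) order_one_w_one)
qed

type_synonym seq_op = "(int \<Rightarrow> complex) \<Rightarrow> int \<Rightarrow> complex"

text \<open>The left-hand side of the equation without its multiple of the identity. As in \<open>split_op\<close>,
  every sum is written as a combination \<open>c * _ + d * _\<close> of two terms.\<close>

definition scfie_seq :: "real \<Rightarrow> real \<Rightarrow> seq_op \<Rightarrow> (nat \<Rightarrow> seq_op) \<Rightarrow> (nat \<Rightarrow> seq_op) \<Rightarrow> (nat \<Rightarrow> seq_op) \<Rightarrow> (nat \<Rightarrow> seq_op) \<Rightarrow> seq_op" where
  "scfie_seq \<nu> \<eta> P S K KT R a m =
     (- 1) * P (KT 2 (\<lambda>i. of_real \<nu> * a i + (- 2) * KT 2 a i)) m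
     + 1 * (- of_real \<nu> * P (KT 1 (\<lambda>i. 1 * a i + 2 * KT 2 a i)) m
     + 1 * (2 * P (\<lambda>i. 1 * R 1 (S 2 a) i + (- 1) * R 2 (S 2 a) i) m
     + 1 * (\<i> * of_real \<eta> * of_real \<nu> * P (S 1 (\<lambda>i. 1 * a i + 2 * KT 2 a i)) m
     + \<i> * of_real \<eta> * P (\<lambda>i. 1 * S 2 a i + (- 2) * K 1 (S 2 a) i) m)))"

lemma represents_scfie:
  assumes P: "represents Q P" and S: "\<And>j. j \<in> {1, 2} \<Longrightarrow> represents (S j) (S' j)"
    and K: "\<And>j. j \<in> {1, 2} \<Longrightarrow> represents (K j) (K' j)" and KT: "\<And>j. j \<in> {1, 2} \<Longrightarrow> represents (KT j) (KT' j)"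
    and R: "\<And>j. j \<in> {1, 2} \<Longrightarrow> represents (R j) (R' j)"
  shows "represents (scfie_lhs \<nu> \<eta> Q S K KT R)
     (\<lambda>a m. - of_real ((1 + \<nu>) / 2) * a m + 1 * scfie_seq \<nu> \<eta> P S' K' KT' R' a m)"
proof -
  have j: "(1::nat) \<in> {1, 2}" "(2::nat) \<in> {1, 2}" by auto
  note J = S[OF j(1)] S[OF j(2)] K[OF j(1)] KT[OF j(1)] KT[OF j(2)] R[OF j(1)] R[OF j(2)]
  note i1 = represents_combine[OF represents_ident KT[OF j(2)], of "of_real \<nu>" "- 2"]
  note i2 = represents_combine[OF represents_ident KT[OF j(2)], of 1 2]
  note t1 = represents_compose[OF P represents_compose[OF KT[OF j(2)] i1]]
  note t2 = represents_compose[OF P represents_compose[OF KT[OF j(1)] i2]]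
  note t3 = represents_compose[OF P represents_combine[OF represents_compose[OF R[OF j(1)] S[OF j(2)]]
        represents_compose[OF R[OF j(2)] S[OF j(2)]], of 1 "- 1"]]
  note t4 = represents_compose[OF P represents_compose[OF S[OF j(1)] i2]]
  note t5 = represents_compose[OF P represents_combine[OF S[OF j(2)] represents_compose[OF K[OF j(1)] S[OF j(2)]], of 1 "- 2"]]
  note all = represents_combine[OF represents_ident represents_combine[OF t1 represents_combine[OF t2
      represents_combine[OF t3 represents_combine[OF t4 t5, of "\<i> * of_real \<eta> * of_real \<nu>" "\<i> * of_real \<eta>"], of 2 1], of "- of_real \<nu>" 1],
      of "- 1" 1], of "- of_real ((1 + \<nu>) / 2)" 1]
  have lhs: "scfie_lhs \<nu> \<eta> Q S K KT R = (\<lambda>\<phi> s. - of_real ((1 + \<nu>) / 2) * \<phi> s + 1 *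
     ((- 1) * Q (KT 2 (\<lambda>i. of_real \<nu> * \<phi> i + (- 2) * KT 2 \<phi> i)) s
     + 1 * (- of_real \<nu> * Q (KT 1 (\<lambda>i. 1 * \<phi> i + 2 * KT 2 \<phi> i)) s
     + 1 * (2 * Q (\<lambda>i. 1 * R 1 (S 2 \<phi>) i + (- 1) * R 2 (S 2 \<phi>) i) s
     + 1 * (\<i> * of_real \<eta> * of_real \<nu> * Q (S 1 (\<lambda>i. 1 * \<phi> i + 2 * KT 2 \<phi> i)) s
     + \<i> * of_real \<eta> * Q (\<lambda>i. 1 * S 2 \<phi> i + (- 2) * K 1 (S 2 \<phi>) i) s)))))"
    by (simp add: scfie_lhs_def fun_eq_iff)
  show ?thesis unfolding lhs scfie_seq_def[abs_def] by (rule all)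
qed

lemma approx_scfie_seq:
  assumes S: "\<And>j. j \<in> {1, 2} \<Longrightarrow> approx_seq (S j) (\<lambda>n. Sn n j)"
    and K: "\<And>j. j \<in> {1, 2} \<Longrightarrow> approx_seq (K j) (\<lambda>n. Kn n j)" and KT: "\<And>j. j \<in> {1, 2} \<Longrightarrow> approx_seq (KT j) (\<lambda>n. KTn n j)"
    and R: "\<And>j. j \<in> {1, 2} \<Longrightarrow> approx_seq (R j) (\<lambda>n. Rn n j)"
  shows "approx_seq (scfie_seq \<nu> \<eta> (\<lambda>a. a) S K KT R) (\<lambda>n. scfie_seq \<nu> \<eta> (\<lambda>a. a) (Sn n) (Kn n) (KTn n) (Rn n))"
proof -
  have j: "(1::nat) \<in> {1, 2}" "(2::nat) \<in> {1, 2}" by auto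
  note i1 = approx_seq_combine[OF approx_seq_id KT[OF j(2)], of "of_real \<nu>" "- 2"]
  note i2 = approx_seq_combine[OF approx_seq_id KT[OF j(2)], of 1 2]
  note t1 = approx_seq_compose[OF KT[OF j(2)] i1]
  note t2 = approx_seq_compose[OF KT[OF j(1)] i2]
  note t3 = approx_seq_combine[OF approx_seq_compose[OF R[OF j(1)] S[OF j(2)]]
        approx_seq_compose[OF R[OF j(2)] S[OF j(2)]], of 1 "- 1"]
  note t4 = approx_seq_compose[OF S[OF j(1)] i2]
  note t5 = approx_seq_combine[OF S[OF j(2)] approx_seq_compose[OF K[OF j(1)] S[OF j(2)]], of 1 "- 2"]
  note all = approx_seq_combine[OF t1 approx_seq_combine[OF t2
      approx_seq_combine[OF t3 approx_seq_combine[OF t4 t5, of "\<i> * of_real \<eta> * of_real \<nu>" "\<i> * of_real \<eta>"], of 2 1], of "- of_real \<nu>" 1],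
      of "- 1" 1]
  show ?thesis unfolding scfie_seq_def[abs_def] by (rule all)
qed

lemma smoothing_scfie_seq:
  assumes S: "\<And>j. j \<in> {1, 2} \<Longrightarrow> smoothing_seq (S j)"
    and K: "\<And>j. j \<in> {1, 2} \<Longrightarrow> smoothing_seq (K j)" and KT: "\<And>j. j \<in> {1, 2} \<Longrightarrow> smoothing_seq (KT j)"
    and R: "\<And>j. j \<in> {1, 2} \<Longrightarrow> smoothing_seq (R j)"
  shows "smoothing_seq (scfie_seq \<nu> \<eta> (\<lambda>a. a) S K KT R)"
proof -
  have j: "(1::nat) \<in> {1, 2}" "(2::nat) \<in> {1, 2}" by auto
  have bid: "bounded_seq (\<lambda>a. a)" using approx_seq_id by (simp add: approx_seq_def)
  note b = smoothing_imp_bounded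
  note i1 = bounded_seq_combine[OF bid b[OF KT[OF j(2)]], of "of_real \<nu>" "- 2"]
  note i2 = bounded_seq_combine[OF bid b[OF KT[OF j(2)]], of 1 2]
  note t1 = smoothing_seq_compose[OF KT[OF j(2)] i1]
  note t2 = smoothing_seq_compose[OF KT[OF j(1)] i2]
  note t3 = smoothing_seq_combine[OF smoothing_seq_compose[OF R[OF j(1)] b[OF S[OF j(2)]]]
        smoothing_seq_compose[OF R[OF j(2)] b[OF S[OF j(2)]]], of 1 "- 1"]
  note t4 = smoothing_seq_compose[OF S[OF j(1)] i2]
  note t5 = smoothing_seq_combine[OF S[OF j(2)] smoothing_seq_compose[OF K[OF j(1)] b[OF S[OF j(2)]]], of 1 "- 2"]
  note all = smoothing_seq_combine[OF t1 smoothing_seq_combine[OF t2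
      smoothing_seq_combine[OF t3 smoothing_seq_combine[OF t4 t5, of "\<i> * of_real \<eta> * of_real \<nu>" "\<i> * of_real \<eta>"], of 2 1], of "- of_real \<nu>" 1],
      of "- 1" 1]
  show ?thesis unfolding scfie_seq_def[abs_def] by (rule all)
qed

text \<open>Interpolation is linear and stands in front of every term, hence can be pulled out of the
  whole sum.\<close>

lemma scfie_seq_interp:
  assumes lin: "\<And>j. j \<in> {1, 2} \<Longrightarrow> linear_seq (S j)" "\<And>j. j \<in> {1, 2} \<Longrightarrow> linear_seq (K j)"
    "\<And>j. j \<in> {1, 2} \<Longrightarrow> linear_seq (KT j)" "\<And>j. j \<in> {1, 2} \<Longrightarrow> linear_seq (R j)"
    and a: "h1 a"
  shows "scfie_seq \<nu> \<eta> (interp n) S K KT R a = interp n (scfie_seq \<nu> \<eta> (\<lambda>a. a) S K KT R a)"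
proof -
  have maps: "h1 (S 1 b)" "h1 (S 2 b)" "h1 (K 1 b)" "h1 (KT 1 b)" "h1 (KT 2 b)" "h1 (R 1 b)" "h1 (R 2 b)" if "h1 b" for b
    using lin that by (auto simp: linear_seq_def)
  have comb: "h1 (\<lambda>m. c * b m + d * b' m)" if "h1 b" "h1 b'" for b b' c d
    using that by (intro h1_add h1_scale)
  show ?thesis unfolding scfie_seq_def[abs_def]
    by (subst interp_linear, (intro h1_l1 comb maps a)+)+ (rule refl)
qed

section \<open>From functions to coefficient sequences\<close>

lemma fourier_coeff_cong_AE:
  assumes m: "f \<in> borel_measurable borel" "g \<in> borel_measurable borel"
    and ae: "AE t in lborel. t \<in> {0..2*pi} \<longrightarrow> f t = g t"
  shows "fourier_coeff f k = fourier_coeff g k"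
  unfolding fourier_coeff_alt
proof (rule arg_cong[where f = "\<lambda>z. 1 / (2 * of_real pi) * z"], rule set_lebesgue_integral_cong_AE)
  note [measurable] = m
  show "(\<lambda>t. f t * mode (- k) t) \<in> borel_measurable lborel" "(\<lambda>t. g t * mode (- k) t) \<in> borel_measurable lborel"
    by measurable
  show "AE t\<in>{0..2*pi} in lborel. f t * mode (- k) t = g t * mode (- k) t"
    using ae by eventually_elim auto
qed simp

lemma borel_measurable_fser: "l1 a \<Longrightarrow> fser a \<in> borel_measurable borel"
  by (intro borel_measurable_continuous_onI continuous_on_fser)

lemma fser_in_sobolev_0:
  assumes a: "h1 a" shows "fser a \<in> sobolev 0"
proof -
  have l: "l1 a" by (rule h1_l1[OF a])
  obtain X where "sob_le 1 a X" using a by (auto simp: h1_def)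
  then have s: "sob_le 0 a X" by (rule sob_le_mono_exponent) simp
  have "set_integrable lborel {0..2*pi} (\<lambda>t. (cmod (fser a t))\<^sup>2)"
    by (intro borel_integrable_atLeastAtMost' continuous_intros continuous_on_fser l)
  moreover have "(\<lambda>m. sobw 0 m * (cmod (fourier_coeff (fser a) m))\<^sup>2) summable_on UNIV"
    using sob_le_summable(1)[OF s] by (simp add: fourier_coeff_fser[OF l])
  ultimately show ?thesis
    using borel_measurable_fser[OF l] periodic_fser by (simp add: sobolev_def sobw_def)
qed

lemma sobolev_integrable:
  assumes "\<psi> \<in> sobolev p" shows "set_integrable lborel {0..2*pi} \<psi>"
proof (rule set_integrable_bound)
  have sq: "set_integrable lborel {0..2*pi} (\<lambda>t. (cmod (\<psi> t))\<^sup>2)" using assms by (simp add: sobolev_def)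
  have "set_integrable lborel {0..2*pi} (\<lambda>t. 1 :: real)"
    by (intro borel_integrable_atLeastAtMost' continuous_intros)
  then show "set_integrable lborel {0..2*pi} (\<lambda>t. 1 + (cmod (\<psi> t))\<^sup>2)" using sq by (rule set_integral_add(1))
  have [measurable]: "\<psi> \<in> borel_measurable borel" using assms by (simp add: sobolev_def)
  show "set_borel_measurable lborel {0..2*pi} \<psi>" unfolding set_borel_measurable_def by measurable
  have "x \<le> 1 + x\<^sup>2" for x :: real
  proof -
    have "0 \<le> (x - 1 / 2)\<^sup>2 + 3 / 4" by simp
    then show ?thesis by (simp add: power2_eq_square algebra_simps)
  qed
  then show "AE t in lborel. t \<in> {0..2*pi} \<longrightarrow> norm (\<psi> t) \<le> norm (1 + (cmod (\<psi> t))\<^sup>2)"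
    by (intro AE_I2) simp
qed

lemma sobolev_sob_le:
  assumes "\<psi> \<in> sobolev p" shows "sob_le p (fourier_coeff \<psi>) ((sobolev_norm p \<psi>)\<^sup>2)"
proof -
  have s: "(\<lambda>m. sobw p m * (cmod (fourier_coeff \<psi> m))\<^sup>2) summable_on UNIV"
    using assms by (simp add: sobolev_def sobw_def)
  have "(sobolev_norm p \<psi>)\<^sup>2 = (\<Sum>\<^sub>\<infinity>m. sobw p m * (cmod (fourier_coeff \<psi> m))\<^sup>2)"
    by (simp add: sobolev_norm_def sobw_def infsum_nonneg)
  then show ?thesis using sob_le_of_summable[OF s] by simp
qed

lemma sobolev_AE_fser:
  assumes \<psi>: "\<psi> \<in> sobolev p" and p: "p \<ge> 1"
  shows "h1 (fourier_coeff \<psi>)" "AE t in lborel. t \<in> {0..2*pi} \<longrightarrow> \<psi> t = fser (fourier_coeff \<psi>) t"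
proof -
  show h: "h1 (fourier_coeff \<psi>)" by (rule h1I[OF sobolev_sob_le[OF \<psi>] p])
  show "AE t in lborel. t \<in> {0..2*pi} \<longrightarrow> \<psi> t = fser (fourier_coeff \<psi>) t"
    by (rule AE_eq_fser[OF sobolev_integrable[OF \<psi>] h1_l1[OF h] refl])
qed

text \<open>All \<open>2 * n\<close> nodes lie in the basic period.\<close>

lemma dft_cong: "(\<And>t. t \<in> {0..2*pi} \<Longrightarrow> f t = g t) \<Longrightarrow> n \<ge> 1 \<Longrightarrow> dft n f = dft n g"
proof -
  assume fg: "\<And>t. t \<in> {0..2*pi} \<Longrightarrow> f t = g t" and n: "n \<ge> 1"
  have "f (node n j) = g (node n j)" if "j < 2 * n" for j
  proof (rule fg)
    have "real j \<le> 2 * real n" using that by linarith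
    then have "real j * pi \<le> 2 * real n * pi" by (intro mult_right_mono) auto
    then show "node n j \<in> {0..2*pi}" using n by (simp add: node_def divide_le_eq mult_ac)
  qed
  then show ?thesis by (simp add: dft_def fun_eq_iff)
qed

lemma dft_combine: "dft n (\<lambda>t. c * f t + d * g t) = (\<lambda>m. c * dft n f m + d * dft n g m)"
  by (simp add: dft_def fun_eq_iff sum_distrib_left sum.distrib algebra_simps)

lemma regular_closed_param_speed_continuous:
  assumes "regular_closed_param x" shows "continuous_on UNIV (speed x)"
proof -
  have s: "smooth x" using assms by (simp add: regular_closed_param_def)
  have d: "vector_derivative x (at t) = frechet_derivative x (at t) 1" for t
  proof -
    have hd: "(x has_derivative frechet_derivative x (at t)) (at t)" by (rule smooth_has_derivative[OF s])
    interpret bounded_linear "frechet_derivative x (at t)" using hd by (rule has_derivative_bounded_linear)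
    have e: "frechet_derivative x (at t) = (\<lambda>h. h *\<^sub>R frechet_derivative x (at t) 1)"
    proof
      fix h show "frechet_derivative x (at t) h = h *\<^sub>R frechet_derivative x (at t) 1"
        using scaleR[of h 1] by simp
    qed
    have "(x has_derivative (\<lambda>h. h *\<^sub>R frechet_derivative x (at t) 1)) (at t)"
      by (rule subst[OF e], rule hd)
    then have "(x has_vector_derivative frechet_derivative x (at t) 1) (at t)"
      unfolding has_vector_derivative_def .
    then show ?thesis by (rule vector_derivative_at)
  qed
  show ?thesis unfolding d
    by (intro continuous_intros smooth_continuous smooth_directional s)
qed

text \<open>Continuity of the data is what allows the equation, which holds almost everywhere, to be
  evaluated at the nodes.\<close>

lemma incident_data_continuous:
  assumes "regular_closed_param x" "incident_field x nv k u"
  shows "continuous_on UNIV (\<lambda>t. - data_g x nv u t + \<i> * of_real \<eta> * data_f x u t)"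
  using assms(2) unfolding incident_field_def data_f_def data_g_def
  by (auto intro!: continuous_intros regular_closed_param_speed_continuous[OF assms(1)])

section \<open>Unique solvability and convergence\<close>

theorem theorem3p8:
  fixes x nv :: "real \<Rightarrow> real^2"
    and \<omega> \<nu> \<eta> :: real
    and \<epsilon> k :: "nat \<Rightarrow> real"
    and M H HT D :: "nat \<Rightarrow> nat \<Rightarrow> real \<Rightarrow> real \<Rightarrow> complex"
  assumes curve: "regular_closed_param x"
    and normal: "exterior_unit_normal x nv"
    and omega: "\<omega> > 0"
    and eps: "\<epsilon> 1 > 0" "\<epsilon> 2 > 0"
    and k_def: "\<And>j. j \<in> {1, 2} \<Longrightarrow> k j = \<omega> * sqrt (\<epsilon> j)"
    and nu: "\<nu> \<in> {1, \<epsilon> 1 / \<epsilon> 2}"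
    and eta: "\<eta> \<noteq> 0"
    and split_M: "\<And>j. j \<in> {1, 2} \<Longrightarrow>
      is_splitting w_log (kernel_M x (k j)) (M j 1) (M j 2)"
    and split_H: "\<And>j. j \<in> {1, 2} \<Longrightarrow>
      is_splitting w_log (kernel_H x nv (k j)) (H j 1) (H j 2)"
    and split_HT: "\<And>j. j \<in> {1, 2} \<Longrightarrow>
      is_splitting w_sin2log (kernel_HT x nv (k j)) (HT j 1) (HT j 2)"
    and split_D: "\<And>j. j \<in> {1, 2} \<Longrightarrow>
      is_splitting w_log (kernel_D x (k j)) (D j 1) (D j 2)"
    and solvable: "scfie_uniquely_solvable x nv k \<nu> \<eta>"
  shows "(\<forall>\<^sub>F n in sequentially. \<forall>u. incident_field x nv (k 1) u \<longrightarrow>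
            (\<exists>!\<psi>\<^sub>n. solves_nystrom n \<nu> \<eta> M H HT D (data_f x u) (data_g x nv u) \<psi>\<^sub>n)) \<and>
         (\<forall>p q :: real. p \<ge> 1 \<longrightarrow> q \<ge> 0 \<longrightarrow>
            (\<exists>C. \<forall>\<^sub>F n in sequentially. \<forall>u \<psi> \<psi>\<^sub>n.
               incident_field x nv (k 1) u \<longrightarrow>
               solves_scfie x nv k \<nu> \<eta>
                 (\<lambda>t. - data_g x nv u t + \<i> * of_real \<eta> * data_f x u t) \<psi> \<longrightarrow>
               \<psi> \<in> sobolev (p + q) \<longrightarrow>
               solves_nystrom n \<nu> \<eta> M H HT D (data_f x u) (data_g x nv u) \<psi>\<^sub>n \<longrightarrow>
               sobolev_norm p (\<lambda>t. \<psi>\<^sub>n t - \<psi> t)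
                 \<le> C * real n powr (- q) * sobolev_norm (p + q) \<psi>))"
proof -
  let ?c0 = "- of_real ((1 + \<nu>) / 2) :: complex"
  define S where "S = (\<lambda>Q j. split_op Q w_log (M j 1) (M j 2))"
  define K where "K = (\<lambda>Q j. split_op Q w_log (H j 1) (H j 2))"
  define KT where "KT = (\<lambda>Q j. split_op Q w_sin2log (HT j 1) (HT j 2))"
  define R where "R = (\<lambda>Q j. split_op Q w_log (D j 1) (D j 2))"
  define B where "B = scfie_seq \<nu> \<eta> (\<lambda>a. a) (S id) (K id) (KT id) (R id)"
  define Bn where "Bn = (\<lambda>n. scfie_seq \<nu> \<eta> (\<lambda>a. a) (S (interp n)) (K (interp n)) (KT (interp n)) (R (interp n)))"
  define A where "A = (\<lambda>a m. ?c0 * a m + 1 * B a m)"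
  define An where "An = (\<lambda>n a m. ?c0 * a m + 1 * interp n (Bn n a) m)"

  have "\<nu> > 0" using nu eps by auto
  then have "1 + \<nu> \<noteq> 0" by linarith
  then have "complex_of_real (1 + \<nu>) \<noteq> 0" by (simp only: of_real_eq_0_iff) simp
  then have c0: "?c0 \<noteq> 0" by simp

  have apS: "approx_seq (S id j) (\<lambda>n. S (interp n) j)" "smoothing_seq (S id j)"
    and apK: "approx_seq (K id j) (\<lambda>n. K (interp n) j)" "smoothing_seq (K id j)"
    and apKT: "approx_seq (KT id j) (\<lambda>n. KT (interp n) j)" "smoothing_seq (KT id j)"
    and apR: "approx_seq (R id j) (\<lambda>n. R (interp n) j)" "smoothing_seq (R id j)"
    if j: "j \<in> {1, 2}" for j
    unfolding S_def K_def KT_def R_def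
    by (rule approx_split_op smoothing_split_op, rule order_one_w_log order_one_w_sin2log,
        rule split_M[OF j] split_H[OF j] split_HT[OF j] split_D[OF j])+
  have apB: "approx_seq B Bn" unfolding B_def Bn_def
    by (rule approx_scfie_seq) (rule apS(1) apK(1) apKT(1) apR(1), assumption)+
  have smB: "smoothing_seq B" unfolding B_def
    by (rule smoothing_scfie_seq) (rule apS(2) apK(2) apKT(2) apR(2), assumption)+
  have linB: "linear_seq B" and linBn: "\<And>n. n \<ge> 1 \<Longrightarrow> linear_seq (Bn n)"
    using apB by (auto simp: approx_seq_def)
  have linA: "linear_seq A" unfolding A_def by (rule linear_seq_combine[OF linear_seq_id linB])
  have linAn: "linear_seq (An n)" if n: "n \<ge> 1" for n
  proof -
    obtain P where P: "\<And>a X. sob_le 1 a X \<Longrightarrow> sob_le 1 (interp n a) (P * X)"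
      using sob_le_interp[of 1] n by auto
    have "linear_seq (interp n)"
      unfolding linear_seq_def using P by (auto simp: h1_def intro!: interp_linear sob_le_l1[of 1])
    from linear_seq_combine[OF linear_seq_id linear_seq_compose[OF this linBn[OF n]]] show ?thesis
      unfolding An_def .
  qed

  have repS: "represents (integral_op (kernel_M x (k j))) (S id j)"
    and repK: "represents (integral_op (kernel_H x nv (k j))) (K id j)"
    and repKT: "represents (integral_op (kernel_HT x nv (k j))) (KT id j)"
    and repR: "represents (integral_op (kernel_D x (k j))) (R id j)"
    if j: "j \<in> {1, 2}" for j
    unfolding S_def K_def KT_def R_def
    by (rule represents_integral_op, rule weight_w_log weight_w_sin2log,
        rule split_M[OF j] split_H[OF j] split_HT[OF j] split_D[OF j])+
  have repA: "represents (scfie_op x nv k \<nu> \<eta>) A"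
    unfolding scfie_op_def A_def B_def
    by (rule represents_scfie) (simp add: represents_def, (rule repS repK repKT repR, assumption)+)
  have repAn: "represents (scfie_disc_op n \<nu> \<eta> M H HT D)
      (\<lambda>a m. ?c0 * a m + 1 * scfie_seq \<nu> \<eta> (interp n) (S (interp n)) (K (interp n)) (KT (interp n)) (R (interp n)) a m)"
    if n: "n \<ge> 1" for n
    unfolding scfie_disc_op_def S_def K_def KT_def R_def
    by (rule represents_scfie, rule represents_interp[OF n])
       (rule represents_disc_split_op[OF n], rule weight_w_log weight_w_sin2log,
        rule split_M split_H split_HT split_D, assumption)+
  have disc: "scfie_disc_op n \<nu> \<eta> M H HT D (fser a) = fser (An n a)" "l1 (An n a)" if n: "n \<ge> 1" and a: "h1 a" for n a
  proof -
    have "scfie_seq \<nu> \<eta> (interp n) (S (interp n)) (K (interp n)) (KT (interp n)) (R (interp n)) a = interp n (Bn n a)"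
      unfolding Bn_def using apS(1) apK(1) apKT(1) apR(1) n
      by (intro scfie_seq_interp a) (auto simp: approx_seq_def)
    then show "scfie_disc_op n \<nu> \<eta> M H HT D (fser a) = fser (An n a)" "l1 (An n a)"
      using repAn[OF n] h1_l1[OF a] by (auto simp: represents_def An_def)
  qed

  \<comment> \<open>both \<open>a\<close> and the zero sequence yield solutions for zero data\<close>
  have inj: "a m = 0" if a: "h1 a" and z: "\<And>m. ?c0 * a m + B a m = 0" for a m
  proof -
    have sol: "solves_scfie x nv k \<nu> \<eta> (\<lambda>_. 0) (fser (\<lambda>m. c * a m))" for c
    proof -
      have ca: "h1 (\<lambda>m. c * a m)" by (rule h1_scale[OF a])
      have "A (\<lambda>m. c * a m) = (\<lambda>m. 0)"
      proof -
        have "A a m = 0" for m using z[of m] by (simp only: A_def mult_1)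
        then show ?thesis unfolding linear_seqD(5)[OF linA a a] by simp
      qed
      then have "scfie_op x nv k \<nu> \<eta> (fser (\<lambda>m. c * a m)) t = 0" for t
        using repA h1_l1[OF ca] by (simp add: represents_def fser_def)
      then show ?thesis using fser_in_sobolev_0[OF ca] by (simp add: solves_scfie_def)
    qed
    have "(\<lambda>_. 0) \<in> sobolev 0"
      using fser_in_sobolev_0[OF h1_scale[OF a, of 0]] by (simp add: fser_def[abs_def])
    then obtain \<psi> where \<psi>: "\<And>\<psi>'. solves_scfie x nv k \<nu> \<eta> (\<lambda>_. 0) \<psi>' \<Longrightarrow> AE t in lborel. \<psi>' t = \<psi> t"
      using solvable unfolding scfie_uniquely_solvable_def by blast
    have "AE t in lborel. t \<in> {0..2*pi} \<longrightarrow> fser (\<lambda>m. 1 * a m) t = fser (\<lambda>m. 0 * a m) t"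
      using \<psi>[OF sol[of 1]] \<psi>[OF sol[of 0]] by eventually_elim simp
    from fourier_coeff_cong_AE[OF _ _ this, of m]
    have "fourier_coeff (fser (\<lambda>m. 1 * a m)) m = fourier_coeff (fser (\<lambda>m. 0 * a m)) m"
      by (simp only: borel_measurable_fser h1_l1 h1_scale a)
    then show ?thesis
      using h1_l1[OF a] by (simp add: fourier_coeff_fser)
  qed

  have stable: "\<exists>C\<ge>0. \<exists>N\<ge>1. \<forall>n\<ge>N. \<forall>a X Y. sob_le p a X \<longrightarrow> sob_le p (An n a) Y \<longrightarrow> sob_le p a (C * Y)"
    if p: "p \<ge> 1" for p
  proof -
    have "\<exists>C\<ge>0. \<forall>a X Y. sob_le p a X \<longrightarrow> sob_le p (\<lambda>m. ?c0 * a m + B a m) Y \<longrightarrow> sob_le p a (C * Y)"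
      by (rule second_kind_coercive[OF c0 linB smB _ p]) (rule inj)
    then obtain C where C: "C \<ge> 0" "\<And>a X Y. sob_le p a X \<Longrightarrow> sob_le p (\<lambda>m. ?c0 * a m + B a m) Y \<Longrightarrow> sob_le p a (C * Y)"
      by blast
    have "\<exists>N\<ge>1. \<forall>n\<ge>N. \<forall>a X Y. sob_le p a X \<longrightarrow>
        sob_le p (\<lambda>m. ?c0 * a m + interp n (Bn n a) m) Y \<longrightarrow> sob_le p a (4 * C * Y)"
      by (rule nystrom_stability[OF apB smB p C(1)]) (rule C(2))
    then show ?thesis
      using C(1) by (intro exI[of _ "4 * C"] conjI) (simp_all only: An_def mult_1 zero_le_mult_iff zero_le_numeral simp_thms)
  qed

  have rhs: "(\<lambda>t. - trig_interp n g t + \<i> * of_real \<eta> * trig_interp n f t)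
      = fser (dft n (\<lambda>t. - g t + \<i> * of_real \<eta> * f t))" if n: "n \<ge> 1" for n f g
  proof -
    have l: "l1 (dft n h)" for h
      by (rule h1_l1[OF trig_coeffs_h1[OF dft_in_trig_coeffs[OF n]]])
    have "dft n (\<lambda>t. (- 1) * g t + \<i> * of_real \<eta> * f t) = (\<lambda>m. (- 1) * dft n g m + \<i> * of_real \<eta> * dft n f m)"
      by (rule dft_combine)
    moreover have "(\<lambda>t. - g t + \<i> * of_real \<eta> * f t) = (\<lambda>t. (- 1) * g t + \<i> * of_real \<eta> * f t)"
      by simp
    ultimately have "fser (dft n (\<lambda>t. - g t + \<i> * of_real \<eta> * f t)) t
        = (- 1) * fser (dft n g) t + \<i> * of_real \<eta> * fser (dft n f) t" for t
      using fser_combine[OF l l] by (simp only:)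
    then show ?thesis by (simp add: trig_interp_eq[OF n] fun_eq_iff)
  qed
  have nys: "solves_nystrom n \<nu> \<eta> M H HT D f g \<psi> \<longleftrightarrow>
      (\<exists>b\<in>trig_coeffs n. \<psi> = fser b \<and> An n b = dft n (\<lambda>t. - g t + \<i> * of_real \<eta> * f t))" if n: "n \<ge> 1" for n f g \<psi>
  proof -
    let ?r = "dft n (\<lambda>t. - g t + \<i> * of_real \<eta> * f t)"
    have l: "l1 ?r" by (rule h1_l1[OF trig_coeffs_h1[OF dft_in_trig_coeffs[OF n]]])
    have eq: "(\<forall>t. scfie_disc_op n \<nu> \<eta> M H HT D (fser b) t = - trig_interp n g t + \<i> * of_real \<eta> * trig_interp n f t)
        \<longleftrightarrow> An n b = ?r" if b: "b \<in> trig_coeffs n" for b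
    proof -
      have hb: "h1 b" by (rule trig_coeffs_h1[OF b])
      have "(\<forall>t. scfie_disc_op n \<nu> \<eta> M H HT D (fser b) t = - trig_interp n g t + \<i> * of_real \<eta> * trig_interp n f t)
        \<longleftrightarrow> fser (An n b) = fser ?r"
        unfolding disc(1)[OF n hb] rhs[OF n, symmetric] by (simp add: fun_eq_iff)
      also have "\<dots> \<longleftrightarrow> An n b = ?r"
        using fourier_coeff_fser[OF disc(2)[OF n hb]] fourier_coeff_fser[OF l] by (metis ext)
      finally show ?thesis .
    qed
    show ?thesis unfolding solves_nystrom_def trig_space_eq[OF n] using eq by auto
  qed

  show ?thesis
  proof (intro conjI allI impI)
    obtain C N where C: "C \<ge> 0" "N \<ge> 1"
      "\<And>n a X Y. n \<ge> N \<Longrightarrow> sob_le 1 a X \<Longrightarrow> sob_le 1 (An n a) Y \<Longrightarrow> sob_le 1 a (C * Y)"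
      using stable[OF order_refl] by blast
    have unique: "\<exists>!\<psi>. solves_nystrom n \<nu> \<eta> M H HT D f g \<psi>" if n: "n \<ge> N" for n f g
    proof -
      have n1: "n \<ge> 1" using n C(2) by simp
      have zero: "c m = 0" if c: "h1 c" "\<And>m. An n c m = 0" for c m
      proof -
        obtain X where X: "sob_le 1 c X" using c(1) by (auto simp: h1_def)
        have "sob_le 1 (An n c) 0" using c(2) by (simp add: sob_le_def)
        from C(3)[OF n X this] show ?thesis using sob_le_zeroD[of 1 c m] by simp
      qed
      have maps: "An n c \<in> trig_coeffs n" if c: "c \<in> trig_coeffs n" for c
      proof -
        have "h1 (Bn n c)" using linBn[OF n1] trig_coeffs_h1[OF c] by (auto simp: linear_seq_def)
        then have "interp n (Bn n c) \<in> trig_coeffs n" using interp_in_trig_coeffs[OF n1 h1_l1] by blast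
        with c show ?thesis by (auto simp: trig_coeffs_def An_def)
      qed
      have "\<exists>b\<in>trig_coeffs n. An n b = dft n (\<lambda>t. - g t + \<i> * of_real \<eta> * f t)"
        by (rule trig_coeffs_injective_imp_surjective[OF linAn[OF n1] maps _ dft_in_trig_coeffs[OF n1]])
           (auto intro: zero trig_coeffs_h1)
      then obtain b where b: "b \<in> trig_coeffs n" "An n b = dft n (\<lambda>t. - g t + \<i> * of_real \<eta> * f t)" by blast
      show ?thesis
      proof (rule ex1I[of _ "fser b"])
        show "solves_nystrom n \<nu> \<eta> M H HT D f g (fser b)" unfolding nys[OF n1] using b by blast
        fix \<psi> assume "solves_nystrom n \<nu> \<eta> M H HT D f g \<psi>"
        then obtain b' where b': "b' \<in> trig_coeffs n" "\<psi> = fser b'" "An n b' = An n b"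
          unfolding nys[OF n1] b(2) by blast
        note h = trig_coeffs_h1[OF b'(1)] trig_coeffs_h1[OF b(1)]
        have "b' m - b m = 0" for m
          by (rule zero[OF h1_diff[OF h]]) (simp add: linear_seqD(3)[OF linAn[OF n1] h] b'(3))
        then have "b' = b" by (auto simp: fun_eq_iff)
        then show "\<psi> = fser b" using b'(2) by simp
      qed
    qed
    show "\<forall>\<^sub>F n in sequentially. \<forall>u. incident_field x nv (k 1) u \<longrightarrow>
            (\<exists>!\<psi>\<^sub>n. solves_nystrom n \<nu> \<eta> M H HT D (data_f x u) (data_g x nv u) \<psi>\<^sub>n)"
      unfolding eventually_sequentially by (intro exI[of _ N] allI impI unique)
  next
    fix p q :: real assume p: "p \<ge> 1" and q: "q \<ge> 0"
    obtain C N where C: "C \<ge> 0" "N \<ge> 1"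
      "\<And>n a X Y. n \<ge> N \<Longrightarrow> sob_le p a X \<Longrightarrow> sob_le p (An n a) Y \<Longrightarrow> sob_le p a (C * Y)"
      using stable[OF p] by blast
    obtain E where E: "E \<ge> 0" "\<And>n a b X. n \<ge> 1 \<Longrightarrow> sob_le (p + q) a X \<Longrightarrow> h1 b \<Longrightarrow>
       (\<And>m. ?c0 * b m + interp n (Bn n b) m = interp n (\<lambda>m. ?c0 * a m + B a m) m) \<Longrightarrow>
       sob_le p (\<lambda>m. ?c0 * (b m - a m) + interp n (Bn n (\<lambda>m. b m - a m)) m) (E * real n powr (- 2 * q) * X)"
      using nystrom_residual[OF apB p q, of ?c0] by blast
    show "\<exists>C. \<forall>\<^sub>F n in sequentially. \<forall>u \<psi> \<psi>\<^sub>n.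
               incident_field x nv (k 1) u \<longrightarrow>
               solves_scfie x nv k \<nu> \<eta>
                 (\<lambda>t. - data_g x nv u t + \<i> * of_real \<eta> * data_f x u t) \<psi> \<longrightarrow>
               \<psi> \<in> sobolev (p + q) \<longrightarrow>
               solves_nystrom n \<nu> \<eta> M H HT D (data_f x u) (data_g x nv u) \<psi>\<^sub>n \<longrightarrow>
               sobolev_norm p (\<lambda>t. \<psi>\<^sub>n t - \<psi> t)
                 \<le> C * real n powr (- q) * sobolev_norm (p + q) \<psi>"
    proof (rule exI[of _ "sqrt (C * E)"], unfold eventually_sequentially, intro exI[of _ N] allI impI)
      fix n u \<psi> \<psi>\<^sub>n
      assume n: "N \<le> n" and u: "incident_field x nv (k 1) u"
        and \<psi>: "solves_scfie x nv k \<nu> \<eta> (\<lambda>t. - data_g x nv u t + \<i> * of_real \<eta> * data_f x u t) \<psi>"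
        and \<psi>S: "\<psi> \<in> sobolev (p + q)"
        and \<psi>n: "solves_nystrom n \<nu> \<eta> M H HT D (data_f x u) (data_g x nv u) \<psi>\<^sub>n"
      define h where "h = (\<lambda>t. - data_g x nv u t + \<i> * of_real \<eta> * data_f x u t)"
      define a where "a = fourier_coeff \<psi>"
      have n1: "n \<ge> 1" using n C(2) by simp
      have pq: "p + q \<ge> 1" using p q by simp
      have ha: "h1 a" and ae: "AE t in lborel. t \<in> {0..2*pi} \<longrightarrow> \<psi> t = fser a t"
        using sobolev_AE_fser[OF \<psi>S pq] by (simp_all add: a_def)
      have la: "l1 a" by (rule h1_l1[OF ha])
      have m\<psi>: "\<psi> \<in> borel_measurable borel" using \<psi>S by (simp add: sobolev_def)
      \<comment> \<open>the integral terms do not see the null set on which \<open>\<psi>\<close> differs from its Fourier series, but the identity term does\<close>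
      have lin\<psi>: "scfie_op x nv k \<nu> \<eta> \<psi> t = ?c0 * (\<psi> t - fser a t) + scfie_op x nv k \<nu> \<eta> (fser a) t" for t
      proof -
        have j: "(1::nat) \<in> {1, 2}" "(2::nat) \<in> {1, 2}" by auto
        have wm: "w_log \<in> borel_measurable borel" "w_sin2log \<in> borel_measurable borel"
          unfolding w_log_def w_sin2log_def by measurable
        have 1: "integral_op (kernel_HT x nv (k 2)) \<psi> = integral_op (kernel_HT x nv (k 2)) (fser a)"
          by (rule integral_op_cong_AE[OF wm(2) split_HT[OF j(2)] m\<psi> borel_measurable_fser[OF la] ae])
        have 2: "integral_op (kernel_M x (k 2)) \<psi> = integral_op (kernel_M x (k 2)) (fser a)"
          by (rule integral_op_cong_AE[OF wm(1) split_M[OF j(2)] m\<psi> borel_measurable_fser[OF la] ae])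
        let ?T = "integral_op (kernel_HT x nv (k 2)) (fser a)"
        have "l1 (KT id 2 a)" "?T = fser (KT id 2 a)" using repKT[OF j(2)] la by (auto simp: represents_def)
        then have mT [measurable]: "?T \<in> borel_measurable borel" by (simp add: borel_measurable_fser)
        note [measurable] = m\<psi> borel_measurable_fser[OF la]
        have aec: "AE t in lborel. t \<in> {0..2*pi} \<longrightarrow> c * \<psi> t + d * ?T t = c * fser a t + d * ?T t" for c d
          using ae by eventually_elim simp
        have 3: "integral_op (kernel_HT x nv (k 2)) (\<lambda>s. c * \<psi> s + d * ?T s) = integral_op (kernel_HT x nv (k 2)) (\<lambda>s. c * fser a s + d * ?T s)" for c d
          by (rule integral_op_cong_AE[OF wm(2) split_HT[OF j(2)] _ _ aec]) measurable
        have 4: "integral_op (kernel_HT x nv (k 1)) (\<lambda>s. c * \<psi> s + d * ?T s) = integral_op (kernel_HT x nv (k 1)) (\<lambda>s. c * fser a s + d * ?T s)" for c d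
          by (rule integral_op_cong_AE[OF wm(2) split_HT[OF j(1)] _ _ aec]) measurable
        have 5: "integral_op (kernel_M x (k 1)) (\<lambda>s. c * \<psi> s + d * ?T s) = integral_op (kernel_M x (k 1)) (\<lambda>s. c * fser a s + d * ?T s)" for c d
          by (rule integral_op_cong_AE[OF wm(1) split_M[OF j(1)] _ _ aec]) measurable
        define \<gamma> where "\<gamma> = complex_of_real ((1 + \<nu>) / 2)"
        show ?thesis
          unfolding scfie_op_def scfie_lhs_def 1 2 \<gamma>_def[symmetric]
          using 3[of "of_real \<nu>" "- 2"] 4[of 1 2] 5[of 1 2] by (simp add: algebra_simps)
      qed
      have aeA: "AE t in lborel. t \<in> {0..2*pi} \<longrightarrow> scfie_op x nv k \<nu> \<eta> (fser a) t = h t"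
        using \<psi>[unfolded solves_scfie_def, THEN conjunct2] ae by eventually_elim (auto simp: lin\<psi> h_def)
      have Aa: "scfie_op x nv k \<nu> \<eta> (fser a) = fser (A a)" "l1 (A a)"
        using repA la by (auto simp: represents_def)
      have ch: "continuous_on UNIV h" unfolding h_def by (rule incident_data_continuous[OF curve u])
      \<comment> \<open>both sides are continuous, so the equation for the Fourier series holds at every point, in particular at the nodes\<close>
      have hA: "h t = fser (A a) t" if "t \<in> {0..2*pi}" for t
        using AE_imp_all_continuous[OF aeA[unfolded Aa(1)] continuous_on_fser[OF Aa(2)] ch that] by simp
      have dh: "dft n h = interp n (A a)"
        using dft_cong[of h "fser (A a)" n] hA n1 dft_fser[OF n1 Aa(2)] by simp
      obtain b where b: "b \<in> trig_coeffs n" "\<psi>\<^sub>n = fser b" "An n b = dft n h"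
        using \<psi>n unfolding nys[OF n1] h_def by blast
      have hb: "h1 b" by (rule trig_coeffs_h1[OF b(1)])
      define X where "X = (sobolev_norm (p + q) \<psi>)\<^sup>2"
      have aX: "sob_le (p + q) a X" unfolding a_def X_def by (rule sobolev_sob_le[OF \<psi>S])
      have eq: "?c0 * b m + interp n (Bn n b) m = interp n (\<lambda>m. ?c0 * a m + B a m) m" for m
        using fun_cong[OF b(3)[unfolded dh], of m] by (simp add: An_def A_def)
      have res: "sob_le p (An n (\<lambda>m. b m - a m)) (E * real n powr (- 2 * q) * X)"
        using E(2)[OF n1 aX hb eq] by (simp add: An_def)
      have "p \<le> p + q" using q by simp
      then have "sob_le p a X" by (rule sob_le_mono_exponent[OF aX])
      moreover obtain Y where "sob_le p b Y" using trig_coeffs_sob_le[OF b(1)] by blast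
      ultimately have "sob_le p (\<lambda>m. b m - a m) (2 * Y + 2 * X)" by (intro sob_le_diff)
      from C(3)[OF n this res] have err: "sob_le p (\<lambda>m. b m - a m) (C * (E * real n powr (- 2 * q) * X))" .
      have fc: "fourier_coeff (\<lambda>t. \<psi>\<^sub>n t - \<psi> t) m = b m - a m" for m
      proof -
        have lb: "l1 b" by (rule h1_l1[OF hb])
        have "fourier_coeff (\<lambda>t. \<psi>\<^sub>n t - \<psi> t) m = fourier_coeff (fser (\<lambda>m. 1 * b m + (- 1) * a m)) m"
        proof (rule fourier_coeff_cong_AE)
          show "(\<lambda>t. \<psi>\<^sub>n t - \<psi> t) \<in> borel_measurable borel"
            unfolding b(2) by (intro borel_measurable_diff borel_measurable_fser lb m\<psi>)
          show "fser (\<lambda>m. 1 * b m + (- 1) * a m) \<in> borel_measurable borel"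
            by (intro borel_measurable_fser l1_combine lb la)
          show "AE t in lborel. t \<in> {0..2*pi} \<longrightarrow> \<psi>\<^sub>n t - \<psi> t = fser (\<lambda>m. 1 * b m + (- 1) * a m) t"
            using ae by eventually_elim (simp only: b(2) fser_combine[OF lb la], simp)
        qed
        also have "\<dots> = 1 * b m + (- 1) * a m" by (intro fourier_coeff_fser l1_combine lb la)
        finally show ?thesis by simp
      qed
      have "sobolev_norm p (\<lambda>t. \<psi>\<^sub>n t - \<psi> t) = sqrt (\<Sum>\<^sub>\<infinity>m. sobw p m * (norm (b m - a m))\<^sup>2)"
        by (simp add: sobolev_norm_def fc sobw_def)
      also have "\<dots> \<le> sqrt (C * (E * real n powr (- 2 * q) * X))"
        by (intro real_sqrt_le_mono sob_le_summable(2)[OF err])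
      also have "C * (E * real n powr (- 2 * q) * X) = C * E * (real n powr (- q) * sobolev_norm (p + q) \<psi>)\<^sup>2"
      proof -
        have "real n powr (- 2 * q) = real n powr (- q) * real n powr (- q)"
          by (simp flip: powr_add)
        then show ?thesis by (simp add: X_def power2_eq_square)
      qed
      also have "sqrt \<dots> = sqrt (C * E) * real n powr (- q) * sobolev_norm (p + q) \<psi>"
        using C(1) E(1) by (simp add: real_sqrt_mult sobolev_norm_def infsum_nonneg)
      finally show "sobolev_norm p (\<lambda>t. \<psi>\<^sub>n t - \<psi> t)
        \<le> sqrt (C * E) * real n powr (- q) * sobolev_norm (p + q) \<psi>" .
    qed
  qed
qed

end
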